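(* Let $G$ be an abelian group, let $D$ be a finite-dimensional $G$-graded-division algebra over a field $\mathbb F$, let $V$ be a nonzero $G$-graded right $D$-module of finite rank, and let $\varphi$ be a (degree-preserving) involution on the graded algebra $R=\mathrm{End}_D(V)$. Assume that $(R,\varphi)$ is central simple as an algebra with involution. Then $D$ admits a degree-preserving involution of the same kind as $\varphi$, and for any such involution $\varphi_0$, there exists a nondegenerate homogeneous $\varphi_0$-sesquilinear form $B:V\times V\to D$ such that $\varphi$ is the adjunction with respect to $B$. Moreover: (i) If $R$ is central simple over $\mathbb F$ and $\mathrm{char}\,\mathbb F\ne2$, then $B$ is determined up to a nonzero factor in $\mathbb F$ and is hermitian if $\varphi$ and $\varphi_0$ have the same type (orthogonal or symplectic) and skew-hermitian if they have the opposite type; (ii) If $R$ is central simple over $\mathbb F$ and $\mathrm{char}\,\mathbb F=2$, then $B$ is determined up to a nonzero factor in $\mathbb F$ and is hermitian; (iii) If $R$ is not central simple over $\mathbb F$, then $B$ can be chosen hermitian, and this condition determines it up to a nonzero factor in $\mathbb F$.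
   Context: All algebras are associative over an arbitrary field $\mathbb F$. A graded-division algebra is a unital $G$-graded algebra in which all nonzero homogeneous elements are invertible. $R=\mathrm{End}_D(V)$ is graded by $R_g=\{r\in R\mid rV_h\subset V_{gh}\ \forall h\in G\}$. Involutions are $\mathbb F$-linear antiautomorphisms of order at most 2; degree-preserving means each homogeneous component is mapped to itself. A finite-dimensional algebra with involution $(R,\varphi)$ is central simple as an algebra with involution if it has no proper nonzero $\varphi$-invariant two-sided ideals and the set of $\varphi$-symmetric elements of the center $Z(R)$ is $\mathbb F$. Then $\mathbb K=Z(R)$ is $\mathbb F$ (first kind), or a separable quadratic field extension of $\mathbb F$ (second kind), or isomorphic to $\mathbb F\times\mathbb F$ (exchange type). The centers of $R=\mathrm{End}_D(V)$ and of $D$ are identified as graded algebras; an involution $\varphi_0$ of $D$ is "of the same kind as $\varphi$" if it induces the same involution as $\varphi$ on this common center $\mathbb K$ (i.e., the identity if $\mathbb K=\mathbb F$ and the nontrivial $\mathbb F$-automorphism otherwise). A $\varphi_0$-sesquilinear form is an $\mathbb F$-bilinear $B:V\times V\to D$ with $B(vd,w)=\varphi_0(d)B(v,w)$, $B(v,wd)=B(v,w)d$. It is homogeneous of degree $g_0$ if $B(V_a,V_b)\subset D_{g_0ab}$ for all $a,b\in G$; hermitian (resp. skew-hermitian) if $B(w,v)=\delta\varphi_0(B(v,w))$ for all $v,w$ with $\delta=1$ (resp. $\delta=-1$). $\varphi$ is the adjunction with respect to $B$ if $B(rv,w)=B(v,\varphi(r)w)$ for all $r\in R$, $v,w\in V$.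 *)

theory Defs
  imports
    "HOL-Library.Function_Algebras"
    "HOL-Algebra.Algebraic_Closure_Type"
    "Jordan_Normal_Form.Matrix"
begin

text \<open>
  The grading group \<open>'g\<close> is written additively, so degrees satisfy \<open>deg (x y) = deg x + deg y\<close>.
  The algebra \<open>D\<close> and the module \<open>V\<close> are types with explicit scalar actions, whereas \<open>End\<^sub>D(V)\<close>
  is a set of functions with composition as product.  Notions needed for both algebras therefore
  take an explicit carrier \<open>A\<close>, product \<open>mul\<close>, unit \<open>e\<close> and scalar multiplication \<open>scl\<close>;
  addition is that of the ambient type (pointwise for functions).
\<close>

locale graded_vector_space = vector_space scl
  for scl :: "'f::field \<Rightarrow> 'a::ab_group_add \<Rightarrow> 'a" (infixr "*s" 75) +
  fixes Ag :: "'g::ab_group_add \<Rightarrow> 'a set"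
  assumes subspace_comp: "subspace (Ag g)"
    and direct_sum:
      "\<exists>!p :: 'g \<Rightarrow> 'a. finite {g. p g \<noteq> 0} \<and> (\<forall>g. p g \<in> Ag g) \<and> x = (\<Sum>g\<in>{g. p g \<noteq> 0}. p g)"

locale graded_algebra = graded_vector_space scl Ag
  for scl :: "'f::field \<Rightarrow> 'a::ring_1 \<Rightarrow> 'a" (infixr "*s" 75)
    and Ag :: "'g::ab_group_add \<Rightarrow> 'a set" +
  assumes scl_mult_left: "(c *s x) * y = c *s (x * y)"
    and scl_mult_right: "x * (c *s y) = c *s (x * y)"
    and comp_mult: "x \<in> Ag g \<Longrightarrow> y \<in> Ag h \<Longrightarrow> x * y \<in> Ag (g + h)"

locale graded_division_algebra = graded_algebra scl Ag
  for scl :: "'f::field \<Rightarrow> 'a::ring_1 \<Rightarrow> 'a" (infixr "*s" 75)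
    and Ag :: "'g::ab_group_add \<Rightarrow> 'a set" +
  assumes homogeneous_invertible: "x \<in> Ag g \<Longrightarrow> x \<noteq> 0 \<Longrightarrow> \<exists>y. x * y = 1 \<and> y * x = 1"

text \<open>The scalar multiplication that a right \<open>D\<close>-module inherits along \<open>c \<mapsto> c 1\<^sub>D\<close>.\<close>

definition module_scale :: "('f \<Rightarrow> 'd::ring_1 \<Rightarrow> 'd) \<Rightarrow> ('v \<Rightarrow> 'd \<Rightarrow> 'v) \<Rightarrow> 'f \<Rightarrow> 'v \<Rightarrow> 'v" where
  "module_scale sD act c v = act v (sD c 1)"

locale graded_right_module = D: graded_algebra sD Dg
  for sD :: "'f::field \<Rightarrow> 'd::ring_1 \<Rightarrow> 'd"
    and Dg :: "'g::ab_group_add \<Rightarrow> 'd set" +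
  fixes act :: "'v::ab_group_add \<Rightarrow> 'd \<Rightarrow> 'v" (infixl "\<cdot>" 75)
    and Vg :: "'g \<Rightarrow> 'v set"
  assumes act_add_left: "(v + w) \<cdot> d = v \<cdot> d + w \<cdot> d"
    and act_add_right: "v \<cdot> (d + d') = v \<cdot> d + v \<cdot> d'"
    and act_mult: "v \<cdot> (d * d') = (v \<cdot> d) \<cdot> d'"
    and act_one: "v \<cdot> 1 = v"
    and graded_space: "graded_vector_space (module_scale sD act) Vg"
    and act_comp: "v \<in> Vg g \<Longrightarrow> d \<in> Dg h \<Longrightarrow> v \<cdot> d \<in> Vg (g + h)"

definition finite_basis_on ::
  "'a::comm_monoid_add set \<Rightarrow> ('c::zero \<Rightarrow> 'a \<Rightarrow> 'a) \<Rightarrow> 'a set \<Rightarrow> bool" where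
  "finite_basis_on A scl E \<longleftrightarrow>
     finite E \<and> E \<subseteq> A \<and>
     (\<forall>x\<in>A. \<exists>c. x = (\<Sum>b\<in>E. scl (c b) b)) \<and>
     (\<forall>c. (\<Sum>b\<in>E. scl (c b) b) = 0 \<longrightarrow> (\<forall>b\<in>E. c b = 0))"

definition finite_rank :: "('v::ab_group_add \<Rightarrow> 'd::ring_1 \<Rightarrow> 'v) \<Rightarrow> bool" where
  "finite_rank act \<longleftrightarrow> (\<exists>E. finite_basis_on UNIV (\<lambda>d v. act v d) E)"

definition End_D :: "('v::ab_group_add \<Rightarrow> 'd::ring_1 \<Rightarrow> 'v) \<Rightarrow> ('v \<Rightarrow> 'v) set" where
  "End_D act = {r. (\<forall>v w. r (v + w) = r v + r w) \<and> (\<forall>v d. r (act v d) = act (r v) d)}"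

definition End_scale ::
  "('f \<Rightarrow> 'd::ring_1 \<Rightarrow> 'd) \<Rightarrow> ('v \<Rightarrow> 'd \<Rightarrow> 'v) \<Rightarrow> 'f \<Rightarrow> ('v \<Rightarrow> 'v) \<Rightarrow> ('v \<Rightarrow> 'v)" where
  "End_scale sD act c r = (\<lambda>v. module_scale sD act c (r v))"

definition End_comp ::
  "('v::ab_group_add \<Rightarrow> 'd::ring_1 \<Rightarrow> 'v) \<Rightarrow> ('g::ab_group_add \<Rightarrow> 'v set) \<Rightarrow> 'g \<Rightarrow> ('v \<Rightarrow> 'v) set" where
  "End_comp act Vg g = {r \<in> End_D act. \<forall>h. r ` Vg h \<subseteq> Vg (g + h)}"

definition involution_on ::
  "'a::ab_group_add set \<Rightarrow> ('a \<Rightarrow> 'a \<Rightarrow> 'a) \<Rightarrow> ('f \<Rightarrow> 'a \<Rightarrow> 'a) \<Rightarrow> ('a \<Rightarrow> 'a) \<Rightarrow> bool" where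
  "involution_on A mul scl \<phi> \<longleftrightarrow>
     (\<forall>x\<in>A. \<phi> x \<in> A) \<and>
     (\<forall>x\<in>A. \<forall>y\<in>A. \<phi> (x + y) = \<phi> x + \<phi> y) \<and>
     (\<forall>c. \<forall>x\<in>A. \<phi> (scl c x) = scl c (\<phi> x)) \<and>
     (\<forall>x\<in>A. \<forall>y\<in>A. \<phi> (mul x y) = mul (\<phi> y) (\<phi> x)) \<and>
     (\<forall>x\<in>A. \<phi> (\<phi> x) = x)"

definition degree_preserving :: "('g \<Rightarrow> 'a set) \<Rightarrow> ('a \<Rightarrow> 'a) \<Rightarrow> bool" where
  "degree_preserving Ag \<phi> \<longleftrightarrow> (\<forall>g. \<phi> ` Ag g \<subseteq> Ag g)"

definition center_on :: "'a set \<Rightarrow> ('a \<Rightarrow> 'a \<Rightarrow> 'a) \<Rightarrow> 'a set" where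
  "center_on A mul = {z \<in> A. \<forall>x\<in>A. mul z x = mul x z}"

definition two_sided_ideal_on ::
  "'a::ab_group_add set \<Rightarrow> ('a \<Rightarrow> 'a \<Rightarrow> 'a) \<Rightarrow> 'a set \<Rightarrow> bool" where
  "two_sided_ideal_on A mul I \<longleftrightarrow>
     I \<subseteq> A \<and> 0 \<in> I \<and> (\<forall>x\<in>I. \<forall>y\<in>I. x - y \<in> I) \<and>
     (\<forall>a\<in>A. \<forall>x\<in>I. mul a x \<in> I \<and> mul x a \<in> I)"

definition central_simple_on ::
  "'a::ab_group_add set \<Rightarrow> ('a \<Rightarrow> 'a \<Rightarrow> 'a) \<Rightarrow> 'a \<Rightarrow> ('f \<Rightarrow> 'a \<Rightarrow> 'a) \<Rightarrow> bool" where
  "central_simple_on A mul e scl \<longleftrightarrow>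
     A \<noteq> {0} \<and>
     (\<forall>I. two_sided_ideal_on A mul I \<longrightarrow> I = {0} \<or> I = A) \<and>
     center_on A mul = range (\<lambda>c. scl c e)"

definition central_simple_with_involution_on ::
  "'a::ab_group_add set \<Rightarrow> ('a \<Rightarrow> 'a \<Rightarrow> 'a) \<Rightarrow> 'a \<Rightarrow> ('f \<Rightarrow> 'a \<Rightarrow> 'a) \<Rightarrow> ('a \<Rightarrow> 'a) \<Rightarrow> bool" where
  "central_simple_with_involution_on A mul e scl \<phi> \<longleftrightarrow>
     A \<noteq> {0} \<and>
     (\<forall>I. two_sided_ideal_on A mul I \<and> \<phi> ` I \<subseteq> I \<longrightarrow> I = {0} \<or> I = A) \<and>
     {z \<in> center_on A mul. \<phi> z = z} = range (\<lambda>c. scl c e)"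

text \<open>
  \<open>\<rho>\<close> is a unital homomorphism from \<open>A\<close> to the \<open>n \<times> n\<close> matrices over the algebraic closure \<open>L\<close>
  of the ground field, and its \<open>L\<close>-linear extension to the scalar extension of \<open>A\<close> to \<open>L\<close> is an
  isomorphism.  The latter is expressed by saying that some basis of \<open>A\<close> is mapped to an
  \<open>L\<close>-basis of the matrix algebra (entrywise, as \<open>'a mat\<close> has no addition class).
\<close>

definition splitting_on ::
  "'a::ab_group_add set \<Rightarrow> ('a \<Rightarrow> 'a \<Rightarrow> 'a) \<Rightarrow> 'a \<Rightarrow> ('f::field \<Rightarrow> 'a \<Rightarrow> 'a) \<Rightarrow>
   nat \<Rightarrow> ('a \<Rightarrow> 'f alg_closure mat) \<Rightarrow> bool" where
  "splitting_on A mul e scl n \<rho> \<longleftrightarrow>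
     (\<forall>x\<in>A. \<rho> x \<in> carrier_mat n n) \<and>
     (\<forall>x\<in>A. \<forall>y\<in>A. \<rho> (x + y) = \<rho> x + \<rho> y) \<and>
     (\<forall>c. \<forall>x\<in>A. \<rho> (scl c x) = to_ac c \<cdot>\<^sub>m \<rho> x) \<and>
     (\<forall>x\<in>A. \<forall>y\<in>A. \<rho> (mul x y) = \<rho> x * \<rho> y) \<and>
     \<rho> e = 1\<^sub>m n \<and>
     (\<exists>E. finite_basis_on A scl E \<and>
        (\<forall>M\<in>carrier_mat n n. \<exists>c. \<forall>i<n. \<forall>j<n. M $$ (i, j) = (\<Sum>b\<in>E. c b * \<rho> b $$ (i, j))) \<and>
        (\<forall>c. (\<forall>i<n. \<forall>j<n. (\<Sum>b\<in>E. c b * \<rho> b $$ (i, j)) = 0) \<longrightarrow> (\<forall>b\<in>E. c b = 0)))"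

definition bilinear_of_mat :: "'l::comm_ring_1 mat \<Rightarrow> 'l vec \<Rightarrow> 'l vec \<Rightarrow> 'l" where
  "bilinear_of_mat \<Phi> x y = x \<bullet> (\<Phi> *\<^sub>v y)"

text \<open>After extension of scalars to \<open>L\<close>, \<open>\<sigma>\<close> is the adjunction for the nondegenerate bilinear
  form on \<open>L\<^sup>n\<close> with Gram matrix \<open>\<Phi>\<close>.  In characteristic different from 2,
  every involution of the first kind on a finite-dimensional central simple algebra is of exactly
  one of the two types below; in characteristic 2 an alternating form is also symmetric.\<close>

definition adjunction_after_splitting ::
  "'a::ab_group_add set \<Rightarrow> ('a \<Rightarrow> 'a \<Rightarrow> 'a) \<Rightarrow> 'a \<Rightarrow> ('f::field \<Rightarrow> 'a \<Rightarrow> 'a) \<Rightarrow> ('a \<Rightarrow> 'a) \<Rightarrow>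
   nat \<Rightarrow> 'f alg_closure mat \<Rightarrow> bool" where
  "adjunction_after_splitting A mul e scl \<sigma> n \<Phi> \<longleftrightarrow>
     \<Phi> \<in> carrier_mat n n \<and> invertible_mat \<Phi> \<and>
     (\<exists>\<rho>. splitting_on A mul e scl n \<rho> \<and>
        (\<forall>a\<in>A. \<forall>x\<in>carrier_vec n. \<forall>y\<in>carrier_vec n.
           bilinear_of_mat \<Phi> (\<rho> a *\<^sub>v x) y = bilinear_of_mat \<Phi> x (\<rho> (\<sigma> a) *\<^sub>v y)))"

definition orthogonal_type ::
  "'a::ab_group_add set \<Rightarrow> ('a \<Rightarrow> 'a \<Rightarrow> 'a) \<Rightarrow> 'a \<Rightarrow> ('f::field \<Rightarrow> 'a \<Rightarrow> 'a) \<Rightarrow> ('a \<Rightarrow> 'a) \<Rightarrow> bool" where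
  "orthogonal_type A mul e scl \<sigma> \<longleftrightarrow>
     (\<exists>n \<Phi>. adjunction_after_splitting A mul e scl \<sigma> n \<Phi> \<and>
        (\<forall>x\<in>carrier_vec n. \<forall>y\<in>carrier_vec n. bilinear_of_mat \<Phi> x y = bilinear_of_mat \<Phi> y x))"

definition symplectic_type ::
  "'a::ab_group_add set \<Rightarrow> ('a \<Rightarrow> 'a \<Rightarrow> 'a) \<Rightarrow> 'a \<Rightarrow> ('f::field \<Rightarrow> 'a \<Rightarrow> 'a) \<Rightarrow> ('a \<Rightarrow> 'a) \<Rightarrow> bool" where
  "symplectic_type A mul e scl \<sigma> \<longleftrightarrow>
     (\<exists>n \<Phi>. adjunction_after_splitting A mul e scl \<sigma> n \<Phi> \<and>
        (\<forall>x\<in>carrier_vec n. bilinear_of_mat \<Phi> x x = 0))"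

text \<open>The center of \<open>D\<close> is identified with that of \<open>End\<^sub>D(V)\<close> by letting \<open>z\<close> act as \<open>v \<mapsto> v z\<close>.\<close>

definition same_kind ::
  "('v \<Rightarrow> 'd::ring_1 \<Rightarrow> 'v) \<Rightarrow> (('v \<Rightarrow> 'v) \<Rightarrow> ('v \<Rightarrow> 'v)) \<Rightarrow> ('d \<Rightarrow> 'd) \<Rightarrow> bool" where
  "same_kind act \<phi> \<phi>0 \<longleftrightarrow>
     (\<forall>z\<in>center_on UNIV (*). \<phi> (\<lambda>v. act v z) = (\<lambda>v. act v (\<phi>0 z)))"

definition sesquilinear ::
  "('f::field \<Rightarrow> 'd::ring_1 \<Rightarrow> 'd) \<Rightarrow> ('v::ab_group_add \<Rightarrow> 'd \<Rightarrow> 'v) \<Rightarrow> ('d \<Rightarrow> 'd) \<Rightarrow>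
   ('v \<Rightarrow> 'v \<Rightarrow> 'd) \<Rightarrow> bool" where
  "sesquilinear sD act \<phi>0 B \<longleftrightarrow>
     (\<forall>w. Vector_Spaces.linear (module_scale sD act) sD (\<lambda>v. B v w)) \<and>
     (\<forall>v. Vector_Spaces.linear (module_scale sD act) sD (B v)) \<and>
     (\<forall>v w d. B (act v d) w = \<phi>0 d * B v w) \<and>
     (\<forall>v w d. B v (act w d) = B v w * d)"

definition homogeneous_form ::
  "('g::ab_group_add \<Rightarrow> 'd set) \<Rightarrow> ('g \<Rightarrow> 'v set) \<Rightarrow> ('v \<Rightarrow> 'v \<Rightarrow> 'd) \<Rightarrow> bool" where
  "homogeneous_form Dg Vg B \<longleftrightarrow>
     (\<exists>g0. \<forall>a b. \<forall>v\<in>Vg a. \<forall>w\<in>Vg b. B v w \<in> Dg (g0 + a + b))"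

definition nondegenerate :: "('v::zero \<Rightarrow> 'v \<Rightarrow> 'd::zero) \<Rightarrow> bool" where
  "nondegenerate B \<longleftrightarrow>
     (\<forall>v. (\<forall>w. B v w = 0) \<longrightarrow> v = 0) \<and> (\<forall>w. (\<forall>v. B v w = 0) \<longrightarrow> w = 0)"

definition hermitian :: "('d \<Rightarrow> 'd) \<Rightarrow> ('v \<Rightarrow> 'v \<Rightarrow> 'd) \<Rightarrow> bool" where
  "hermitian \<phi>0 B \<longleftrightarrow> (\<forall>v w. B w v = \<phi>0 (B v w))"

definition skew_hermitian :: "('d::ring_1 \<Rightarrow> 'd) \<Rightarrow> ('v \<Rightarrow> 'v \<Rightarrow> 'd) \<Rightarrow> bool" where
  "skew_hermitian \<phi>0 B \<longleftrightarrow> (\<forall>v w. B w v = - \<phi>0 (B v w))"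

definition is_adjunction ::
  "('v::ab_group_add \<Rightarrow> 'd::ring_1 \<Rightarrow> 'v) \<Rightarrow> (('v \<Rightarrow> 'v) \<Rightarrow> ('v \<Rightarrow> 'v)) \<Rightarrow>
   ('v \<Rightarrow> 'v \<Rightarrow> 'd) \<Rightarrow> bool" where
  "is_adjunction act \<phi> B \<longleftrightarrow> (\<forall>r\<in>End_D act. \<forall>v w. B (r v) w = B v (\<phi> r w))"

definition adjoint_forms ::
  "('f::field \<Rightarrow> 'd::ring_1 \<Rightarrow> 'd) \<Rightarrow> ('g::ab_group_add \<Rightarrow> 'd set) \<Rightarrow>
   ('v::ab_group_add \<Rightarrow> 'd \<Rightarrow> 'v) \<Rightarrow> ('g \<Rightarrow> 'v set) \<Rightarrow> (('v \<Rightarrow> 'v) \<Rightarrow> ('v \<Rightarrow> 'v)) \<Rightarrow>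
   ('d \<Rightarrow> 'd) \<Rightarrow> ('v \<Rightarrow> 'v \<Rightarrow> 'd) set" where
  "adjoint_forms sD Dg act Vg \<phi> \<phi>0 =
     {B. sesquilinear sD act \<phi>0 B \<and> homogeneous_form Dg Vg B \<and> nondegenerate B \<and>
         is_adjunction act \<phi> B}"

definition unique_up_to_factor ::
  "('f::field \<Rightarrow> 'd \<Rightarrow> 'd) \<Rightarrow> ('v \<Rightarrow> 'v \<Rightarrow> 'd) set \<Rightarrow> bool" where
  "unique_up_to_factor sD \<B> \<longleftrightarrow>
     (\<forall>B\<in>\<B>. \<forall>B'. B' \<in> \<B> \<longleftrightarrow> (\<exists>c. c \<noteq> 0 \<and> B' = (\<lambda>v w. sD c (B v w))))"

end

theory Submission
  imports Defs
begin

text \<open>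
  Choose a homogeneous vector \<open>v1\<close> and a homogeneous functional \<open>f\<close> with \<open>f v1 = 1\<close>; then
  \<open>\<theta> v = (x \<mapsto> v (f x))\<close> embeds \<open>V\<close> as a left ideal of \<open>R\<close>, and \<open>e = \<theta> v1\<close> is an idempotent
  with \<open>e R e = D\<close>.  Since \<open>\<phi>\<close> is an involution that preserves the nonzero graded space
  \<open>e R \<phi>(e)\<close>, this space contains a homogeneous \<open>r \<noteq> 0\<close> with \<open>\<phi> r = \<plusminus> r\<close>.  The form
  \<open>B0 v w = r \<phi>(\<theta> v) (\<theta> w)\<close>, read in \<open>e R e = D\<close>, is sesquilinear for the involution
  \<open>\<psi> d = r \<phi>(d) r\<^sup>-\<^sup>1\<close> of \<open>D\<close>, and \<open>\<phi>\<close> is its adjunction.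

  For an arbitrary \<open>\<phi>0\<close> of the same kind, \<open>\<phi>0 \<circ> \<psi>\<close> is trivial on the centre, so it is conjugation
  by a homogeneous \<open>u\<close> (graded Skolem--Noether), and \<open>u B0\<close> is the required form.  Every adjoint form
  is \<open>c B0\<close> with \<open>c\<close> homogeneous, so two of them differ by a central factor; the symmetry
  \<open>B w v = \<phi>0 (B v w) \<epsilon>\<close> has a central \<open>\<epsilon>\<close> with \<open>\<phi>0(\<epsilon>) \<epsilon> = 1\<close>, which is a sign if the centre is the ground field
  and is removed by Hilbert 90 otherwise.  To identify the sign, \<open>f\<close> is represented by a vector \<open>u\<close>
  with respect to \<open>B\<close>; then \<open>\<theta> u\<close> is \<open>\<phi>\<close>-symmetric up to this sign and twists the split form of
  \<open>\<phi>\<close>, restricted along \<open>e R e\<close>, into that of \<open>\<phi>0\<close>.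
\<close>

section \<open>Homogeneous components\<close>

text \<open>The centre of \<open>D\<close> may be \<open>F \<times> F\<close>, and nonzero
  inhomogeneous elements of \<open>D\<close> need not be invertible, so neither field nor division
  ring arguments apply as they stand. Every vector, coefficient or pivot that has to be inverted is
  therefore taken homogeneous, and additivity carries the resulting identities over to all elements.
  The element \<open>r\<close> has to be symmetric or skew: for a general homogeneous element of
  \<open>e R \<phi>(e)\<close> the map \<open>\<psi>\<close> would be an antiautomorphism whose
  square is only inner. If \<open>R\<close> is not central simple, \<open>\<phi>0\<close> must move
  the centre, and this is what Hilbert 90 needs: were the centre fixed, a proper ideal and its image
  under \<open>\<phi>\<close> would decompose \<open>R\<close> by a central idempotent that
  \<open>\<phi>\<close> exchanges with its complement. For the types, no tensor product with the
  algebraic closure is formed. A linear form in the entries of a splitting is determined by its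
  values on the algebra, and the intertwiner between the splittings of \<open>D\<close> and
  \<open>R\<close> is read off from such coefficients.\<close>

context graded_vector_space
begin

definition hcomp :: "'a \<Rightarrow> 'g \<Rightarrow> 'a" where
  "hcomp x = (THE p. finite {g. p g \<noteq> 0} \<and> (\<forall>g. p g \<in> Ag g) \<and> x = (\<Sum>g\<in>{g. p g \<noteq> 0}. p g))"

lemma hcomp_props:
  "finite {g. hcomp x g \<noteq> 0} \<and> (\<forall>g. hcomp x g \<in> Ag g) \<and> x = (\<Sum>g\<in>{g. hcomp x g \<noteq> 0}. hcomp x g)"
  unfolding hcomp_def by (rule theI'[OF direct_sum[of x]])

lemma finite_hcomp: "finite {g. hcomp x g \<noteq> 0}"
  and hcomp_mem: "hcomp x g \<in> Ag g"
  and sum_hcomp: "(\<Sum>g\<in>{g. hcomp x g \<noteq> 0}. hcomp x g) = x"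
  using hcomp_props[of x] by auto

lemma zero_mem: "0 \<in> Ag g"
  and add_mem: "x \<in> Ag g \<Longrightarrow> y \<in> Ag g \<Longrightarrow> x + y \<in> Ag g"
  and scale_mem: "x \<in> Ag g \<Longrightarrow> scl c x \<in> Ag g"
  using subspace_comp[of g] by (auto simp: subspace_def)

lemma neg_mem: "x \<in> Ag g \<Longrightarrow> - x \<in> Ag g"
  using subspace_comp[of g] subspace_neg by blast

lemma diff_mem: "x \<in> Ag g \<Longrightarrow> y \<in> Ag g \<Longrightarrow> x - y \<in> Ag g"
  using subspace_comp[of g] subspace_diff by blast

lemma sum_mem: "(\<And>i. i \<in> I \<Longrightarrow> x i \<in> Ag g) \<Longrightarrow> sum x I \<in> Ag g"
  using subspace_comp[of g] subspace_sum by blast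

lemma sum_hcomp_superset:
  assumes "finite S" "{g. hcomp x g \<noteq> 0} \<subseteq> S"
  shows "(\<Sum>g\<in>S. hcomp x g) = x"
proof -
  have "(\<Sum>g\<in>S. hcomp x g) = (\<Sum>g\<in>{g. hcomp x g \<noteq> 0}. hcomp x g)"
    using assms by (intro sum.mono_neutral_right) auto
  then show ?thesis by (simp add: sum_hcomp)
qed

text \<open>\<open>S\<close> may exceed the support of \<open>p\<close>, so decompositions can be
  added over the union of their supports without tracking which terms cancel.\<close>

lemma hcomp_eqI:
  assumes S: "finite S" and p: "\<And>g. p g \<in> Ag g" and out: "\<And>g. g \<notin> S \<Longrightarrow> p g = 0"
    and x: "x = (\<Sum>g\<in>S. p g)"
  shows "hcomp x = p"
proof -
  have sub: "{g. p g \<noteq> 0} \<subseteq> S" using out by auto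
  have "x = (\<Sum>g\<in>{g. p g \<noteq> 0}. p g)"
    unfolding x using S sub by (intro sum.mono_neutral_right) auto
  then have "finite {g. p g \<noteq> 0} \<and> (\<forall>g. p g \<in> Ag g) \<and> x = (\<Sum>g\<in>{g. p g \<noteq> 0}. p g)"
    using finite_subset[OF sub S] p by blast
  then show ?thesis
    using direct_sum[of x] hcomp_props[of x] by blast
qed

lemma hcomp_homogeneous: "x \<in> Ag g \<Longrightarrow> hcomp x h = (if h = g then x else 0)"
  by (rule fun_cong[of "hcomp x" "\<lambda>h. if h = g then x else 0"], rule hcomp_eqI[of "{g}"])
     (auto simp: zero_mem)

lemma hcomp_add: "hcomp (x + y) g = hcomp x g + hcomp y g"
proof -
  let ?S = "{g. hcomp x g \<noteq> 0} \<union> {g. hcomp y g \<noteq> 0}"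
  have S: "finite ?S" by (simp add: finite_hcomp)
  have "hcomp (x + y) = (\<lambda>g. hcomp x g + hcomp y g)"
  proof (rule hcomp_eqI[OF S])
    show "x + y = (\<Sum>g\<in>?S. hcomp x g + hcomp y g)"
      using sum_hcomp_superset[OF S] by (simp add: sum.distrib)
  qed (auto simp: hcomp_mem add_mem)
  then show ?thesis by simp
qed

lemma hcomp_zero [simp]: "hcomp 0 g = 0"
  using hcomp_homogeneous[OF zero_mem] by simp

lemma nonzero_hcomp: "x \<noteq> 0 \<Longrightarrow> \<exists>g. hcomp x g \<noteq> 0"
  using sum_hcomp[of x] by (metis sum.neutral)

text \<open>An element is the finite sum of its components, and the empty sum is covered because 0
  is homogeneous.\<close>

lemma homogeneous_induct [case_names homogeneous add]:
  assumes h: "\<And>g x. x \<in> Ag g \<Longrightarrow> P x" and a: "\<And>x y. P x \<Longrightarrow> P y \<Longrightarrow> P (x + y)"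
  shows "P x"
proof -
  have "P (\<Sum>g\<in>S. hcomp x g)" if "finite S" for S
    using that by (induction S) (auto intro: a h[OF hcomp_mem] h[OF zero_mem])
  then show ?thesis using finite_hcomp sum_hcomp by metis
qed

end

text \<open>On a homogeneous \<open>x\<close> each side is \<open>T x\<close> or 0, and both sides
  are additive in \<open>x\<close>. Here \<open>T\<close> stands for multiplication by a homogeneous
  element and for \<open>\<phi>0\<close>.\<close>

lemma hcomp_shift:
  fixes T :: "'a::ab_group_add \<Rightarrow> 'b::ab_group_add" and Ag :: "'g::ab_group_add \<Rightarrow> 'a set"
  assumes A: "graded_vector_space s Ag" and B: "graded_vector_space s' Bg"
    and add: "\<And>x y. T (x + y) = T x + T y"
    and shift: "\<And>h x. x \<in> Ag h \<Longrightarrow> T x \<in> Bg (h + k)"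
  shows "graded_vector_space.hcomp Bg (T x) (h + k) = T (graded_vector_space.hcomp Ag x h)"
proof -
  interpret A: graded_vector_space s Ag by (rule A)
  interpret B: graded_vector_space s' Bg by (rule B)
  show ?thesis
  proof (induction x rule: A.homogeneous_induct)
    case (homogeneous g x)
    have "T 0 = 0" using add[of 0 0] by simp
    then show ?case
      by (simp add: A.hcomp_homogeneous[OF homogeneous] B.hcomp_homogeneous[OF shift[OF homogeneous]])
  next
    case (add x y)
    then show ?case by (simp add: assms(3) A.hcomp_add B.hcomp_add)
  qed
qed

section \<open>The unit and the centre of a graded algebra\<close>

context graded_algebra
begin

lemma hcomp_mult_left: "x \<in> Ag h \<Longrightarrow> hcomp (x * y) (g + h) = x * hcomp y g"
  by (rule hcomp_shift[OF graded_vector_space_axioms graded_vector_space_axioms])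
     (auto simp: algebra_simps dest: comp_mult)

lemma hcomp_mult_right: "y \<in> Ag h \<Longrightarrow> hcomp (x * y) (g + h) = hcomp x g * y"
  by (rule hcomp_shift[OF graded_vector_space_axioms graded_vector_space_axioms])
     (auto simp: algebra_simps dest: comp_mult)

text \<open>Comparing components of \<open>x * 1 = x\<close> in the degree of \<open>x\<close> shows
  that \<open>hcomp 1 0\<close> is a right unit, hence equal to 1.\<close>

lemma one_mem: "1 \<in> Ag 0"
proof -
  have "x * hcomp 1 0 = x" for x
  proof (induction x rule: homogeneous_induct)
    case (homogeneous g x)
    then show ?case
      using hcomp_mult_left[OF homogeneous, of 1 0] by (simp add: hcomp_homogeneous)
  qed (simp add: algebra_simps)
  then have "hcomp 1 0 = 1" by (metis mult_1)
  then show ?thesis using hcomp_mem by metis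
qed

lemma scl_conv_mult: "scl c x = scl c 1 * x"
  by (simp add: scl_mult_left)

lemma scl_one_commute: "scl c 1 * x = x * scl c 1"
  by (simp add: scl_mult_left scl_mult_right)

lemma scl_one_mem: "scl c 1 \<in> Ag 0"
  by (rule scale_mem[OF one_mem])

abbreviation centre :: "'a set" where
  "centre \<equiv> center_on UNIV (*)"

lemma centreD: "z \<in> centre \<Longrightarrow> z * x = x * z"
  by (simp add: center_on_def)

lemma centreI: "(\<And>x. z * x = x * z) \<Longrightarrow> z \<in> centre"
  by (simp add: center_on_def)

lemma centre_scl_one: "scl c 1 \<in> centre"
  by (rule centreI) (rule scl_one_commute)

lemma centre_add:
  assumes "y \<in> centre" "z \<in> centre"
  shows "y + z \<in> centre"
  by (rule centreI) (simp only: distrib_left distrib_right centreD[OF assms(1)] centreD[OF assms(2)])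

lemma centre_mult:
  assumes "y \<in> centre" "z \<in> centre"
  shows "y * z \<in> centre"
  by (rule centreI) (metis mult.assoc centreD[OF assms(1)] centreD[OF assms(2)])

lemma centre_minus:
  assumes "z \<in> centre"
  shows "- z \<in> centre"
  by (rule centreI) (simp add: centreD[OF assms])

lemma centre_homogeneousI:
  assumes "\<And>g x. x \<in> Ag g \<Longrightarrow> z * x = x * z"
  shows "z \<in> centre"
proof -
  have "z * x = x * z" for x
  proof (induction x rule: homogeneous_induct)
    case (homogeneous g x)
    then show ?case by (rule assms)
  qed (simp add: distrib_left distrib_right)
  then show ?thesis by (rule centreI)
qed

text \<open>The grading group is abelian, so for \<open>x\<close> of degree \<open>h\<close> the
  contributions of \<open>hcomp z g\<close> to \<open>z * x\<close> and to \<open>x * z\<close> both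
  sit in degree \<open>g + h\<close>. This later provides homogeneous central factors.\<close>

lemma hcomp_centre:
  assumes "z \<in> centre"
  shows "hcomp z g \<in> centre"
proof (rule centre_homogeneousI)
  fix h x assume x: "x \<in> Ag h"
  show "hcomp z g * x = x * hcomp z g"
    using hcomp_mult_left[OF x, of z g] hcomp_mult_right[OF x, of z g] centreD[OF assms] by simp
qed

lemma centre_inverse:
  assumes "z \<in> centre" "z * y = 1" "y * z = 1"
  shows "y \<in> centre"
proof -
  have "y * x = x * y" for x
    using assms centreD[OF assms(1)] by (metis mult.assoc mult_1_left mult_1_right)
  then show ?thesis by (simp add: center_on_def)
qed

end

context graded_division_algebra
begin

text \<open>Only the component of \<open>y\<close> in degree \<open>- g\<close> contributes to the
  degree 0 part of \<open>x * y = 1\<close>. That component is thus a right inverse already, and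
  uniqueness of inverses makes it all of \<open>y\<close>.\<close>

lemma homogeneous_inverse:
  assumes x: "x \<in> Ag g" "x \<noteq> 0"
  obtains y where "x * y = 1" "y * x = 1" "y \<in> Ag (- g)"
proof -
  obtain y where y: "x * y = 1" "y * x = 1" using homogeneous_invertible x by blast
  have "x * hcomp y (- g) = hcomp 1 0"
    using hcomp_mult_left[OF x(1), of y "- g"] y by simp
  then have "x * hcomp y (- g) = 1" by (simp add: hcomp_homogeneous[OF one_mem])
  then have "hcomp y (- g) = y" using y by (metis mult.assoc mult_1_left mult_1_right)
  then have "y \<in> Ag (- g)" using hcomp_mem by metis
  then show thesis using y that by blast
qed

lemma homogeneous_mult_eq_0:
  assumes "x \<in> Ag g" "x \<noteq> 0" "x * y = 0"
  shows "y = 0"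
  using homogeneous_invertible[OF assms(1,2)] assms(3) by (metis mult.assoc mult_1_left mult_zero_right)

end

section \<open>Graded Skolem--Noether\<close>

context graded_division_algebra
begin

text \<open>Gaussian elimination needs pivots to be homogeneous, which the consistent degrees
  \<open>p j + q i\<close> of the coefficients guarantee at every step.\<close>

lemma homogeneous_system_solvable:
  fixes M :: "'j \<Rightarrow> 'i \<Rightarrow> 'a"
  assumes "finite J" "finite I" "card J < card I"
    and "\<And>i j. i \<in> I \<Longrightarrow> j \<in> J \<Longrightarrow> M j i \<in> Ag (p j + q i)"
  shows "\<exists>c k. (\<forall>i\<in>I. c i \<in> Ag (k - q i)) \<and> (\<exists>i\<in>I. c i \<noteq> 0) \<and> (\<forall>j\<in>J. (\<Sum>i\<in>I. c i * M j i) = 0)"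
  using assms
proof (induction J arbitrary: I M rule: finite_induct)
  case empty
  then obtain i0 where i0: "i0 \<in> I" by fastforce
  define c where "c = (\<lambda>i. if i = i0 then 1 else 0 :: 'a)"
  have "\<forall>i\<in>I. c i \<in> Ag (q i0 - q i)" by (simp add: c_def one_mem zero_mem)
  moreover have "c i0 \<noteq> 0" by (simp add: c_def)
  ultimately show ?case using i0 by blast
next
  case (insert j J)
  have M: "M j i \<in> Ag (p j + q i)" if "i \<in> I" for i
    using insert.prems(3)[OF that] by simp
  have MJ: "M l i \<in> Ag (p l + q i)" if "i \<in> I" "l \<in> J" for i l
    using insert.prems(3)[OF that(1)] that by simp
  show ?case
  proof (cases "\<forall>i\<in>I. M j i = 0")
    case True
    have "card J < card I" using insert.prems(2) insert.hyps by simp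
    from insert.IH[OF insert.prems(1) this MJ] obtain c k where
      c: "\<forall>i\<in>I. c i \<in> Ag (k - q i)" "\<exists>i\<in>I. c i \<noteq> 0" "\<forall>l\<in>J. (\<Sum>i\<in>I. c i * M l i) = 0"
      by blast
    moreover have "(\<Sum>i\<in>I. c i * M j i) = 0" using True by simp
    ultimately show ?thesis by auto
  next
    case False
    then obtain i0 where i0: "i0 \<in> I" "M j i0 \<noteq> 0" by blast
    obtain y where y: "M j i0 * y = 1" "y * M j i0 = 1" "y \<in> Ag (- (p j + q i0))"
      using homogeneous_inverse[OF M[OF i0(1)] i0(2)] .
    define I' where "I' = I - {i0}"
    \<comment> \<open>Row \<open>j\<close>, solved for the unknown \<open>i0\<close>, is substituted
      into row \<open>l\<close>. The new term has degree \<open>p l + q i\<close> because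
      \<open>y\<close> has degree \<open>- (p j + q i0)\<close>.\<close>
    define M' where "M' = (\<lambda>l i. M l i - M j i * y * M l i0)"
    have I': "finite I'" "card J < card I'"
      using insert.prems insert.hyps i0 by (auto simp: I'_def)
    have "M' l i \<in> Ag (p l + q i)" if "i \<in> I'" "l \<in> J" for i l
    proof -
      have "M j i * y * M l i0 \<in> Ag ((p j + q i) + - (p j + q i0) + (p l + q i0))"
        using that i0 by (intro comp_mult M MJ y) (auto simp: I'_def)
      then have "M j i * y * M l i0 \<in> Ag (p l + q i)" by (simp add: algebra_simps)
      then show ?thesis unfolding M'_def using that by (intro diff_mem MJ) (auto simp: I'_def)
    qed
    from insert.IH[OF I' this] obtain c k where
      c: "\<forall>i\<in>I'. c i \<in> Ag (k - q i)" "\<exists>i\<in>I'. c i \<noteq> 0" "\<forall>l\<in>J. (\<Sum>i\<in>I'. c i * M' l i) = 0"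
      by blast
    define s where "s = (\<Sum>i\<in>I'. c i * M j i)"
    \<comment> \<open>Back substitution: the value at \<open>i0\<close> is the one that makes row
      \<open>j\<close> vanish.\<close>
    define c' where "c' = c(i0 := - (s * y))"
    have split: "(\<Sum>i\<in>I. c' i * N i) = (\<Sum>i\<in>I'. c i * N i) - s * y * N i0" for N
    proof -
      have "(\<Sum>i\<in>I. c' i * N i) = c' i0 * N i0 + (\<Sum>i\<in>I'. c' i * N i)"
        unfolding I'_def using insert.prems(1) i0(1) by (rule sum.remove)
      moreover have "(\<Sum>i\<in>I'. c' i * N i) = (\<Sum>i\<in>I'. c i * N i)"
        by (rule sum.cong) (auto simp: c'_def I'_def)
      ultimately show ?thesis by (simp add: c'_def)
    qed
    have "s \<in> Ag (k + p j)"
      unfolding s_def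
    proof (rule sum_mem)
      fix i assume i: "i \<in> I'"
      then have "c i * M j i \<in> Ag ((k - q i) + (p j + q i))"
        using c(1) by (intro comp_mult M) (auto simp: I'_def)
      then show "c i * M j i \<in> Ag (k + p j)" by (simp add: algebra_simps)
    qed
    from comp_mult[OF this y(3)] have "s * y \<in> Ag (k - q i0)" by (simp add: algebra_simps)
    then have 1: "\<forall>i\<in>I. c' i \<in> Ag (k - q i)"
      using c(1) by (auto simp: c'_def I'_def intro: neg_mem)
    have 2: "\<exists>i\<in>I. c' i \<noteq> 0" using c(2) by (auto simp: c'_def I'_def)
    have "(\<Sum>i\<in>I. c' i * M j i) = 0"
      unfolding split using y(2) by (simp add: s_def mult.assoc)
    moreover have "(\<Sum>i\<in>I. c' i * M l i) = 0" if "l \<in> J" for l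
    proof -
      have "(\<Sum>i\<in>I'. c i * M' l i) = (\<Sum>i\<in>I'. c i * M l i) - s * y * M l i0"
        by (simp add: M'_def s_def right_diff_distrib sum_subtractf sum_distrib_right mult.assoc)
      then show ?thesis unfolding split using c(3) that by simp
    qed
    ultimately show ?thesis using 1 2 by blast
  qed
qed

text \<open>Induction on the number of nonzero coefficients. After one of them is scaled to 1, the
  commutators \<open>x * d b - d b * x\<close> form a shorter relation and vanish; so all
  \<open>d b\<close> are central, and \<open>y = 1\<close> leaves a relation over the centre.
  Coefficients are homogeneous since the scaling divides by one of them.\<close>

lemma centre_independent_imp_bimodule_independent:
  assumes S: "finite S"
    and indep: "\<And>c. (\<And>b. b \<in> S \<Longrightarrow> c b \<in> centre \<and> (\<exists>g. c b \<in> Ag g)) \<Longrightarrow> (\<Sum>b\<in>S. c b * b) = 0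
                  \<Longrightarrow> \<forall>b\<in>S. c b = 0"
    and c: "\<And>b. b \<in> S \<Longrightarrow> \<exists>g. c b \<in> Ag g" "\<And>y. (\<Sum>b\<in>S. c b * y * b) = 0"
  shows "\<forall>b\<in>S. c b = 0"
  using c
proof (induction "card {b \<in> S. c b \<noteq> 0}" arbitrary: c rule: less_induct)
  case less
  show ?case
  proof (rule ccontr)
    assume "\<not> (\<forall>b\<in>S. c b = 0)"
    then obtain b0 where b0: "b0 \<in> S" "c b0 \<noteq> 0" by blast
    obtain g0 where g0: "c b0 \<in> Ag g0" using less.prems(1)[OF b0(1)] by blast
    obtain u where u: "c b0 * u = 1" "u * c b0 = 1" "u \<in> Ag (- g0)"
      using homogeneous_inverse[OF g0 b0(2)] .
    define d where "d = (\<lambda>b. u * c b)"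
    have d_hom: "\<exists>g. d b \<in> Ag g" if "b \<in> S" for b
      using less.prems(1)[OF that] u(3) comp_mult unfolding d_def by blast
    have d0: "d b0 = 1" using u by (simp add: d_def)
    have d_rel: "(\<Sum>b\<in>S. d b * y * b) = 0" for y
    proof -
      have "(\<Sum>b\<in>S. d b * y * b) = u * (\<Sum>b\<in>S. c b * y * b)"
        by (simp add: d_def sum_distrib_left mult.assoc)
      then show ?thesis by (simp add: less.prems(2))
    qed
    have "d b \<in> centre" if b: "b \<in> S" for b
    proof (rule centre_homogeneousI)
      fix g x assume x: "x \<in> Ag g"
      define e where "e = (\<lambda>b. x * d b - d b * x)"
      have "\<exists>g. e b \<in> Ag g" if b: "b \<in> S" for b
      proof -
        obtain h where h: "d b \<in> Ag h" using d_hom[OF b] by blast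
        have "e b \<in> Ag (g + h)"
          using comp_mult[OF x h] comp_mult[OF h x] by (simp add: e_def add.commute diff_mem)
        then show ?thesis ..
      qed
      moreover have "(\<Sum>b\<in>S. e b * y * b) = 0" for y
      proof -
        have "(\<Sum>b\<in>S. e b * y * b) = x * (\<Sum>b\<in>S. d b * y * b) - (\<Sum>b\<in>S. d b * (x * y) * b)"
          by (simp add: e_def sum_distrib_left algebra_simps sum_subtractf)
        then show ?thesis by (simp add: d_rel)
      qed
      moreover have "card {b \<in> S. e b \<noteq> 0} < card {b \<in> S. c b \<noteq> 0}"
      proof (rule psubset_card_mono)
        have "{b \<in> S. e b \<noteq> 0} \<subseteq> {b \<in> S. c b \<noteq> 0}" by (auto simp: e_def d_def)
        moreover have "e b0 = 0" by (simp add: e_def d0)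
        ultimately show "{b \<in> S. e b \<noteq> 0} \<subset> {b \<in> S. c b \<noteq> 0}" using b0 by blast
      qed (simp add: S)
      ultimately have "\<forall>b\<in>S. e b = 0" by (intro less.hyps) auto
      then show "d b * x = x * d b" using b by (simp add: e_def)
    qed
    moreover have "(\<Sum>b\<in>S. d b * b) = 0" using d_rel[of 1] by simp
    ultimately have "\<forall>b\<in>S. d b = 0" using d_hom by (intro indep) auto
    then show False using b0(1) d0 by auto
  qed
qed

text \<open>In a homogeneous generating set of least cardinality, a nonzero homogeneous central
  coefficient in a relation has a central inverse, so its generator could be dropped. The components
  of an \<open>F\<close>-spanning set show that finite generating sets exist. The centre need not be
  a field, which is why independence is tested with homogeneous coefficients.\<close>

lemma centre_basis_exists:
  assumes fd: "finite_dimensional_vector_space scl E"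
  obtains S where "finite S" "\<And>b. b \<in> S \<Longrightarrow> \<exists>g. b \<in> Ag g"
    "\<And>y. \<exists>k. (\<forall>b\<in>S. k b \<in> centre) \<and> y = (\<Sum>b\<in>S. k b * b)"
    "\<And>c. (\<And>b. b \<in> S \<Longrightarrow> c b \<in> centre \<and> (\<exists>g. c b \<in> Ag g)) \<Longrightarrow> (\<Sum>b\<in>S. c b * b) = 0
       \<Longrightarrow> \<forall>b\<in>S. c b = 0"
proof -
  define gen where "gen S \<longleftrightarrow> finite S \<and> (\<forall>b\<in>S. \<exists>g. b \<in> Ag g) \<and>
      (\<forall>y. \<exists>k. (\<forall>b\<in>S. k b \<in> centre) \<and> y = (\<Sum>b\<in>S. k b * b))" for S
  define S0 where "S0 = (\<Union>x\<in>E. hcomp x ` {g. hcomp x g \<noteq> 0})"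
  have E: "finite E" "span E = UNIV"
    using fd by (simp_all add: finite_dimensional_vector_space_def finite_dimensional_vector_space_axioms_def)
  have S0: "finite S0" using E by (simp add: S0_def finite_hcomp)
  have span: "span S0 = UNIV"
  proof -
    have "x \<in> span S0" if "x \<in> E" for x
    proof -
      have "(\<Sum>g\<in>{g. hcomp x g \<noteq> 0}. hcomp x g) \<in> span S0"
        unfolding S0_def using that by (intro span_sum span_base) blast
      then show ?thesis by (simp add: sum_hcomp)
    qed
    then have "span E \<subseteq> span S0" by (meson span_minimal subsetI subspace_span)
    then show ?thesis using E by auto
  qed
  have "gen S0"
    unfolding gen_def
  proof (intro conjI allI ballI)
    fix y
    have "y \<in> span S0" by (simp add: span)
    then obtain u where "y = (\<Sum>v\<in>S0. scl (u v) v)" using span_finite[OF S0] by auto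
    then have "y = (\<Sum>v\<in>S0. scl (u v) 1 * v)" by (simp flip: scl_conv_mult)
    then show "\<exists>k. (\<forall>b\<in>S0. k b \<in> centre) \<and> y = (\<Sum>b\<in>S0. k b * b)"
      by (intro exI[of _ "\<lambda>v. scl (u v) 1"]) (simp add: centre_scl_one)
  qed (use S0 hcomp_mem in \<open>auto simp: S0_def\<close>)
  then obtain S where S: "gen S" and min: "\<And>S'. gen S' \<Longrightarrow> card S \<le> card S'"
    using ex_has_least_nat[of gen S0 card] by blast
  have "\<forall>b\<in>S. c b = 0"
    if c: "\<And>b. b \<in> S \<Longrightarrow> c b \<in> centre \<and> (\<exists>g. c b \<in> Ag g)" and rel: "(\<Sum>b\<in>S. c b * b) = 0" for c
  proof (rule ccontr)
    assume "\<not> (\<forall>b\<in>S. c b = 0)"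
    then obtain b0 where b0: "b0 \<in> S" "c b0 \<noteq> 0" by blast
    then obtain g0 where "c b0 \<in> Ag g0" using c by blast
    then obtain u where u: "c b0 * u = 1" "u * c b0 = 1" using homogeneous_inverse b0(2) by blast
    have u_c: "u \<in> centre" using centre_inverse c[OF b0(1)] u by blast
    have fS: "finite S" using S by (simp add: gen_def)
    have b0_eq: "b0 = (\<Sum>b\<in>S - {b0}. - (u * c b) * b)"
    proof -
      have "u * (c b0 * b0 + (\<Sum>b\<in>S - {b0}. c b * b)) = 0"
        using rel sum.remove[OF fS b0(1), of "\<lambda>b. c b * b"] by simp
      then have "b0 + (\<Sum>b\<in>S - {b0}. u * c b * b) = 0"
        using u by (simp add: distrib_left sum_distrib_left flip: mult.assoc)
      then show ?thesis by (simp add: sum_negf add_eq_0_iff2)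
    qed
    have "gen (S - {b0})"
      unfolding gen_def
    proof (intro conjI allI)
      fix y
      obtain k where k: "\<forall>b\<in>S. k b \<in> centre" "y = (\<Sum>b\<in>S. k b * b)"
        using S unfolding gen_def by blast
      \<comment> \<open>Substituting the expression for \<open>b0\<close> changes the other
        coefficients by central elements.\<close>
      define k' where "k' = (\<lambda>b. k b + k b0 * - (u * c b))"
      have "y = k b0 * b0 + (\<Sum>b\<in>S - {b0}. k b * b)"
        using k(2) sum.remove[OF fS b0(1), of "\<lambda>b. k b * b"] by simp
      also have "k b0 * b0 = (\<Sum>b\<in>S - {b0}. k b0 * (- (u * c b) * b))"
        by (subst b0_eq) (simp add: sum_distrib_left)
      finally have "y = (\<Sum>b\<in>S - {b0}. k' b * b)"
        by (simp add: k'_def left_diff_distrib sum_subtractf sum_negf mult.assoc)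
      moreover have "\<forall>b\<in>S - {b0}. k' b \<in> centre"
        unfolding k'_def using k(1) c b0(1) u_c
        by (intro ballI centre_add centre_mult centre_minus) auto
      ultimately show "\<exists>k. (\<forall>b\<in>S - {b0}. k b \<in> centre) \<and> y = (\<Sum>b\<in>S - {b0}. k b * b)" by blast
    qed (use S in \<open>auto simp: gen_def\<close>)
    then have "card S \<le> card (S - {b0})" by (rule min)
    then show False using card_Diff1_less[OF fS b0(1)] by linarith
  qed
  moreover have "finite S" "\<And>b. b \<in> S \<Longrightarrow> \<exists>g. b \<in> Ag g"
    "\<And>y. \<exists>k. (\<forall>b\<in>S. k b \<in> centre) \<and> y = (\<Sum>b\<in>S. k b * b)"
    using S unfolding gen_def by blast+
  ultimately show thesis using that by blast
qed

text \<open>With \<open>S\<close> a homogeneous basis over the centre, the \<open>card S + 1\<close> maps \<open>y \<mapsto> y b\<close> and \<open>\<alpha>\<close> are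
  determined by their values on \<open>S\<close>, hence left linearly dependent; a dependence expresses \<open>\<alpha>\<close> as
  \<open>y \<mapsto> \<Sum> a b * y * b\<close>, and every coefficient \<open>a b\<close> intertwines.\<close>

theorem graded_Skolem_Noether:
  assumes fd: "finite_dimensional_vector_space scl E"
    and add: "\<And>x y. \<alpha> (x + y) = \<alpha> x + \<alpha> y" and mult: "\<And>x y. \<alpha> (x * y) = \<alpha> x * \<alpha> y"
    and one: "\<alpha> 1 = 1" and deg: "\<And>g x. x \<in> Ag g \<Longrightarrow> \<alpha> x \<in> Ag g"
    and cent: "\<And>z. z \<in> centre \<Longrightarrow> \<alpha> z = z"
  obtains u g where "u \<in> Ag g" "u \<noteq> 0" "\<And>x. u * x = \<alpha> x * u"
proof -
  obtain S where S: "finite S" "\<And>b. b \<in> S \<Longrightarrow> \<exists>g. b \<in> Ag g"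
    "\<And>y. \<exists>k. (\<forall>b\<in>S. k b \<in> centre) \<and> y = (\<Sum>b\<in>S. k b * b)"
    and S_indep: "\<And>c. (\<And>b. b \<in> S \<Longrightarrow> c b \<in> centre \<and> (\<exists>g. c b \<in> Ag g)) \<Longrightarrow> (\<Sum>b\<in>S. c b * b) = 0
       \<Longrightarrow> \<forall>b\<in>S. c b = 0"
    using centre_basis_exists[OF fd] by blast
  note bi_indep = centre_independent_imp_bimodule_independent[OF S(1) S_indep]
  obtain dg where dg: "\<And>b. b \<in> S \<Longrightarrow> b \<in> Ag (dg b)" using S(2) by metis
  \<comment> \<open>\<open>None\<close> indexes the map \<open>\<alpha>\<close>, which preserves
    degrees and so gets degree 0; \<open>Some b\<close> indexes right multiplication by
    \<open>b\<close>. There is one unknown more than there are equations.\<close>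
  define I where "I = insert None (Some ` S)"
  define q where "q = case_option 0 dg"
  define M where "M = (\<lambda>b. case_option (\<alpha> b) (\<lambda>b'. b * b'))"
  have I: "finite I" "card S < card I"
    using S(1) by (simp_all add: I_def card_image)
  have M: "M j i \<in> Ag (dg j + q i)" if "i \<in> I" "j \<in> S" for i j
    using that dg deg comp_mult by (auto simp: I_def M_def q_def)
  have sum_I: "(\<Sum>i\<in>I. h i) = h None + (\<Sum>b\<in>S. h (Some b))" for h :: "'a option \<Rightarrow> 'a"
    using S(1) by (simp add: I_def sum.reindex)
  from homogeneous_system_solvable[where p = dg and q = q, OF S(1) I M] obtain c k where
    c: "\<forall>i\<in>I. c i \<in> Ag (k - q i)" "\<exists>i\<in>I. c i \<noteq> 0" "\<forall>j\<in>S. (\<Sum>i\<in>I. c i * M j i) = 0"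
    by blast
  \<comment> \<open>The left side is additive in \<open>y\<close> and lets central factors through,
    the latter because \<open>\<alpha>\<close> fixes the centre; so vanishing on \<open>S\<close> is
    enough.\<close>
  have rel: "c None * \<alpha> y + (\<Sum>b\<in>S. c (Some b) * y * b) = 0" for y
  proof -
    obtain z where z: "\<forall>b\<in>S. z b \<in> centre" "y = (\<Sum>j\<in>S. z j * j)" using S(3) by blast
    define F where "F = (\<lambda>y. c None * \<alpha> y + (\<Sum>b\<in>S. c (Some b) * y * b))"
    have F_add: "F (x + y) = F x + F y" for x y
      by (simp add: F_def add algebra_simps sum.distrib)
    have "F 0 = 0" using F_add[of 0 0] by simp
    then have F_sum: "F (sum h T) = (\<Sum>j\<in>T. F (h j))" for h :: "'a \<Rightarrow> 'a" and T
      by (induction T rule: infinite_finite_induct) (simp_all add: F_add)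
    have F_z: "F (x * j) = x * F j" if x: "x \<in> centre" for x j
    proof -
      have comm: "w * (x * v) = x * (w * v)" for w v
        by (metis centreD[OF x] mult.assoc)
      show ?thesis
        by (simp add: F_def mult cent[OF x] comm distrib_left sum_distrib_left mult.assoc)
    qed
    have "F j = 0" if "j \<in> S" for j
      using c(3) that by (force simp: F_def sum_I M_def mult.assoc)
    then have "F y = 0" unfolding z(2) F_sum using z(1) by (simp add: F_z)
    then show ?thesis by (simp add: F_def)
  qed
  have cS: "\<exists>g. c (Some b) \<in> Ag g" if "b \<in> S" for b
    using c(1) that by (auto simp: I_def)
  \<comment> \<open>Otherwise only terms \<open>c (Some b) * y * b\<close> remain, and these are
    independent.\<close>
  have "c None \<noteq> 0"
  proof
    assume 0: "c None = 0"
    have "\<forall>b\<in>S. c (Some b) = 0"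
      by (rule bi_indep) (use rel 0 cS in auto)
    then show False using 0 c(2) by (auto simp: I_def)
  qed
  moreover have "c None \<in> Ag k" using c(1) by (auto simp: I_def q_def)
  ultimately obtain v where v: "c None * v = 1" "v * c None = 1" "v \<in> Ag (- k)"
    using homogeneous_inverse by blast
  define a where "a = (\<lambda>b. - (v * c (Some b)))"
  have a_hom: "\<exists>g. a b \<in> Ag g" if "b \<in> S" for b
    using cS[OF that] v(3) unfolding a_def by (meson comp_mult neg_mem)
  have a_rel: "\<alpha> y = (\<Sum>b\<in>S. a b * y * b)" for y
  proof -
    have "v * (c None * \<alpha> y + (\<Sum>b\<in>S. c (Some b) * y * b)) = 0" by (simp add: rel)
    then have "\<alpha> y + (\<Sum>b\<in>S. v * c (Some b) * y * b) = 0"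
      using v(2) by (simp add: distrib_left sum_distrib_left flip: mult.assoc)
    then show ?thesis by (simp add: a_def sum_negf add_eq_0_iff2)
  qed
  have hom: "a b * x = \<alpha> x * a b" if x: "x \<in> Ag g" and b: "b \<in> S" for x g b
  proof -
    \<comment> \<open>Inserting the expansion of \<open>\<alpha>\<close> into
      \<open>\<alpha> (x * y) = \<alpha> x * \<alpha> y\<close> gives a bimodule relation with
      exactly these coefficients.\<close>
    define e where "e = (\<lambda>b. a b * x - \<alpha> x * a b)"
    have "\<exists>g. e b \<in> Ag g" if b: "b \<in> S" for b
    proof -
      obtain h where h: "a b \<in> Ag h" using a_hom[OF b] by blast
      have "e b \<in> Ag (g + h)"
        using comp_mult[OF deg[OF x] h] comp_mult[OF h x] by (simp add: e_def add.commute diff_mem)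
      then show ?thesis ..
    qed
    moreover have "(\<Sum>b\<in>S. e b * y * b) = 0" for y
    proof -
      have "(\<Sum>b\<in>S. e b * y * b) = (\<Sum>b\<in>S. a b * (x * y) * b) - \<alpha> x * (\<Sum>b\<in>S. a b * y * b)"
        by (simp add: e_def sum_distrib_left algebra_simps sum_subtractf)
      then show ?thesis by (simp add: mult flip: a_rel)
    qed
    ultimately have "\<forall>b\<in>S. e b = 0" by (intro bi_indep)
    then show ?thesis using b by (simp add: e_def)
  qed
  have "\<exists>b\<in>S. a b \<noteq> 0"
    using a_rel[of 1] one by (auto intro: ccontr)
  then obtain b where b: "b \<in> S" "a b \<noteq> 0" by blast
  then obtain g where g: "a b \<in> Ag g" using a_hom by blast
  have "a b * x = \<alpha> x * a b" for x
  proof (induction x rule: homogeneous_induct)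
    case (homogeneous h x)
    then show ?case using hom b(1) by blast
  qed (simp add: add distrib_left distrib_right)
  then show thesis using that b g by blast
qed

end

section \<open>Endomorphisms and functionals of a graded module\<close>

sublocale graded_right_module \<subseteq> V: graded_vector_space "module_scale sD act" Vg
  by (rule graded_space)

context graded_right_module
begin

lemma act_zero_left [simp]: "0 \<cdot> d = 0"
  using act_add_left[of 0 0 d] by simp

lemma act_zero_right [simp]: "v \<cdot> 0 = 0"
  using act_add_right[of v 0 0] by simp

lemma act_minus_left: "(- v) \<cdot> d = - (v \<cdot> d)"
  using act_add_left[of v "- v" d] by (simp add: add_eq_0_iff)

lemma act_minus_right: "v \<cdot> (- d) = - (v \<cdot> d)"
  using act_add_right[of v d "- d"] by (simp add: add_eq_0_iff)

lemma End_DI: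
  assumes "\<And>v w. r (v + w) = r v + r w" "\<And>v d. r (v \<cdot> d) = r v \<cdot> d"
  shows "r \<in> End_D act"
  using assms by (simp add: End_D_def)

lemma End_D_add: "r \<in> End_D act \<Longrightarrow> r (v + w) = r v + r w"
  and End_D_act: "r \<in> End_D act \<Longrightarrow> r (v \<cdot> d) = r v \<cdot> d"
  by (simp_all add: End_D_def)

lemma End_D_0: "r \<in> End_D act \<Longrightarrow> r 0 = 0"
  using End_D_add[of r 0 0] by simp

lemma id_End_D: "id \<in> End_D act"
  and zero_End_D: "0 \<in> End_D act"
  by (simp_all add: End_D_def)

lemma comp_End_D: "r \<in> End_D act \<Longrightarrow> s \<in> End_D act \<Longrightarrow> r \<circ> s \<in> End_D act"
  by (simp add: End_D_def)

lemma plus_End_D: "r \<in> End_D act \<Longrightarrow> s \<in> End_D act \<Longrightarrow> r + s \<in> End_D act"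
  by (auto simp: End_D_def act_add_left)

lemma minus_End_D: "r \<in> End_D act \<Longrightarrow> - r \<in> End_D act"
  by (auto simp: End_D_def act_minus_left)

lemma diff_End_D: "r \<in> End_D act \<Longrightarrow> s \<in> End_D act \<Longrightarrow> r - s \<in> End_D act"
  using plus_End_D[of r "- s"] minus_End_D by simp

lemma centre_End_D: "z \<in> D.centre \<Longrightarrow> (\<lambda>v. v \<cdot> z) \<in> End_D act"
  by (rule End_DI) (simp_all add: act_add_left D.centreD flip: act_mult)

lemma End_compD: "r \<in> End_comp act Vg g \<Longrightarrow> v \<in> Vg h \<Longrightarrow> r v \<in> Vg (g + h)"
  by (auto simp: End_comp_def)

lemma End_comp_End_D: "r \<in> End_comp act Vg g \<Longrightarrow> r \<in> End_D act"
  by (simp add: End_comp_def)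

lemma End_compI:
  assumes "r \<in> End_D act" "\<And>h v. v \<in> Vg h \<Longrightarrow> r v \<in> Vg (g + h)"
  shows "r \<in> End_comp act Vg g"
  using assms by (auto simp: End_comp_def)

lemma comp_End_comp:
  assumes "r \<in> End_comp act Vg g" "s \<in> End_comp act Vg h"
  shows "r \<circ> s \<in> End_comp act Vg (g + h)"
proof (rule End_compI)
  fix k v assume "v \<in> Vg k"
  then have "r (s v) \<in> Vg (g + (h + k))" using assms by (intro End_compD)
  then show "(r \<circ> s) v \<in> Vg (g + h + k)" by (simp add: add.assoc)
qed (use assms in \<open>auto intro: comp_End_D End_comp_End_D\<close>)

lemma End_D_nonzero_homogeneous:
  assumes "r \<in> End_D act" "r \<noteq> 0"
  obtains g v where "v \<in> Vg g" "r v \<noteq> 0"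
proof -
  have "\<exists>g. \<exists>v\<in>Vg g. r v \<noteq> 0"
  proof (rule ccontr)
    assume "\<nexists>g. \<exists>v\<in>Vg g. r v \<noteq> 0"
    then have *: "r v = 0" if "v \<in> Vg g" for g v using that by blast
    have "r v = 0" for v
      by (induction v rule: V.homogeneous_induct) (use * assms(1) in \<open>auto simp: End_D_add\<close>)
    then show False using assms(2) by auto
  qed
  then show thesis using that by blast
qed

text \<open>Cutting \<open>f\<close> down to its degree \<open>k\<close> part keeps it
  \<open>D\<close>-linear, because a homogeneous \<open>d\<close> shifts the degree of
  \<open>v\<close> and the degree of the value by the same amount.\<close>

lemma linear_functional_component:
  assumes f_add: "\<And>v w. f (v + w) = f v + f w" and f_act: "\<And>v d. f (v \<cdot> d) = f v * d"
  obtains f' where "\<And>v w. f' (v + w) = f' v + f' w" "\<And>v d. f' (v \<cdot> d) = f' v * d"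
    "\<And>h v. v \<in> Vg h \<Longrightarrow> f' v = D.hcomp (f v) (h + k)"
proof -
  define f' where "f' v = (\<Sum>h\<in>{h. V.hcomp v h \<noteq> 0}. D.hcomp (f (V.hcomp v h)) (h + k))" for v
  have f_0: "f 0 = 0" using f_add[of 0 0] by simp
  have f': "f' v = (\<Sum>h\<in>S. D.hcomp (f (V.hcomp v h)) (h + k))"
    if "finite S" "{h. V.hcomp v h \<noteq> 0} \<subseteq> S" for v S
    unfolding f'_def using that by (intro sum.mono_neutral_left) (auto simp: f_0)
  have f'_hom: "f' v = D.hcomp (f v) (h + k)" if v: "v \<in> Vg h" for h v
  proof -
    have "{h. V.hcomp v h \<noteq> 0} \<subseteq> {h}"
      by (auto simp: V.hcomp_homogeneous[OF v] split: if_splits)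
    from f'[OF _ this] show ?thesis by (simp add: V.hcomp_homogeneous[OF v])
  qed
  have f'_add: "f' (v + w) = f' v + f' w" for v w
  proof -
    let ?S = "{h. V.hcomp v h \<noteq> 0} \<union> {h. V.hcomp w h \<noteq> 0}"
    have S: "finite ?S" by (simp add: V.finite_hcomp)
    have "{h. V.hcomp (v + w) h \<noteq> 0} \<subseteq> ?S" by (auto simp: V.hcomp_add)
    then show ?thesis
      using f'[OF S, of v] f'[OF S, of w] f'[OF S, of "v + w"]
      by (simp add: V.hcomp_add f_add D.hcomp_add sum.distrib)
  qed
  have "f' (v \<cdot> d) = f' v * d" for v d
  proof (induction v rule: V.homogeneous_induct)
    case (homogeneous h v)
    show ?case
    proof (induction d rule: D.homogeneous_induct)
      case (homogeneous l d)
      have "f' (v \<cdot> d) = D.hcomp (f v * d) (h + k + l)"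
        using f'_hom[OF act_comp[OF \<open>v \<in> Vg h\<close> homogeneous]] by (simp add: f_act algebra_simps)
      then show ?case
        by (simp add: D.hcomp_mult_right[OF homogeneous] f'_hom[OF \<open>v \<in> Vg h\<close>])
    next
      case (add x y)
      then show ?case by (simp add: act_add_right f'_add distrib_left)
    qed
  next
    case (add v w)
    then show ?case by (simp add: act_add_left f'_add distrib_right)
  qed
  then show thesis using that f'_add f'_hom by blast
qed

text \<open>Some coordinate of \<open>w\<close> in the given basis is nonzero. The basis need not be
  homogeneous; degrees are restored afterwards by passing to a component of the functional.\<close>

lemma finite_rank_functional:
  assumes "finite_rank act" "w \<noteq> 0"
  obtains f where "\<And>v v'. f (v + v') = f v + f v'" "\<And>v d. f (v \<cdot> d) = f v * d" "f w \<noteq> 0"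
proof -
  obtain E where E: "finite E" "\<And>v. \<exists>c. v = (\<Sum>b\<in>E. b \<cdot> c b)"
    "\<And>c. (\<Sum>b\<in>E. b \<cdot> c b) = 0 \<Longrightarrow> \<forall>b\<in>E. c b = 0"
    using assms(1) unfolding finite_rank_def finite_basis_on_def by auto
  define co where "co v = (SOME c. v = (\<Sum>b\<in>E. b \<cdot> c b))" for v
  have co: "v = (\<Sum>b\<in>E. b \<cdot> co v b)" for v
    unfolding co_def by (rule someI_ex[OF E(2)])
  have co_unique: "co v b = c b" if "v = (\<Sum>b\<in>E. b \<cdot> c b)" "b \<in> E" for v c b
  proof -
    have "(\<Sum>b\<in>E. b \<cdot> (co v b + - c b)) = (\<Sum>b\<in>E. b \<cdot> co v b) - (\<Sum>b\<in>E. b \<cdot> c b)"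
      by (simp only: act_add_right act_minus_right sum.distrib sum_negf diff_conv_add_uminus)
    also have "\<dots> = 0" by (simp only: co[of v, symmetric] that(1)[symmetric] diff_self)
    finally have "(\<Sum>b\<in>E. b \<cdot> (co v b + - c b)) = 0" .
    from E(3)[OF this] show ?thesis using that(2) by simp
  qed
  have "\<exists>b\<in>E. co w b \<noteq> 0"
  proof (rule ccontr)
    assume "\<not> (\<exists>b\<in>E. co w b \<noteq> 0)"
    then have "w = 0" using co[of w] by simp
    then show False using assms(2) by simp
  qed
  then obtain b where b: "b \<in> E" "co w b \<noteq> 0" by blast
  have "co (v + v') b = co v b + co v' b" for v v'
    by (rule co_unique[OF _ b(1)]) (subst co[of v], subst co[of v'], simp add: act_add_right sum.distrib)
  moreover have "co (v \<cdot> d) b = co v b * d" for v d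
  proof (rule co_unique[OF _ b(1)])
    have "(\<Sum>b\<in>T. b \<cdot> c b) \<cdot> d = (\<Sum>b\<in>T. b \<cdot> (c b * d))" for T c
      by (induction T rule: infinite_finite_induct) (simp_all add: act_add_left act_mult)
    then show "v \<cdot> d = (\<Sum>b\<in>E. b \<cdot> (co v b * d))" using co[of v] by metis
  qed
  ultimately show thesis using that[of "\<lambda>v. co v b"] b(2) by blast
qed

end

locale graded_division_module = graded_right_module sD Dg act Vg + D: graded_division_algebra sD Dg
  for sD :: "'f::field \<Rightarrow> 'd::ring_1 \<Rightarrow> 'd"
    and Dg :: "'g::ab_group_add \<Rightarrow> 'd set"
    and act :: "'v::ab_group_add \<Rightarrow> 'd \<Rightarrow> 'v" (infixl "\<cdot>" 75)
    and Vg :: "'g \<Rightarrow> 'v set"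
begin

text \<open>Some homogeneous part of a functional with \<open>f0 w \<noteq> 0\<close> is still
  nonzero at \<open>w\<close>. Its value there is homogeneous, hence invertible, and left
  multiplication by the inverse does not disturb right linearity.\<close>

lemma homogeneous_functional:
  assumes fr: "finite_rank act" and w: "w \<in> Vg h" "w \<noteq> 0"
  obtains f where "\<And>v v'. f (v + v') = f v + f v'" "\<And>v d. f (v \<cdot> d) = f v * d"
    "\<And>b v. v \<in> Vg b \<Longrightarrow> f v \<in> Dg (b - h)" "f w = 1"
proof -
  obtain f0 where f0: "\<And>v v'. f0 (v + v') = f0 v + f0 v'" "\<And>v d. f0 (v \<cdot> d) = f0 v * d" "f0 w \<noteq> 0"
    using finite_rank_functional[OF fr w(2)] by blast
  obtain g where g: "D.hcomp (f0 w) g \<noteq> 0" using D.nonzero_hcomp[OF f0(3)] by blast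
  obtain f1 where f1: "\<And>v v'. f1 (v + v') = f1 v + f1 v'" "\<And>v d. f1 (v \<cdot> d) = f1 v * d"
    "\<And>b v. v \<in> Vg b \<Longrightarrow> f1 v = D.hcomp (f0 v) (b + (g - h))"
    using linear_functional_component[OF f0(1,2), where k = "g - h"] by blast
  have "f1 w = D.hcomp (f0 w) g" using f1(3)[OF w(1)] by simp
  then obtain y where y: "y * f1 w = 1" "y \<in> Dg (- g)"
    using D.homogeneous_inverse[OF D.hcomp_mem g] by metis
  have "y * f1 v \<in> Dg (b - h)" if "v \<in> Vg b" for b v
    using D.comp_mult[OF y(2) D.hcomp_mem, of "f0 v" "b + (g - h)"] f1(3)[OF that]
    by (simp add: algebra_simps)
  then show thesis
    using that[of "\<lambda>v. y * f1 v"] f1(1,2) y(1) by (simp add: distrib_left mult.assoc)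
qed

end

section \<open>The form attached to a rank one idempotent\<close>

locale module_involution = graded_division_module sD Dg act Vg
  for sD :: "'f::field \<Rightarrow> 'd::ring_1 \<Rightarrow> 'd"
    and Dg :: "'g::ab_group_add \<Rightarrow> 'd set"
    and act :: "'v::ab_group_add \<Rightarrow> 'd \<Rightarrow> 'v" (infixl "\<cdot>" 75)
    and Vg :: "'g \<Rightarrow> 'v set" +
  fixes \<phi> :: "('v \<Rightarrow> 'v) \<Rightarrow> ('v \<Rightarrow> 'v)"
  assumes V_nonzero: "\<exists>v::'v. v \<noteq> 0"
    and V_fin_rank: "finite_rank act"
    and phi_involution: "involution_on (End_D act) (\<circ>) (End_scale sD act) \<phi>"
    and phi_degree: "degree_preserving (End_comp act Vg) \<phi>"
begin

lemma phi_mem: "r \<in> End_D act \<Longrightarrow> \<phi> r \<in> End_D act"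
  and phi_add: "r \<in> End_D act \<Longrightarrow> s \<in> End_D act \<Longrightarrow> \<phi> (r + s) = \<phi> r + \<phi> s"
  and phi_comp: "r \<in> End_D act \<Longrightarrow> s \<in> End_D act \<Longrightarrow> \<phi> (r \<circ> s) = \<phi> s \<circ> \<phi> r"
  and phi_phi: "r \<in> End_D act \<Longrightarrow> \<phi> (\<phi> r) = r"
  and phi_scale: "r \<in> End_D act \<Longrightarrow> \<phi> (End_scale sD act c r) = End_scale sD act c (\<phi> r)"
  using phi_involution by (auto simp: involution_on_def)

lemma phi_End_comp: "r \<in> End_comp act Vg g \<Longrightarrow> \<phi> r \<in> End_comp act Vg g"
  using phi_degree by (auto simp: degree_preserving_def)

lemma phi_0: "\<phi> 0 = 0"
  using phi_add[OF zero_End_D zero_End_D] by simp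

text \<open>The auxiliary maps \<open>p\<close>, \<open>q\<close> and \<open>r\<close> of the
  construction survive only through \<open>w1\<close>, \<open>B0\<close> and
  \<open>\<delta>\<close>; the listed facts are what left linearity, adjunction and symmetry will be
  recovered from.\<close>

lemma base_form_exists:
  obtains f :: "'v \<Rightarrow> 'd" and v1 w1 B0 \<delta> where
    "\<And>v w. f (v + w) = f v + f w" "\<And>v d. f (v \<cdot> d) = f v * d" "f v1 = 1"
    "\<exists>g. v1 \<in> Vg g" "\<exists>g. w1 \<in> Vg g"
    "\<And>v v' w. B0 (v + v') w = B0 v w + B0 v' w"
    "\<And>v w w'. B0 v (w + w') = B0 v w + B0 v w'"
    "\<And>v w d. B0 v (w \<cdot> d) = B0 v w * d"
    "\<And>a v w. a \<in> End_D act \<Longrightarrow> B0 (a v) w = B0 v (\<phi> a w)"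
    "homogeneous_form Dg Vg B0" "B0 v1 w1 = 1"
    "\<And>v w. \<phi> (\<lambda>x. v \<cdot> f x) w = w1 \<cdot> B0 v w"
    "\<delta> = 1 \<or> \<delta> = - 1" "\<And>v w. B0 (v1 \<cdot> B0 v w) w1 = B0 w v * \<delta>"
proof -
  obtain v0 :: 'v where "v0 \<noteq> 0" using V_nonzero by blast
  then obtain v1 g1 where v1: "v1 \<in> Vg g1" "v1 \<noteq> 0"
    using V.nonzero_hcomp V.hcomp_mem by blast
  obtain f where f_add: "\<And>v v'. f (v + v') = f v + f v'" and f_act: "\<And>v d. f (v \<cdot> d) = f v * d"
    and f_deg: "\<And>b v. v \<in> Vg b \<Longrightarrow> f v \<in> Dg (b - g1)" and f_v1: "f v1 = 1"
    using homogeneous_functional[OF V_fin_rank v1] by blast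
  define \<theta> where "\<theta> v = (\<lambda>w. v \<cdot> f w)" for v
  have \<theta>_mem: "\<theta> v \<in> End_D act" for v
    by (rule End_DI) (simp_all add: \<theta>_def f_add f_act act_add_right act_mult)
  have \<theta>_hom: "\<theta> v \<in> End_comp act Vg (a - g1)" if v: "v \<in> Vg a" for v a
  proof (rule End_compI[OF \<theta>_mem])
    fix h w assume "w \<in> Vg h"
    from act_comp[OF v f_deg[OF this]] show "\<theta> v w \<in> Vg (a - g1 + h)"
      by (simp add: \<theta>_def algebra_simps)
  qed
  have comp_\<theta>: "a \<circ> \<theta> v = \<theta> (a v)" if "a \<in> End_D act" for a v
    using that by (auto simp: \<theta>_def End_D_act)
  have \<theta>_v1: "\<theta> v v1 = v" for v by (simp add: \<theta>_def f_v1 act_one)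
  define e where "e = \<theta> v1"
  have e_mem: "e \<in> End_D act" by (simp add: e_def \<theta>_mem)
  have e_v1: "e (v1 \<cdot> d) = v1 \<cdot> d" for d by (simp add: e_def \<theta>_def f_act f_v1)
  have \<theta>_e: "\<theta> v \<circ> e = \<theta> v" for v
    by (auto simp: e_def \<theta>_def f_act f_v1)
  define p where "p = \<phi> e"
  have p_mem: "p \<in> End_D act" by (simp add: p_def phi_mem e_mem)
  have phi_p: "\<phi> p = e" by (simp add: p_def phi_phi e_mem)
  have p_p: "p \<circ> p = p" using phi_comp[OF e_mem e_mem] \<theta>_e[of v1] by (simp add: p_def e_def)
  have p_deg: "p \<in> End_comp act Vg 0" using phi_End_comp[OF \<theta>_hom[OF v1(1)]] by (simp add: p_def e_def)
  have "p \<noteq> 0"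
  proof
    assume "p = 0"
    then have "e = 0" using phi_p phi_0 by simp
    then show False using e_v1[of 1] v1 by (simp add: act_one)
  qed
  then obtain b w0 where w0: "w0 \<in> Vg b" "p w0 \<noteq> 0"
    using End_D_nonzero_homogeneous[OF p_mem] by blast
  have pw0: "p w0 \<in> Vg b" using End_compD[OF p_deg w0(1)] by simp
  obtain f2 where f2_add: "\<And>v v'. f2 (v + v') = f2 v + f2 v'" and f2_act: "\<And>v d. f2 (v \<cdot> d) = f2 v * d"
    and f2_deg: "\<And>c v. v \<in> Vg c \<Longrightarrow> f2 v \<in> Dg (c - b)" and f2_w: "f2 (p w0) = 1"
    using homogeneous_functional[OF V_fin_rank pw0 w0(2)] by blast
  \<comment> \<open>As \<open>f2\<close> is normalised at \<open>p w0\<close>,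
    \<open>x w0 = v1\<close>: this is a nonzero homogeneous element of \<open>e R \<phi>(e)\<close>,
    of degree \<open>g1 - b\<close>.\<close>
  define x where "x w = v1 \<cdot> f2 (p w)" for w
  have x_mem: "x \<in> End_D act"
    by (rule End_DI)
       (simp_all add: x_def End_D_add[OF p_mem] End_D_act[OF p_mem] f2_add f2_act act_add_right act_mult)
  have x_deg: "x \<in> End_comp act Vg (g1 - b)"
  proof (rule End_compI[OF x_mem])
    fix h w assume "w \<in> Vg h"
    then have "p w \<in> Vg h" using End_compD[OF p_deg] by fastforce
    from act_comp[OF v1(1) f2_deg[OF this]] show "x w \<in> Vg (g1 - b + h)"
      by (simp add: x_def algebra_simps)
  qed
  have x_0: "x \<noteq> 0"
  proof
    assume "x = 0"
    then have "x w0 = 0" by simp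
    then show False using v1(2) by (simp add: x_def f2_w act_one)
  qed
  have e_x: "e \<circ> x = x" by (auto simp: x_def e_v1)
  have x_p: "x \<circ> p = x" using p_p by (auto simp: x_def fun_eq_iff)
  have e_phi_x: "e \<circ> \<phi> x = \<phi> x" using phi_comp[OF x_mem p_mem] x_p phi_p by simp
  have phi_x_p: "\<phi> x \<circ> p = \<phi> x" using phi_comp[OF e_mem x_mem] e_x by (simp add: p_def)
  \<comment> \<open>If \<open>x + \<phi> x\<close> vanishes then \<open>x\<close> is skew, otherwise
    \<open>x + \<phi> x\<close> is symmetric, in every characteristic. The sign
    \<open>\<delta>\<close> is an element of \<open>D\<close>, so that it can act on
    \<open>V\<close>.\<close>
  obtain r \<delta> where r_deg: "r \<in> End_comp act Vg (g1 - b)" and r_0: "r \<noteq> 0"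
    and e_r: "e \<circ> r = r" and r_p: "r \<circ> p = r"
    and phi_r: "\<And>v. \<phi> r v = r v \<cdot> \<delta>" and \<delta>: "\<delta> = (1::'d) \<or> \<delta> = - 1"
  proof (cases "x + \<phi> x = 0")
    case True
    then have "\<phi> x = - x" by (simp add: add_eq_0_iff)
    then show thesis using that[of x "- 1"] x_deg x_0 e_x x_p by (simp add: act_minus_right act_one)
  next
    case False
    have "\<phi> (x + \<phi> x) = x + \<phi> x"
      using phi_add[OF x_mem phi_mem[OF x_mem]] by (simp add: phi_phi x_mem add.commute)
    moreover have "x + \<phi> x \<in> End_comp act Vg (g1 - b)"
      using x_deg phi_End_comp[OF x_deg]
      by (auto intro!: End_compI plus_End_D V.add_mem dest: End_compD End_comp_End_D)
    moreover have "e \<circ> (x + \<phi> x) = x + \<phi> x"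
      using e_x e_phi_x by (auto simp: fun_eq_iff End_D_add[OF e_mem])
    moreover have "(x + \<phi> x) \<circ> p = x + \<phi> x"
      using x_p phi_x_p by (auto simp: fun_eq_iff)
    ultimately show thesis using that[of "x + \<phi> x" 1] False by (simp add: act_one)
  qed
  have r_mem: "r \<in> End_D act" using r_deg by (rule End_comp_End_D)
  have r_v1: "r v = v1 \<cdot> f (r v)" for v using fun_cong[OF e_r, of v] by (simp add: e_def \<theta>_def)
  obtain c u where u: "u \<in> Vg c" "r u \<noteq> 0" using End_D_nonzero_homogeneous[OF r_mem r_0] by blast
  have fru: "f (r u) \<in> Dg (g1 - b + c - g1)" using f_deg[OF End_compD[OF r_deg u(1)]] .
  have "f (r u) \<noteq> 0" using r_v1[of u] u(2) by auto
  then obtain y where y: "f (r u) * y = 1" "y \<in> Dg (- (g1 - b + c - g1))"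
    using D.homogeneous_inverse[OF fru] by metis
  \<comment> \<open>\<open>u \<cdot> y\<close> is a preimage of \<open>v1\<close> under
    \<open>r\<close>. Applying \<open>p\<close> moves it into the image of \<open>p\<close> and, by
    \<open>r \<circ> p = r\<close>, keeps it a preimage.\<close>
  define w1 where "w1 = p (u \<cdot> y)"
  have r_w1: "r w1 = v1"
  proof -
    have "r w1 = r u \<cdot> y" unfolding w1_def using fun_cong[OF r_p, of "u \<cdot> y"] by (simp add: End_D_act[OF r_mem])
    also have "\<dots> = v1 \<cdot> (f (r u) * y)" by (subst r_v1) (simp add: act_mult)
    finally show ?thesis by (simp add: y act_one)
  qed
  have p_w1: "p w1 = w1" unfolding w1_def using fun_cong[OF p_p, of "u \<cdot> y"] by simp
  have w1_deg: "w1 \<in> Vg b"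
    using End_compD[OF p_deg act_comp[OF u(1) y(2)]] by (simp add: w1_def algebra_simps)
  define q where "q w = w1 \<cdot> f (r w)" for w
  have q_eq: "q = \<theta> w1 \<circ> r" by (auto simp: q_def \<theta>_def)
  have q_mem: "q \<in> End_D act" unfolding q_eq by (intro comp_End_D \<theta>_mem r_mem)
  have q_deg: "q \<in> End_comp act Vg 0"
    using comp_End_comp[OF \<theta>_hom[OF w1_deg] r_deg] by (simp add: q_eq)
  have q_q: "q \<circ> q = q" by (auto simp: q_def End_D_act[OF r_mem] r_w1 f_act f_v1)
  have q_p: "q \<circ> p = q" using r_p by (auto simp: q_def fun_eq_iff)
  have p_q: "p \<circ> q = q" by (auto simp: q_def End_D_act[OF p_mem] p_w1)
  \<comment> \<open>\<open>\<phi> q\<close> lies in \<open>e R e\<close>, so it is given by one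
    element \<open>d\<close> of \<open>D\<close>. This \<open>d\<close> is idempotent, nonzero and
    of degree 0, hence invertible, hence 1, and \<open>\<phi> q = e\<close>. Consequently the image
    of \<open>p\<close> is \<open>w1 D\<close>.\<close>
  have "q = p"
  proof -
    have e_q: "e \<circ> \<phi> q = \<phi> q" using phi_comp[OF q_mem p_mem] q_p phi_p by simp
    have "\<phi> q \<circ> e = \<phi> q" using phi_comp[OF p_mem q_mem] p_q phi_p by simp
    then have phi_q: "\<phi> q = \<theta> (\<phi> q v1)" using comp_\<theta>[OF phi_mem[OF q_mem], of v1] by (simp add: e_def)
    define d where "d = f (\<phi> q v1)"
    have d: "\<phi> q v1 = v1 \<cdot> d" using fun_cong[OF e_q, of v1] by (simp add: e_def \<theta>_def d_def)
    have "\<phi> q \<circ> \<phi> q = \<phi> q" using phi_comp[OF q_mem q_mem] q_q by simp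
    then have "\<phi> q (\<phi> q v1) = \<phi> q v1" by (metis comp_apply)
    then have "v1 \<cdot> (d * d) = v1 \<cdot> d"
      by (simp add: d End_D_act[OF phi_mem[OF q_mem]] act_mult)
    then have "f (v1 \<cdot> (d * d)) = f (v1 \<cdot> d)" by simp
    then have dd: "d * d = d" by (simp add: f_act f_v1)
    have "d \<in> Dg (g1 - g1)"
      unfolding d_def using End_compD[OF phi_End_comp[OF q_deg] v1(1)] by (intro f_deg) simp
    moreover have "d \<noteq> 0"
    proof
      assume "d = 0"
      then have "\<phi> q = 0" using phi_q d by (auto simp: \<theta>_def)
      then have "q = 0" using phi_phi[OF q_mem] phi_0 by simp
      then have "q w1 = 0" by simp
      then have "w1 = 0" by (simp add: q_def r_w1 f_v1 act_one)
      then show False using r_w1 End_D_0[OF r_mem] v1(2) by simp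
    qed
    ultimately obtain z where "z * d = 1" using D.homogeneous_invertible by blast
    then have "d = 1" using dd by (metis mult.assoc mult_1_left)
    then have "\<phi> q = e" using phi_q d by (simp add: e_def act_one)
    then show "q = p" using phi_phi[OF q_mem] by (simp add: p_def)
  qed
  define B0 where "B0 v w = f (r (\<phi> (\<theta> v) w))" for v w
  \<comment> \<open>Under \<open>\<phi>\<close>, \<open>\<theta> v \<circ> e = \<theta> v\<close>
    becomes \<open>p \<circ> \<phi> (\<theta> v) = \<phi> (\<theta> v)\<close>, so all values are
    multiples of \<open>w1\<close>; \<open>B0\<close> is the multiplier.\<close>
  have phi_\<theta>: "\<phi> (\<theta> v) w = w1 \<cdot> B0 v w" for v w
  proof -
    have "p \<circ> \<phi> (\<theta> v) = \<phi> (\<theta> v)" using phi_comp[OF \<theta>_mem e_mem] \<theta>_e by (simp add: p_def)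
    then have "\<phi> (\<theta> v) w = q (\<phi> (\<theta> v) w)" using \<open>q = p\<close> by (metis comp_apply)
    then show ?thesis by (simp add: q_def B0_def)
  qed
  have phi_\<theta>_mem: "\<phi> (\<theta> v) \<in> End_D act" for v by (rule phi_mem[OF \<theta>_mem])
  have B0_add_left: "B0 (v + v') w = B0 v w + B0 v' w" for v v' w
  proof -
    have "\<theta> (v + v') = \<theta> v + \<theta> v'" by (auto simp: \<theta>_def act_add_left)
    then show ?thesis
      using phi_add[OF \<theta>_mem \<theta>_mem] by (simp add: B0_def End_D_add[OF r_mem] f_add)
  qed
  have B0_add_right: "B0 v (w + w') = B0 v w + B0 v w'" for v w w'
    by (simp add: B0_def End_D_add[OF r_mem] End_D_add[OF phi_\<theta>_mem] f_add)
  have B0_act_right: "B0 v (w \<cdot> d) = B0 v w * d" for v w d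
    by (simp add: B0_def End_D_act[OF r_mem] End_D_act[OF phi_\<theta>_mem] f_act)
  have B0_adj: "B0 (a v) w = B0 v (\<phi> a w)" if a: "a \<in> End_D act" for a v w
    using phi_comp[OF a \<theta>_mem[of v]] comp_\<theta>[OF a, of v] by (simp add: B0_def)
  have B0_hom: "homogeneous_form Dg Vg B0"
    unfolding homogeneous_form_def
  proof (intro exI allI ballI)
    fix a c v w assume v: "v \<in> Vg a" and w: "w \<in> Vg c"
    have "f (r (\<phi> (\<theta> v) w)) \<in> Dg ((g1 - b) + ((a - g1) + c) - g1)"
      by (intro f_deg End_compD[OF r_deg] End_compD[OF phi_End_comp[OF \<theta>_hom[OF v]] w])
    then show "B0 v w \<in> Dg (- b - g1 + a + c)" by (simp add: B0_def algebra_simps)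
  qed
  have B0_unit: "B0 v1 w1 = 1"
    using p_w1 by (simp add: B0_def r_w1 f_v1 flip: e_def p_def)
  \<comment> \<open>\<open>r \<circ> \<phi> (\<theta> v)\<close> sends \<open>w\<close> to
    \<open>v1 \<cdot> B0 v w\<close>. Across the form it becomes
    \<open>\<theta> v \<circ> \<phi> r\<close>, and \<open>\<phi> r\<close> contributes
    \<open>\<delta>\<close>.\<close>
  have B0_sym: "B0 (v1 \<cdot> B0 v w) w1 = B0 w v * \<delta>" for v w
  proof -
    have "v1 \<cdot> B0 v w = (r \<circ> \<phi> (\<theta> v)) w" by (simp add: B0_def flip: r_v1)
    then have "B0 (v1 \<cdot> B0 v w) w1 = B0 w (\<phi> (r \<circ> \<phi> (\<theta> v)) w1)"
      using B0_adj[OF comp_End_D[OF r_mem phi_\<theta>_mem]] by metis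
    also have "\<phi> (r \<circ> \<phi> (\<theta> v)) = \<theta> v \<circ> \<phi> r"
      using phi_comp[OF r_mem phi_\<theta>_mem] by (simp add: phi_phi \<theta>_mem)
    also have "(\<theta> v \<circ> \<phi> r) w1 = v \<cdot> \<delta>" by (simp add: phi_r r_w1 \<theta>_def f_act f_v1)
    finally show ?thesis by (simp add: B0_act_right)
  qed
  show thesis
    by (rule that[of f v1 w1 B0 \<delta>])
       (use f_add f_act f_v1 v1 w1_deg B0_add_left B0_add_right B0_act_right B0_adj B0_hom B0_unit
          phi_\<theta> \<delta> B0_sym in \<open>auto simp: \<theta>_def\<close>)
qed

end

section \<open>The involution of \<open>D\<close> carried by the base form\<close>

lemma (in graded_vector_space) degree_unique:
  "x \<in> Ag g \<Longrightarrow> x \<in> Ag h \<Longrightarrow> x \<noteq> 0 \<Longrightarrow> g = h"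
  using hcomp_homogeneous[of x g h] hcomp_homogeneous[of x h h] by (auto split: if_splits)

lemma involution_on_UNIV_one:
  fixes \<sigma> :: "'a::ring_1 \<Rightarrow> 'a"
  assumes "involution_on UNIV (*) s \<sigma>"
  shows "\<sigma> 1 = 1"
proof -
  have "\<sigma> (\<sigma> 1 * 1) = \<sigma> 1 * \<sigma> (\<sigma> 1)" "\<sigma> (\<sigma> 1) = 1"
    using assms unfolding involution_on_def by blast+
  then show ?thesis by simp
qed

locale base_form = module_involution sD Dg act Vg \<phi>
  for sD :: "'f::field \<Rightarrow> 'd::ring_1 \<Rightarrow> 'd"
    and Dg :: "'g::ab_group_add \<Rightarrow> 'd set"
    and act :: "'v::ab_group_add \<Rightarrow> 'd \<Rightarrow> 'v" (infixl "\<cdot>" 75)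
    and Vg :: "'g \<Rightarrow> 'v set"
    and \<phi> :: "('v \<Rightarrow> 'v) \<Rightarrow> ('v \<Rightarrow> 'v)" +
  fixes f :: "'v \<Rightarrow> 'd" and v1 w1 :: 'v and B0 :: "'v \<Rightarrow> 'v \<Rightarrow> 'd" and \<delta> :: 'd
  assumes f_add: "f (v + w) = f v + f w" and f_act: "f (v \<cdot> d) = f v * d" and f_v1: "f v1 = 1"
    and v1_hom: "\<exists>g. v1 \<in> Vg g" and w1_hom: "\<exists>g. w1 \<in> Vg g"
    and B0_add_left: "B0 (v + v') w = B0 v w + B0 v' w"
    and B0_add_right: "B0 v (w + w') = B0 v w + B0 v w'"
    and B0_act_right: "B0 v (w \<cdot> d) = B0 v w * d"
    and B0_adj: "a \<in> End_D act \<Longrightarrow> B0 (a v) w = B0 v (\<phi> a w)"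
    and B0_hom: "homogeneous_form Dg Vg B0"
    and B0_unit: "B0 v1 w1 = 1"
    and phi_theta_raw: "\<phi> (\<lambda>x. v \<cdot> f x) w = w1 \<cdot> B0 v w"
    and delta: "\<delta> = 1 \<or> \<delta> = - 1"
    and B0_sym: "B0 (v1 \<cdot> B0 v w) w1 = B0 w v * \<delta>"
begin

definition \<theta> :: "'v \<Rightarrow> 'v \<Rightarrow> 'v" where "\<theta> v = (\<lambda>x. v \<cdot> f x)"

text \<open>Because \<open>B0 v1 w1 = 1\<close>, this is the factor by which a scalar on the left
  argument leaves the form.\<close>

definition \<psi> :: "'d \<Rightarrow> 'd" where "\<psi> d = B0 (v1 \<cdot> d) w1"

lemma theta_End_D: "\<theta> v \<in> End_D act"
  by (rule End_DI) (simp_all add: \<theta>_def f_add f_act act_add_right act_mult)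

lemma theta_v1: "\<theta> v (v1 \<cdot> d) = v \<cdot> d"
  by (simp add: \<theta>_def f_act f_v1)

lemma theta_v1': "\<theta> v v1 = v"
  using theta_v1[of v 1] by (simp add: act_one)

lemma phi_theta: "\<phi> (\<theta> v) w = w1 \<cdot> B0 v w"
  by (simp add: \<theta>_def phi_theta_raw)

lemma act_v1_inj: "v1 \<cdot> x = v1 \<cdot> y \<Longrightarrow> x = y"
  by (metis f_act f_v1 mult_1_left)

text \<open>The argument \<open>v \<cdot> d\<close> is \<open>\<theta> v (v1 \<cdot> d)\<close>, and
  \<open>\<theta> v\<close> moved to the right side replaces \<open>w\<close> by
  \<open>w1 \<cdot> B0 v w\<close>.\<close>

lemma B0_act_left: "B0 (v \<cdot> d) w = \<psi> d * B0 v w"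
proof -
  have "B0 (v \<cdot> d) w = B0 (\<theta> v (v1 \<cdot> d)) w" by (simp add: theta_v1)
  then show ?thesis by (simp add: B0_adj[OF theta_End_D] phi_theta B0_act_right \<psi>_def)
qed

lemma psi_B0: "\<psi> (B0 v w) = B0 w v * \<delta>"
  by (simp add: \<psi>_def B0_sym)

lemma delta_square: "\<delta> * \<delta> = 1" and delta_commute: "\<delta> * x = x * \<delta>"
  using delta by auto

lemma psi_add: "\<psi> (x + y) = \<psi> x + \<psi> y"
  by (simp add: \<psi>_def act_add_right B0_add_left)

lemma psi_mult: "\<psi> (x * y) = \<psi> y * \<psi> x"
proof -
  have "\<psi> (x * y) = B0 (v1 \<cdot> x \<cdot> y) w1" by (simp add: \<psi>_def act_mult)
  then show ?thesis by (simp add: B0_act_left B0_unit)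
qed

lemma psi_one: "\<psi> 1 = 1"
  by (simp add: \<psi>_def act_one B0_unit)

text \<open>Symmetry of \<open>B0\<close> gives the value \<open>B0 w1 v1 * x * \<delta>\<close>. As
  \<open>\<delta>\<close> is a sign, only the constant \<open>B0 w1 v1 * \<delta>\<close> is
  unknown, and \<open>x = 1\<close> determines it.\<close>

lemma psi_psi: "\<psi> (\<psi> x) = x"
proof -
  have *: "\<psi> (\<psi> x) = B0 w1 v1 * x * \<delta>" for x
    by (simp add: \<psi>_def[of x] psi_B0 B0_act_right)
  have "B0 w1 v1 * \<delta> = 1" using *[of 1] psi_one by simp
  moreover have "\<psi> (\<psi> x) = B0 w1 v1 * \<delta> * x"
    unfolding * by (simp only: mult.assoc delta_commute[of x])
  ultimately show ?thesis by simp
qed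

lemma phi_id: "\<phi> id = id"
proof -
  have "\<phi> (\<phi> id \<circ> id) = \<phi> id \<circ> \<phi> (\<phi> id)" by (rule phi_comp) (simp_all add: phi_mem id_End_D)
  then show ?thesis by (simp add: phi_phi id_End_D)
qed

text \<open>The homothety by \<open>c\<close> is fixed by \<open>\<phi>\<close>, so adjunction at
  \<open>v1\<close> and \<open>w1\<close> shows that \<open>\<psi>\<close> fixes
  \<open>sD c 1\<close>.\<close>

lemma psi_scale: "\<psi> (sD c x) = sD c (\<psi> x)"
proof -
  have "End_scale sD act c id \<in> End_D act"
    using centre_End_D[OF D.centre_scl_one] by (simp add: End_scale_def module_scale_def)
  from B0_adj[OF this, of v1 w1] have "\<psi> (sD c 1) = sD c 1"
    unfolding phi_scale[OF id_End_D] phi_id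
    by (simp add: End_scale_def module_scale_def \<psi>_def B0_act_right B0_unit)
  then show ?thesis
    using psi_mult[of x "sD c 1"] by (simp add: D.scl_mult_right D.scl_mult_left)
qed

text \<open>The degrees of \<open>v1\<close>, \<open>w1\<close> and the form add up to 0, since the
  value at this pair is 1.\<close>

lemma psi_homogeneous: "x \<in> Dg g \<Longrightarrow> \<psi> x \<in> Dg g"
proof -
  assume x: "x \<in> Dg g"
  obtain a b where ab: "v1 \<in> Vg a" "w1 \<in> Vg b" using v1_hom w1_hom by blast
  obtain g0 where g0: "\<And>a b v w. v \<in> Vg a \<Longrightarrow> w \<in> Vg b \<Longrightarrow> B0 v w \<in> Dg (g0 + a + b)"
    using B0_hom unfolding homogeneous_form_def by blast
  have "g0 + a + b = 0"
    using D.degree_unique[OF g0[OF ab]] D.one_mem by (simp add: B0_unit)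
  moreover have "\<psi> x \<in> Dg (g0 + (a + g) + b)"
    unfolding \<psi>_def by (rule g0[OF act_comp[OF ab(1) x] ab(2)])
  ultimately show ?thesis by (metis add.assoc add.commute add_0)
qed

lemma psi_involution: "involution_on UNIV (*) sD \<psi>"
  by (simp add: involution_on_def psi_add psi_scale psi_mult psi_psi)

text \<open>Commuting with \<open>\<theta> v\<close> and evaluating at \<open>v1\<close> gives
  \<open>r v = v \<cdot> f (r v1)\<close> for all \<open>v\<close>; linearity of \<open>r\<close>
  then makes \<open>f (r v1)\<close> central.\<close>

lemma center_End_D: "center_on (End_D act) (\<circ>) = (\<lambda>z v. v \<cdot> z) ` D.centre"
proof (intro equalityI subsetI)
  fix r assume "r \<in> center_on (End_D act) (\<circ>)"
  then have r: "r \<in> End_D act" and comm: "\<And>s. s \<in> End_D act \<Longrightarrow> r \<circ> s = s \<circ> r"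
    by (auto simp: center_on_def)
  define z where "z = f (r v1)"
  have r_z: "r v = v \<cdot> z" for v
    using fun_cong[OF comm[OF theta_End_D[of v]], of v1] by (simp add: theta_v1') (simp add: \<theta>_def z_def)
  have "z * x = x * z" for x
  proof (rule act_v1_inj)
    have "r (v1 \<cdot> x) = v1 \<cdot> z \<cdot> x" by (subst End_D_act[OF r]) (simp add: r_z)
    then show "v1 \<cdot> (z * x) = v1 \<cdot> (x * z)" by (simp add: r_z act_mult)
  qed
  then have "z \<in> D.centre" by (rule D.centreI)
  moreover have "r = (\<lambda>v. v \<cdot> z)" using r_z by blast
  ultimately show "r \<in> (\<lambda>z v. v \<cdot> z) ` D.centre" by blast
next
  fix r assume "r \<in> (\<lambda>z v. v \<cdot> z) ` D.centre"
  then show "r \<in> center_on (End_D act) (\<circ>)"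
    by (auto simp: center_on_def[of "End_D act"] centre_End_D End_D_act)
qed

lemma phi_center:
  assumes "r \<in> center_on (End_D act) (\<circ>)"
  shows "\<phi> r \<in> center_on (End_D act) (\<circ>)"
proof -
  have r: "r \<in> End_D act" and comm: "\<And>s. s \<in> End_D act \<Longrightarrow> r \<circ> s = s \<circ> r"
    using assms by (auto simp: center_on_def)
  have "\<phi> r \<circ> s = s \<circ> \<phi> r" if s: "s \<in> End_D act" for s
    using phi_comp[OF r phi_mem[OF s]] phi_comp[OF phi_mem[OF s] r] comm[OF phi_mem[OF s]]
    by (simp add: phi_phi[OF s])
  then show ?thesis by (simp add: center_on_def phi_mem r)
qed

text \<open>\<open>\<phi>\<close> preserves the centre of the endomorphism algebra, so it sends the
  action of \<open>z\<close> to that of some \<open>z'\<close>; adjunction at \<open>v1\<close> and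
  \<open>w1\<close> gives \<open>z' = \<psi> z\<close>.\<close>

lemma psi_same_kind: "same_kind act \<phi> \<psi>"
  unfolding same_kind_def
proof
  fix z assume z: "z \<in> D.centre"
  have "\<phi> (\<lambda>v. v \<cdot> z) \<in> (\<lambda>z v. v \<cdot> z) ` D.centre"
    using phi_center[of "\<lambda>v. v \<cdot> z"] z by (simp add: center_End_D)
  then obtain z' where z': "\<phi> (\<lambda>v. v \<cdot> z) = (\<lambda>v. v \<cdot> z')" by blast
  have "\<psi> z = z'"
    using B0_adj[OF centre_End_D[OF z], of v1 w1] by (simp add: \<psi>_def z' B0_act_right B0_unit)
  then show "\<phi> (\<lambda>v. v \<cdot> z) = (\<lambda>v. v \<cdot> \<psi> z)" using z' by simp
qed

lemma B0_left_kernel: "(\<And>w. B0 v w = 0) \<Longrightarrow> v = 0"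
proof -
  assume "\<And>w. B0 v w = 0"
  then have "\<phi> (\<theta> v) = 0" by (auto simp: phi_theta)
  then have "\<theta> v = 0" using phi_phi[OF theta_End_D, of v] phi_0 by simp
  then show ?thesis using theta_v1'[of v] by simp
qed

lemma B0_right_kernel: "(\<And>v. B0 v w = 0) \<Longrightarrow> w = 0"
proof (rule B0_left_kernel)
  fix v assume "\<And>v. B0 v w = 0"
  then have "B0 w v * \<delta> = 0" using psi_B0[of v w] psi_add[of 0 0] by simp
  then show "B0 w v = 0" using delta by auto
qed

end

section \<open>The forms adjoint to the involution\<close>

locale compatible_involution = base_form sD Dg act Vg \<phi> f v1 w1 B0 \<delta>
  for sD :: "'f::field \<Rightarrow> 'd::ring_1 \<Rightarrow> 'd"
    and Dg :: "'g::ab_group_add \<Rightarrow> 'd set"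
    and act :: "'v::ab_group_add \<Rightarrow> 'd \<Rightarrow> 'v" (infixl "\<cdot>" 75)
    and Vg :: "'g \<Rightarrow> 'v set"
    and \<phi> :: "('v \<Rightarrow> 'v) \<Rightarrow> ('v \<Rightarrow> 'v)"
    and f :: "'v \<Rightarrow> 'd" and v1 w1 :: 'v and B0 :: "'v \<Rightarrow> 'v \<Rightarrow> 'd" and \<delta> :: 'd +
  fixes \<phi>0 :: "'d \<Rightarrow> 'd"
  assumes phi0_involution: "involution_on UNIV (*) sD \<phi>0"
    and phi0_degree: "degree_preserving Dg \<phi>0"
    and phi0_kind: "same_kind act \<phi> \<phi>0"
    and D_fin_dim: "\<exists>E. finite_dimensional_vector_space sD E"
    and R_phi: "central_simple_with_involution_on (End_D act) (\<circ>) id (End_scale sD act) \<phi>"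
begin

abbreviation forms :: "('v \<Rightarrow> 'v \<Rightarrow> 'd) set" where
  "forms \<equiv> adjoint_forms sD Dg act Vg \<phi> \<phi>0"

lemma phi0_add: "\<phi>0 (x + y) = \<phi>0 x + \<phi>0 y"
  and phi0_scale: "\<phi>0 (sD c x) = sD c (\<phi>0 x)"
  and phi0_mult: "\<phi>0 (x * y) = \<phi>0 y * \<phi>0 x"
  and phi0_phi0 [simp]: "\<phi>0 (\<phi>0 x) = x"
  using phi0_involution by (simp_all add: involution_on_def)

lemma phi0_one: "\<phi>0 1 = 1"
  using phi0_involution by (rule involution_on_UNIV_one)

lemma phi0_zero: "\<phi>0 0 = 0"
  using phi0_add[of 0 0] by simp

lemma phi0_minus: "\<phi>0 (- x) = - \<phi>0 x"
  using phi0_add[of x "- x"] by (simp add: phi0_zero add_eq_0_iff)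

lemma phi0_homogeneous: "x \<in> Dg g \<Longrightarrow> \<phi>0 x \<in> Dg g"
  using phi0_degree by (auto simp: degree_preserving_def)

lemma phi0_scl_one: "\<phi>0 (sD c 1) = sD c 1"
  by (simp add: phi0_scale phi0_one)

lemma phi0_hcomp: "D.hcomp (\<phi>0 x) g = \<phi>0 (D.hcomp x g)"
  using hcomp_shift[OF D.graded_vector_space_axioms D.graded_vector_space_axioms, of \<phi>0 0 x g]
  by (simp add: phi0_add phi0_homogeneous)

lemma phi0_eq_psi: "z \<in> D.centre \<Longrightarrow> \<phi>0 z = \<psi> z"
  using psi_same_kind phi0_kind act_v1_inj unfolding same_kind_def by metis

lemma phi0_centre: "z \<in> D.centre \<Longrightarrow> \<phi>0 z \<in> D.centre"
  by (rule D.centreI) (metis phi0_phi0 phi0_mult D.centreD)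

lemma formsD:
  assumes "B \<in> forms"
  shows "B (v + v') w = B v w + B v' w" "B v (w + w') = B v w + B v w'"
    "B (v \<cdot> d) w = \<phi>0 d * B v w" "B v (w \<cdot> d) = B v w * d"
    "homogeneous_form Dg Vg B" "nondegenerate B"
    "r \<in> End_D act \<Longrightarrow> B (r v) w = B v (\<phi> r w)"
  using assms
  by (auto simp: adjoint_forms_def sesquilinear_def is_adjunction_def Vector_Spaces.linear_iff)

text \<open>Write \<open>v = \<theta> v v1\<close> and move \<open>\<theta> v\<close> across
  \<open>B\<close>: the right argument becomes \<open>w1 \<cdot> B0 v w\<close>, whose scalar comes
  out on the right.\<close>

lemma form_eq_base_form: "B \<in> forms \<Longrightarrow> B v w = B v1 w1 * B0 v w"
  using formsD(7)[OF _ theta_End_D, of B v v1 w] by (simp add: theta_v1' phi_theta formsD)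

lemma form_coefficient:
  assumes B: "B \<in> forms"
  shows "\<exists>g. B v1 w1 \<in> Dg g" "B v1 w1 \<noteq> 0" "\<phi>0 d * B v1 w1 = B v1 w1 * \<psi> d"
proof -
  show "\<exists>g. B v1 w1 \<in> Dg g"
    using formsD(5)[OF B] v1_hom w1_hom unfolding homogeneous_form_def by blast
  show "B v1 w1 \<noteq> 0"
  proof
    assume "B v1 w1 = 0"
    then have "B v1 w = 0" for w using form_eq_base_form[OF B, of v1 w] by simp
    then have "v1 = 0" using formsD(6)[OF B] by (auto simp: nondegenerate_def)
    then show False using f_v1 f_act[of 0 0] by simp
  qed
  show "\<phi>0 d * B v1 w1 = B v1 w1 * \<psi> d"
    using form_eq_base_form[OF B, of "v1 \<cdot> d" w1] formsD(3)[OF B] by (simp add: \<psi>_def)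
qed

text \<open>With \<open>form_eq_base_form\<close> and \<open>form_coefficient\<close> this gives a
  bijection between adjoint forms and nonzero homogeneous solutions \<open>c\<close> of the
  intertwining equation: left multiplication by \<open>c\<close> exchanges \<open>\<psi>\<close> for
  \<open>\<phi>0\<close>.\<close>

lemma form_of_intertwiner:
  assumes c: "c \<in> Dg g" "c \<noteq> 0" and int: "\<And>d. \<phi>0 d * c = c * \<psi> d"
  shows "(\<lambda>v w. c * B0 v w) \<in> forms"
proof -
  have left: "c * B0 (v \<cdot> d) w = \<phi>0 d * (c * B0 v w)" for v d w
    by (simp add: B0_act_left flip: mult.assoc int)
  have "Vector_Spaces.linear (module_scale sD act) sD (\<lambda>v. c * B0 v w)" for w
    using V.vector_space_axioms D.vector_space_axioms
    by (auto simp: Vector_Spaces.linear_iff B0_add_left distrib_left module_scale_def left phi0_scl_one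
        simp flip: D.scl_conv_mult)
  moreover have "Vector_Spaces.linear (module_scale sD act) sD (\<lambda>w. c * B0 v w)" for v
    using V.vector_space_axioms D.vector_space_axioms
    by (auto simp: Vector_Spaces.linear_iff B0_add_right distrib_left module_scale_def B0_act_right
        D.scl_mult_right)
  ultimately have "sesquilinear sD act \<phi>0 (\<lambda>v w. c * B0 v w)"
    by (simp add: sesquilinear_def left B0_act_right mult.assoc)
  moreover have "homogeneous_form Dg Vg (\<lambda>v w. c * B0 v w)"
  proof -
    obtain g0 where g0: "\<And>a b v w. v \<in> Vg a \<Longrightarrow> w \<in> Vg b \<Longrightarrow> B0 v w \<in> Dg (g0 + a + b)"
      using B0_hom unfolding homogeneous_form_def by blast
    have "c * B0 v w \<in> Dg ((g + g0) + a + b)" if "v \<in> Vg a" "w \<in> Vg b" for a b v w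
      using D.comp_mult[OF c(1) g0[OF that]] by (simp add: add.assoc)
    then show ?thesis unfolding homogeneous_form_def by blast
  qed
  moreover have "nondegenerate (\<lambda>v w. c * B0 v w)"
    using B0_left_kernel B0_right_kernel D.homogeneous_mult_eq_0[OF c] unfolding nondegenerate_def by blast
  moreover have "is_adjunction act \<phi> (\<lambda>v w. c * B0 v w)"
    by (simp add: is_adjunction_def B0_adj)
  ultimately show ?thesis by (simp add: adjoint_forms_def)
qed

section \<open>Existence, ratios and symmetry of adjoint forms\<close>

lemma forms_nonempty: "\<exists>B. B \<in> forms"
proof -
  obtain E where fd: "finite_dimensional_vector_space sD E" using D_fin_dim by blast
  have cent: "\<phi>0 (\<psi> z) = z" if "z \<in> D.centre" for z
    using phi0_eq_psi[OF that] by (metis phi0_phi0)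
  obtain u g where u: "u \<in> Dg g" "u \<noteq> 0" "\<And>x. u * x = \<phi>0 (\<psi> x) * u"
    by (rule D.graded_Skolem_Noether[OF fd, of "\<lambda>x. \<phi>0 (\<psi> x)"])
       (auto simp: phi0_add psi_add phi0_mult psi_mult phi0_one psi_one phi0_homogeneous psi_homogeneous cent)
  have "\<phi>0 d * u = u * \<psi> d" for d using u(3)[of "\<psi> d"] by (simp add: psi_psi)
  from form_of_intertwiner[OF u(1,2) this] show ?thesis by blast
qed

lemma scaled_form:
  assumes B: "B \<in> forms" and z: "z \<in> D.centre" "z \<in> Dg g" "z \<noteq> 0"
  shows "(\<lambda>v w. z * B v w) \<in> forms"
proof -
  obtain h where h: "B v1 w1 \<in> Dg h" using form_coefficient(1)[OF B] by blast
  have "z * B v1 w1 \<noteq> 0"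
    using D.homogeneous_mult_eq_0[OF z(2,3)] form_coefficient(2)[OF B] by blast
  moreover have "\<phi>0 d * (z * B v1 w1) = z * B v1 w1 * \<psi> d" for d
    using form_coefficient(3)[OF B, of d] D.centreD[OF z(1), of "\<phi>0 d"] by (metis mult.assoc)
  ultimately have "(\<lambda>v w. z * B v1 w1 * B0 v w) \<in> forms"
    by (intro form_of_intertwiner[OF D.comp_mult[OF z(2) h]])
  moreover have "(\<lambda>v w. z * B v1 w1 * B0 v w) = (\<lambda>v w. z * B v w)"
    by (simp add: mult.assoc flip: form_eq_base_form[OF B])
  ultimately show ?thesis by simp
qed

text \<open>Both coefficients at \<open>v1\<close>, \<open>w1\<close> intertwine
  \<open>\<psi>\<close> with \<open>\<phi>0\<close>, so their quotient commutes with every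
  \<open>\<phi>0 d\<close>, that is, with all of \<open>D\<close>.\<close>

lemma forms_ratio:
  assumes B: "B \<in> forms" and B': "B' \<in> forms"
  obtains z where "z \<in> D.centre" "B' = (\<lambda>v w. z * B v w)"
proof -
  let ?c = "B v1 w1" and ?c' = "B' v1 w1"
  obtain h where h: "?c \<in> Dg h" using form_coefficient(1)[OF B] by blast
  obtain y where y: "?c * y = 1" "y * ?c = 1"
    using D.homogeneous_inverse[OF h form_coefficient(2)[OF B]] by metis
  have "?c' * y * x = x * (?c' * y)" for x
  proof -
    let ?x = "\<psi> (\<phi>0 x)"
    have "y * x = y * (x * ?c) * y" by (simp add: y(1) mult.assoc)
    also have "x * ?c = ?c * ?x" using form_coefficient(3)[OF B, of "\<phi>0 x"] by simp
    also have "y * (?c * ?x) * y = ?x * y" using y(2) by (simp flip: mult.assoc)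
    finally have "?c' * y * x = ?c' * ?x * y" by (simp only: mult.assoc)
    also have "?c' * ?x = x * ?c'" using form_coefficient(3)[OF B', of "\<phi>0 x"] by simp
    finally show ?thesis by (simp only: mult.assoc)
  qed
  then have "?c' * y \<in> D.centre" by (rule D.centreI)
  moreover have "B' = (\<lambda>v w. ?c' * y * B v w)"
  proof (intro ext)
    fix v w
    have "?c' * y * B v w = ?c' * (y * ?c) * B0 v w"
      by (simp add: form_eq_base_form[OF B, of v w] mult.assoc)
    then show "B' v w = ?c' * y * B v w" by (simp add: y form_eq_base_form[OF B', of v w])
  qed
  ultimately show thesis by (rule that)
qed

text \<open>\<open>B v1 w1\<close> is invertible. Attaining all values turns an identity between
  values of the form into one on \<open>D\<close>.\<close>

lemma form_surj:
  assumes B: "B \<in> forms"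
  obtains w where "B v1 w = d"
proof -
  obtain h where h: "B v1 w1 \<in> Dg h" using form_coefficient(1)[OF B] by blast
  obtain y where y: "B v1 w1 * y = 1"
    using D.homogeneous_inverse[OF h form_coefficient(2)[OF B]] by metis
  then have "B v1 (w1 \<cdot> (y * d)) = d" by (simp add: formsD(4)[OF B] flip: mult.assoc)
  then show thesis by (rule that)
qed

text \<open>Interchanging the arguments produces the factor
  \<open>\<epsilon> = \<phi>0 y * B v1 w1 * \<delta>\<close> with \<open>y\<close> inverse to
  \<open>B v1 w1\<close>. Doing it twice gives
  \<open>\<phi>0 \<epsilon> * d * \<epsilon> = d\<close> for all \<open>d\<close>;
  \<open>d = 1\<close> shows that \<open>\<phi>0 \<epsilon>\<close> inverts
  \<open>\<epsilon>\<close>, so conjugation by \<open>\<epsilon>\<close> is trivial.\<close>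

lemma form_symmetry:
  assumes B: "B \<in> forms"
  shows "\<exists>\<epsilon>\<in>D.centre. \<epsilon> \<in> Dg 0 \<and> \<phi>0 \<epsilon> * \<epsilon> = 1 \<and> (\<forall>v w. B w v = \<phi>0 (B v w) * \<epsilon>)"
proof -
  let ?c = "B v1 w1"
  obtain g where g: "?c \<in> Dg g" using form_coefficient(1)[OF B] by blast
  obtain y where y: "?c * y = 1" "y * ?c = 1" "y \<in> Dg (- g)"
    using D.homogeneous_inverse[OF g form_coefficient(2)[OF B]] by metis
  define \<epsilon> where "\<epsilon> = \<phi>0 y * ?c * \<delta>"
  have "\<delta> \<in> Dg 0" using delta D.one_mem D.neg_mem by auto
  then have deg: "\<epsilon> \<in> Dg 0"
    using D.comp_mult[OF D.comp_mult[OF phi0_homogeneous[OF y(3)] g]] by (simp add: \<epsilon>_def)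
  have sym: "B w v = \<phi>0 (B v w) * \<epsilon>" for v w
  proof -
    have "B0 w v = \<psi> (B0 v w) * \<delta>" by (simp add: psi_B0 mult.assoc delta_square)
    then have "B w v = ?c * \<psi> (B0 v w) * \<delta>"
      using form_eq_base_form[OF B, of w v] by (simp add: mult.assoc)
    also have "\<dots> = \<phi>0 (B0 v w) * ?c * \<delta>" by (simp add: form_coefficient(3)[OF B])
    also have "B0 v w = y * B v w"
      using y by (simp add: form_eq_base_form[OF B, of v w] flip: mult.assoc)
    finally show ?thesis by (simp add: phi0_mult \<epsilon>_def mult.assoc)
  qed
  have twice: "\<phi>0 \<epsilon> * d * \<epsilon> = d" for d
  proof -
    obtain w where w: "B v1 w = d" using form_surj[OF B] .
    have "d = \<phi>0 (\<phi>0 d * \<epsilon>) * \<epsilon>" using sym[of v1 w] sym[of w v1] w by metis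
    then show ?thesis by (simp add: phi0_mult)
  qed
  have one: "\<phi>0 \<epsilon> * \<epsilon> = 1" using twice[of 1] by simp
  then have "\<epsilon> \<noteq> 0" by auto
  then obtain x where x: "\<epsilon> * x = 1" "x * \<epsilon> = 1" using D.homogeneous_inverse[OF deg] by metis
  have "\<phi>0 \<epsilon> = \<phi>0 \<epsilon> * (\<epsilon> * x)" by (simp add: x)
  then have \<epsilon>_inv: "\<phi>0 \<epsilon> = x" using one by (simp flip: mult.assoc)
  have "\<epsilon> * d = d * \<epsilon>" for d
  proof -
    have "\<epsilon> * d = \<epsilon> * (x * d * \<epsilon>)" using twice[of d] by (simp add: \<epsilon>_inv)
    also have "\<dots> = \<epsilon> * x * (d * \<epsilon>)" by (simp only: mult.assoc)
    finally show ?thesis by (simp add: x)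
  qed
  then have "\<epsilon> \<in> D.centre" by (rule D.centreI)
  then show ?thesis using deg one sym by blast
qed

text \<open>The action of \<open>z\<close> is a central endomorphism fixed by \<open>\<phi>\<close>,
  and central simplicity with involution says that these are the scalars.\<close>

lemma fixed_centre_scalar:
  assumes z: "z \<in> D.centre" "\<phi>0 z = z"
  obtains c where "z = sD c 1"
proof -
  have "\<phi> (\<lambda>v. v \<cdot> z) = (\<lambda>v. v \<cdot> z)" using phi0_kind z by (simp add: same_kind_def)
  moreover have "(\<lambda>v. v \<cdot> z) \<in> center_on (End_D act) (\<circ>)" using z by (simp add: center_End_D)
  ultimately have "(\<lambda>v. v \<cdot> z) \<in> range (\<lambda>c. End_scale sD act c id)"
    using R_phi unfolding central_simple_with_involution_on_def by blast
  then obtain c where "v1 \<cdot> z = v1 \<cdot> sD c 1"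
    by (auto simp: End_scale_def module_scale_def fun_eq_iff)
  then show thesis using that act_v1_inj by blast
qed

lemma scale_form:
  assumes "B \<in> forms" "c \<noteq> 0"
  shows "(\<lambda>v w. sD c (B v w)) \<in> forms"
proof -
  have "sD c 1 \<noteq> 0" using assms(2) by (simp add: D.scale_eq_0_iff)
  then have "(\<lambda>v w. sD c 1 * B v w) \<in> forms"
    by (intro scaled_form[OF assms(1) D.centre_scl_one D.scl_one_mem])
  then show ?thesis by (simp flip: D.scl_conv_mult)
qed

lemma form_not_zero: "B \<in> forms \<Longrightarrow> B \<noteq> (\<lambda>v w. 0)"
  using form_coefficient(2) by metis

text \<open>Ratios are central by \<open>forms_ratio\<close>. Why a ratio is a scalar differs
  between all adjoint forms and the hermitian ones, so it is left as a premise.\<close>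

lemma unique_up_to_factorI:
  assumes sub: "\<B> \<subseteq> forms"
    and scale: "\<And>B c. B \<in> \<B> \<Longrightarrow> c \<noteq> 0 \<Longrightarrow> (\<lambda>v w. sD c (B v w)) \<in> \<B>"
    and ratio: "\<And>B B' z. B \<in> \<B> \<Longrightarrow> B' \<in> \<B> \<Longrightarrow> z \<in> D.centre \<Longrightarrow> B' = (\<lambda>v w. z * B v w)
      \<Longrightarrow> \<exists>c. z = sD c 1"
  shows "unique_up_to_factor sD \<B>"
  unfolding unique_up_to_factor_def
proof (intro ballI allI iffI)
  fix B B' assume B: "B \<in> \<B>" and B': "B' \<in> \<B>"
  obtain z where z: "z \<in> D.centre" "B' = (\<lambda>v w. z * B v w)"
    using forms_ratio B B' sub by blast
  then obtain c where "z = sD c 1" using ratio B B' by blast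
  then have eq: "B' = (\<lambda>v w. sD c (B v w))" using z(2) by (simp flip: D.scl_conv_mult)
  moreover have "c \<noteq> 0" using form_not_zero[of B'] B' sub eq by auto
  ultimately show "\<exists>c. c \<noteq> 0 \<and> B' = (\<lambda>v w. sD c (B v w))" by blast
qed (use scale in blast)

section \<open>Adjoint forms when the centre is the ground field\<close>

context
  assumes central_simple: "central_simple_on (End_D act) (\<circ>) id (End_scale sD act)"
begin

lemma centre_scalar:
  assumes "z \<in> D.centre"
  obtains c where "z = sD c 1"
proof -
  have "(\<lambda>v. v \<cdot> z) \<in> range (\<lambda>c. End_scale sD act c id)"
    using central_simple assms by (auto simp: central_simple_on_def center_End_D)
  then obtain c where "v1 \<cdot> z = v1 \<cdot> sD c 1"
    by (auto simp: End_scale_def module_scale_def fun_eq_iff)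
  then show thesis using that act_v1_inj by blast
qed

lemma forms_unique_central: "unique_up_to_factor sD forms"
  by (rule unique_up_to_factorI) (auto intro: scale_form elim: centre_scalar)

text \<open>The central factor \<open>\<epsilon>\<close> is now a scalar, on which
  \<open>\<phi>0\<close> acts trivially, so \<open>\<phi>0 \<epsilon> * \<epsilon> = 1\<close>
  becomes \<open>k * k = 1\<close>. The sign is kept in the ground field so that
  \<open>to_ac\<close> can transport it.\<close>

lemma form_sign_central:
  assumes B: "B \<in> forms"
  shows "\<exists>k. (k = 1 \<or> k = - 1) \<and> (\<forall>v w. B w v = sD k (\<phi>0 (B v w)))"
proof -
  obtain \<epsilon> where \<epsilon>: "\<epsilon> \<in> D.centre" "\<phi>0 \<epsilon> * \<epsilon> = 1" "\<And>v w. B w v = \<phi>0 (B v w) * \<epsilon>"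
    using form_symmetry[OF B] by blast
  obtain k where k: "\<epsilon> = sD k 1" using centre_scalar[OF \<epsilon>(1)] .
  have "sD (k * k) 1 = sD 1 1"
    using \<epsilon>(2) by (simp add: k phi0_scl_one flip: D.scl_conv_mult)
  then have "k * k = 1" using D.scale_cancel_right[of "k * k" 1 1] by simp
  then have "k = 1 \<or> k = - 1" by (simp add: square_eq_1_iff)
  moreover have "B w v = sD k (\<phi>0 (B v w))" for v w
    unfolding \<epsilon>(3)[of w v] k by (simp add: D.scl_mult_right)
  ultimately show ?thesis by blast
qed

end

section \<open>Hermitian forms and the action of the involution on the centre\<close>

lemma hermitian_exists:
  assumes k: "k \<in> D.centre" "\<phi>0 k \<noteq> k"
  shows "\<exists>B\<in>forms. hermitian \<phi>0 B"
proof -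
  obtain B where B: "B \<in> forms" using forms_nonempty by blast
  obtain \<epsilon> where \<epsilon>: "\<epsilon> \<in> D.centre" "\<epsilon> \<in> Dg 0" "\<phi>0 \<epsilon> * \<epsilon> = 1" "\<And>v w. B w v = \<phi>0 (B v w) * \<epsilon>"
    using form_symmetry[OF B] by blast
  text \<open>Hilbert 90 for the quadratic extension: \<open>x + \<phi>0 (x \<epsilon>)\<close> is multiplied by \<open>\<epsilon>\<close> under \<open>\<phi>0\<close>.\<close>
  define h where "h x = x + \<phi>0 (x * \<epsilon>)" for x
  have h: "\<phi>0 (h x) = h x * \<epsilon>" if "x \<in> D.centre" for x
  proof -
    have "\<phi>0 (x * \<epsilon>) = \<phi>0 x * \<phi>0 \<epsilon>"
      unfolding phi0_mult by (rule D.centreD[OF phi0_centre[OF that], symmetric])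
    then have "\<phi>0 (x * \<epsilon>) * \<epsilon> = \<phi>0 x * (\<phi>0 \<epsilon> * \<epsilon>)" by (simp only: mult.assoc)
    then show ?thesis by (simp only: h_def phi0_add phi0_phi0 \<epsilon>(3) distrib_right add.commute mult_1_right)
  qed
  have h_centre: "h x \<in> D.centre" if "x \<in> D.centre" for x
    unfolding h_def by (intro D.centre_add that phi0_centre D.centre_mult \<epsilon>(1))
  have one_centre: "1 \<in> D.centre" by (rule D.centreI) simp
  \<comment> \<open>If \<open>h\<close> were 0 on the centre, \<open>x = 1\<close> would give
    \<open>\<epsilon> = - 1\<close>, and then \<open>x = k\<close> would give
    \<open>\<phi>0 k = k\<close>.\<close>
  have "\<exists>x\<in>D.centre. h x \<noteq> 0"
  proof (rule ccontr)
    assume "\<not> ?thesis"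
    then have 0: "h x = 0" if "x \<in> D.centre" for x using that by blast
    have "\<phi>0 \<epsilon> = - 1" using 0[OF one_centre] by (simp add: h_def add_eq_0_iff)
    then have "\<phi>0 (\<phi>0 \<epsilon>) = - 1" by (simp only: phi0_minus phi0_one)
    then have "\<epsilon> = - 1" by simp
    then have "h k = k - \<phi>0 k" by (simp add: h_def phi0_minus)
    then have "k = \<phi>0 k" unfolding 0[OF k(1)] by (rule eq_iff_diff_eq_0[THEN iffD2, OF sym])
    then show False using k(2) by metis
  qed
  then obtain x where x: "x \<in> D.centre" "h x \<noteq> 0" by blast
  then obtain g where g: "D.hcomp (h x) g \<noteq> 0" using D.nonzero_hcomp by blast
  \<comment> \<open>Scaling needs a homogeneous factor. As \<open>\<epsilon>\<close> has degree 0
    and \<open>\<phi>0\<close> preserves degrees, every component of \<open>h x\<close> satisfies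
    the same equation.\<close>
  define a where "a = D.hcomp (h x) g"
  have a: "a \<in> D.centre" "a \<in> Dg g" "a \<noteq> 0"
    using g D.hcomp_centre[OF h_centre[OF x(1)]] D.hcomp_mem by (simp_all add: a_def)
  have phi0_a: "\<phi>0 a = a * \<epsilon>"
    using D.hcomp_mult_right[OF \<epsilon>(2), of "h x" g] by (simp add: a_def h[OF x(1)] flip: phi0_hcomp)
  have "hermitian \<phi>0 (\<lambda>v w. a * B v w)"
    unfolding hermitian_def
  proof (intro allI)
    fix v w
    have "a * B w v = a * \<phi>0 (B v w) * \<epsilon>" by (simp only: \<epsilon>(4)[of w v] mult.assoc)
    also have "a * \<phi>0 (B v w) = \<phi>0 (B v w) * a" by (rule D.centreD[OF a(1)])
    also have "\<dots> * \<epsilon> = \<phi>0 (B v w) * \<phi>0 a" by (simp only: phi0_a mult.assoc)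
    finally show "a * B w v = \<phi>0 (a * B v w)" by (simp add: phi0_mult)
  qed
  then show ?thesis using scaled_form[OF B a] by blast
qed

lemma hermitian_forms_unique: "unique_up_to_factor sD {B \<in> forms. hermitian \<phi>0 B}"
proof (rule unique_up_to_factorI)
  fix B c assume B: "B \<in> {B \<in> forms. hermitian \<phi>0 B}" and c: "c \<noteq> (0::'f)"
  have herm: "B w v = \<phi>0 (B v w)" for v w using B unfolding hermitian_def by blast
  have "hermitian \<phi>0 (\<lambda>v w. sD c (B v w))"
    unfolding hermitian_def phi0_scale herm[symmetric] by blast
  then show "(\<lambda>v w. sD c (B v w)) \<in> {B \<in> forms. hermitian \<phi>0 B}" using scale_form B c by simp
next
  fix B B' z
  assume B: "B \<in> {B \<in> forms. hermitian \<phi>0 B}" and B': "B' \<in> {B \<in> forms. hermitian \<phi>0 B}"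
    and z: "z \<in> D.centre" and B'_eq: "B' = (\<lambda>v w. z * B v w)"
  \<comment> \<open>At a pair where \<open>B\<close> takes the value 1 in both orders, hermitian
    symmetry of \<open>B'\<close> reads \<open>z = \<phi>0 z\<close>.\<close>
  obtain w where w: "B v1 w = 1" using form_surj[of B] B by blast
  have "B w v1 = \<phi>0 (B v1 w)" using B unfolding hermitian_def by blast
  then have w': "B w v1 = 1" by (simp only: w phi0_one)
  have "z * B w v1 = \<phi>0 (z * B v1 w)" using B' unfolding B'_eq hermitian_def by blast
  then have "z = \<phi>0 z" unfolding w w' mult_1_right .
  from this[symmetric] show "\<exists>c. z = sD c 1" using fixed_centre_scalar[OF z] by blast
qed auto

text \<open>Contrapositively, this supplies the moved central element for
  \<open>hermitian_exists\<close>. For an ideal \<open>I\<close> with image \<open>J\<close> under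
  \<open>\<phi>\<close>, both \<open>I \<inter> J\<close> and \<open>I + J\<close> are invariant; if
  \<open>I\<close> is proper and nonzero they are 0 and everything, so \<open>id = x + y\<close>
  with \<open>x\<close> central. As \<open>\<phi>\<close> fixes \<open>x\<close>, it lies in
  \<open>J\<close> too; hence \<open>x = 0\<close> and \<open>I\<close> is everything.\<close>

lemma central_simple_if_fixed_centre:
  assumes fixed: "\<And>z. z \<in> D.centre \<Longrightarrow> \<phi>0 z = z"
  shows "central_simple_on (End_D act) (\<circ>) id (End_scale sD act)"
proof -
  let ?R = "End_D act"
  have fixed': "\<phi> z = z" if "z \<in> center_on ?R (\<circ>)" for z
    using that phi0_kind fixed by (auto simp: center_End_D same_kind_def)
  have ideal_cases: "I = {0} \<or> I = ?R" if "two_sided_ideal_on ?R (\<circ>) I" "\<phi> ` I \<subseteq> I" for I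
    using R_phi that by (auto simp: central_simple_with_involution_on_def)
  have "I = {0} \<or> I = ?R" if I: "two_sided_ideal_on ?R (\<circ>) I" for I
  proof (rule ccontr)
    assume ne: "\<not> (I = {0} \<or> I = ?R)"
    have I_sub: "I \<subseteq> ?R" and I_0: "0 \<in> I" and I_diff: "\<And>x y. x \<in> I \<Longrightarrow> y \<in> I \<Longrightarrow> x - y \<in> I"
      and I_mult: "\<And>a x. a \<in> ?R \<Longrightarrow> x \<in> I \<Longrightarrow> a \<circ> x \<in> I \<and> x \<circ> a \<in> I"
      using I by (auto simp: two_sided_ideal_on_def)
    define J where "J = {r \<in> ?R. \<phi> r \<in> I}"
    have phi_diff: "\<phi> (x - y) = \<phi> x - \<phi> y" if "x \<in> ?R" "y \<in> ?R" for x y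
      using phi_add[of "x - y" y] that diff_End_D[of x y] by simp
    have phi_J: "\<phi> x \<in> J" if "x \<in> I" for x
      using that I_sub by (auto simp: J_def phi_phi phi_mem)
    have J_mult: "a \<circ> x \<in> J \<and> x \<circ> a \<in> J" if "a \<in> ?R" "x \<in> J" for a x
      using that I_mult by (auto simp: J_def phi_comp phi_mem comp_End_D)
    have J: "0 \<in> J" "\<And>x y. x \<in> J \<Longrightarrow> y \<in> J \<Longrightarrow> x - y \<in> J" "J \<subseteq> ?R"
      using I_0 I_diff by (auto simp: J_def zero_End_D phi_0 diff_End_D phi_diff)
    have "two_sided_ideal_on ?R (\<circ>) (I \<inter> J)"
      using I_sub I_0 I_diff I_mult J J_mult by (auto simp: two_sided_ideal_on_def)
    moreover have "\<phi> ` (I \<inter> J) \<subseteq> I \<inter> J" using phi_J by (auto simp: J_def)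
    ultimately have IJ: "I \<inter> J = {0}" using ideal_cases[of "I \<inter> J"] I_sub ne by blast
    define K where "K = {x + y | x y. x \<in> I \<and> y \<in> J}"
    have "two_sided_ideal_on ?R (\<circ>) K"
      unfolding two_sided_ideal_on_def
    proof (intro conjI ballI)
      show "K \<subseteq> ?R" using I_sub J(3) by (auto simp: K_def intro!: plus_End_D)
      show "0 \<in> K" using I_0 J(1) by (auto simp: K_def intro!: exI[of _ 0])
      show "s - t \<in> K" if "s \<in> K" "t \<in> K" for s t
      proof -
        obtain x y x' y' where "s = x + y" "t = x' + y'" "x \<in> I" "y \<in> J" "x' \<in> I" "y' \<in> J"
          using \<open>s \<in> K\<close> \<open>t \<in> K\<close> by (auto simp: K_def)
        moreover have "x + y - (x' + y') = (x - x') + (y - y')" by simp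
        ultimately show ?thesis using I_diff J(2) unfolding K_def by blast
      qed
      show "a \<circ> s \<in> K" "s \<circ> a \<in> K" if "a \<in> ?R" "s \<in> K" for a s
      proof -
        obtain x y where xy: "s = x + y" "x \<in> I" "y \<in> J" using \<open>s \<in> K\<close> by (auto simp: K_def)
        have "a \<circ> s = (a \<circ> x) + (a \<circ> y)" "s \<circ> a = (x \<circ> a) + (y \<circ> a)"
          using End_D_add[OF \<open>a \<in> ?R\<close>] xy(1) by auto
        then show "a \<circ> s \<in> K" "s \<circ> a \<in> K"
          using I_mult[OF \<open>a \<in> ?R\<close> xy(2)] J_mult[OF \<open>a \<in> ?R\<close> xy(3)] unfolding K_def by blast+
      qed
    qed
    moreover have "\<phi> ` K \<subseteq> K"
    proof
      fix t assume "t \<in> \<phi> ` K"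
      then obtain x y where xy: "t = \<phi> (x + y)" "x \<in> I" "y \<in> J" by (auto simp: K_def)
      then have "t = \<phi> y + \<phi> x" using I_sub J(3) by (simp add: phi_add subset_iff add.commute)
      then show "t \<in> K" using phi_J[OF xy(2)] xy(3) unfolding K_def J_def by blast
    qed
    moreover have "K \<noteq> {0}"
    proof -
      obtain x where "x \<in> I" "x \<noteq> 0" using ne I_0 by blast
      moreover have "x + 0 \<in> K" using \<open>x \<in> I\<close> J(1) unfolding K_def by blast
      ultimately show ?thesis by auto
    qed
    ultimately have "K = ?R" using ideal_cases by blast
    then obtain x y where xy: "id = x + y" "x \<in> I" "y \<in> J" using id_End_D unfolding K_def by blast
    have x_R: "x \<in> ?R" using xy(2) I_sub by blast
    have "x \<circ> r = r \<circ> x" if r: "r \<in> ?R" for r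
    proof -
      \<comment> \<open>By \<open>id = x + y\<close>, the commutator of \<open>x\<close> with
        \<open>r\<close> equals that of \<open>r\<close> with \<open>y\<close>; so it lies in
        \<open>I \<inter> J\<close>.\<close>
      have "x (r v) - r (x v) = r (y v) - y (r v)" for v
      proof -
        have "x (r v) + y (r v) = r v" "x v + y v = v"
          using fun_cong[OF xy(1), of "r v"] fun_cong[OF xy(1), of v] by simp_all
        then have "x (r v) + y (r v) = r (x v) + r (y v)" by (simp flip: End_D_add[OF r])
        then show ?thesis by (simp add: diff_eq_eq add_diff_eq eq_diff_eq add.commute)
      qed
      then have "(x \<circ> r) - (r \<circ> x) = (r \<circ> y) - (y \<circ> r)" by (simp add: fun_eq_iff)
      moreover have "(r \<circ> y) - (y \<circ> r) \<in> J" using J_mult[OF r xy(3)] J(2) by blast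
      moreover have "(x \<circ> r) - (r \<circ> x) \<in> I" using I_mult[OF r xy(2)] I_diff by blast
      ultimately have "(x \<circ> r) - (r \<circ> x) \<in> I \<inter> J" by simp
      then show ?thesis by (simp add: IJ)
    qed
    then have "x \<in> center_on ?R (\<circ>)" using x_R by (simp add: center_on_def)
    then have "x \<in> J" using fixed' phi_J[OF xy(2)] by simp
    then have "x = 0" using xy(2) IJ by blast
    then have "id \<in> J" using xy by simp
    then have "id \<in> I" by (simp add: J_def phi_id)
    then have "?R \<subseteq> I" using I_mult[OF _ \<open>id \<in> I\<close>] by auto
    then show False using ne I_sub by blast
  qed
  moreover have "{z \<in> center_on ?R (\<circ>). \<phi> z = z} = center_on ?R (\<circ>)" using fixed' by blast
  ultimately show ?thesis
    using R_phi by (simp add: central_simple_with_involution_on_def central_simple_on_def)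
qed

end

section \<open>Comparison of types after splitting\<close>

lemma mult_mat_entry:
  "A \<in> carrier_mat n m \<Longrightarrow> B \<in> carrier_mat m p \<Longrightarrow> i < n \<Longrightarrow> j < p
    \<Longrightarrow> (A * B) $$ (i, j) = (\<Sum>k<m. A $$ (i, k) * B $$ (k, j))"
  by (auto simp: scalar_prod_def atLeast0LessThan intro!: sum.cong)

lemma bilinear_of_mat_unit:
  "M \<in> carrier_mat n n \<Longrightarrow> i < n \<Longrightarrow> j < n \<Longrightarrow> bilinear_of_mat M (unit_vec n i) (unit_vec n j) = M $$ (i, j)"
  by (simp add: bilinear_of_mat_def scalar_prod_left_unit[of _ n] mult_mat_vec_carrier[of _ n n])

lemma bilinear_of_mat_mult_right:
  "M \<in> carrier_mat n n \<Longrightarrow> N \<in> carrier_mat n n \<Longrightarrow> y \<in> carrier_vec n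
    \<Longrightarrow> bilinear_of_mat M x (N *\<^sub>v y) = bilinear_of_mat (M * N) x y"
  by (simp add: bilinear_of_mat_def)

lemma bilinear_of_mat_mult_left:
  fixes M N :: "'l::comm_ring_1 mat"
  assumes M: "M \<in> carrier_mat n n" and N: "N \<in> carrier_mat n n" and x: "x \<in> carrier_vec n" and y: "y \<in> carrier_vec n"
  shows "bilinear_of_mat M (N *\<^sub>v x) y = bilinear_of_mat (transpose_mat N * M) x y"
proof -
  have My: "M *\<^sub>v y \<in> carrier_vec n" using M y by simp
  have "(N *\<^sub>v x) \<bullet> (M *\<^sub>v y) = (M *\<^sub>v y) \<bullet> (N *\<^sub>v x)"
    using N x My by (intro comm_scalar_prod[of _ n]) auto
  also have "\<dots> = (transpose_mat N *\<^sub>v (M *\<^sub>v y)) \<bullet> x"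
    using transpose_vec_mult_scalar[OF N x My] by simp
  also have "\<dots> = x \<bullet> (transpose_mat N *\<^sub>v (M *\<^sub>v y))"
    using N x My by (intro comm_scalar_prod[of _ n]) auto
  also have "transpose_mat N *\<^sub>v (M *\<^sub>v y) = transpose_mat N * M *\<^sub>v y"
    using assoc_mult_mat_vec[of "transpose_mat N" n n M n y] M N y by simp
  finally show ?thesis by (simp add: bilinear_of_mat_def)
qed

lemma eq_mat_of_bilinear:
  assumes M: "M \<in> carrier_mat n n" and N: "N \<in> carrier_mat n n"
    and eq: "\<And>x y. x \<in> carrier_vec n \<Longrightarrow> y \<in> carrier_vec n \<Longrightarrow> bilinear_of_mat M x y = bilinear_of_mat N x y"
  shows "M = N"
proof (rule eq_matI)
  fix i j assume "i < dim_row N" "j < dim_col N"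
  then have ij: "i < n" "j < n" using N by auto
  show "M $$ (i, j) = N $$ (i, j)"
    using eq[of "unit_vec n i" "unit_vec n j"] bilinear_of_mat_unit[OF M ij] bilinear_of_mat_unit[OF N ij]
    by simp
qed (use M N in auto)

lemma invertible_matE:
  assumes "M \<in> carrier_mat n n" "invertible_mat M"
  obtains N where "N \<in> carrier_mat n n" "M * N = 1\<^sub>m n" "N * M = 1\<^sub>m n"
proof -
  obtain N where N: "M * N = 1\<^sub>m (dim_row M)" "N * M = 1\<^sub>m (dim_row N)"
    using assms(2) by (auto simp: invertible_mat_def inverts_mat_def)
  have "dim_col (M * N) = dim_col N" "dim_col (N * M) = dim_col M" by simp_all
  then have "N \<in> carrier_mat n n"
    using assms(1) unfolding N by auto
  then show thesis using that N assms(1) by auto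
qed

lemma sum_matrix_unit_right:
  fixes Y :: "nat \<Rightarrow> nat \<Rightarrow> 'l::semiring_1"
  assumes "i < n" "j < n"
  shows "(\<Sum>p<n. \<Sum>q<n. Y p q * (if i = p then if j = q then 1 else 0 else 0)) = Y i j"
proof -
  have "(\<Sum>q<n. Y p q * (if i = p then if j = q then 1 else 0 else 0)) = (if i = p then Y p j else 0)" for p
  proof (cases "i = p")
    case True
    have "(\<Sum>q<n. Y p q * (if j = q then 1 else 0)) = (\<Sum>q<n. if j = q then Y p q else 0)"
      by (intro sum.cong) auto
    then show ?thesis using True assms by simp
  qed simp
  then show ?thesis using assms by simp
qed

lemma sum_matrix_unit_left:
  fixes Y :: "nat \<Rightarrow> nat \<Rightarrow> 'l::semiring_1"
  assumes "p < n" "q < n"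
  shows "(\<Sum>i<n. \<Sum>j<n. (if i = p then if j = q then 1 else 0 else 0) * Y i j) = Y p q"
proof -
  have "(\<Sum>j<n. (if i = p then if j = q then 1 else 0 else 0) * Y i j) = (if i = p then Y i q else 0)" for i
  proof (cases "i = p")
    case True
    have "(\<Sum>j<n. (if j = q then 1 else 0) * Y i j) = (\<Sum>j<n. if j = q then Y i j else 0)"
      by (intro sum.cong) auto
    then show ?thesis using True assms by simp
  qed simp
  then show ?thesis using assms by simp
qed

text \<open>The carrier is a set, because the same facts serve the set of endomorphisms and the
  whole type of \<open>D\<close>.\<close>

locale splitting =
  fixes A :: "'a::ab_group_add set" and mul :: "'a \<Rightarrow> 'a \<Rightarrow> 'a" and e :: 'a
    and scl :: "'f::field \<Rightarrow> 'a \<Rightarrow> 'a" and n :: nat and \<rho> :: "'a \<Rightarrow> 'f alg_closure mat"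
  assumes split: "splitting_on A mul e scl n \<rho>"
    and zero_closed: "0 \<in> A" and add_closed: "x \<in> A \<Longrightarrow> y \<in> A \<Longrightarrow> x + y \<in> A"
    and scl_closed: "x \<in> A \<Longrightarrow> scl c x \<in> A"
    and mul_closed: "x \<in> A \<Longrightarrow> y \<in> A \<Longrightarrow> mul x y \<in> A"
begin

lemma rho_carrier: "x \<in> A \<Longrightarrow> \<rho> x \<in> carrier_mat n n"
  and rho_add: "x \<in> A \<Longrightarrow> y \<in> A \<Longrightarrow> \<rho> (x + y) = \<rho> x + \<rho> y"
  and rho_scl: "x \<in> A \<Longrightarrow> \<rho> (scl c x) = to_ac c \<cdot>\<^sub>m \<rho> x"
  and rho_mul: "x \<in> A \<Longrightarrow> y \<in> A \<Longrightarrow> \<rho> (mul x y) = \<rho> x * \<rho> y"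
  and rho_one: "\<rho> e = 1\<^sub>m n"
  using split by (simp_all add: splitting_on_def)

lemma rho_add_entry: "x \<in> A \<Longrightarrow> y \<in> A \<Longrightarrow> i < n \<Longrightarrow> j < n \<Longrightarrow> \<rho> (x + y) $$ (i, j) = \<rho> x $$ (i, j) + \<rho> y $$ (i, j)"
  using rho_carrier[of x] rho_carrier[of y] by (simp add: rho_add)

lemma rho_scl_entry: "x \<in> A \<Longrightarrow> i < n \<Longrightarrow> j < n \<Longrightarrow> \<rho> (scl c x) $$ (i, j) = to_ac c * \<rho> x $$ (i, j)"
  using rho_carrier[of x] by (simp add: rho_scl)

text \<open>These are the linear functionals on the scalar extension of \<open>A\<close> to the
  algebraic closure, described by their restrictions to \<open>A\<close>.\<close>

definition functional :: "('a \<Rightarrow> 'f alg_closure) \<Rightarrow> bool" where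
  "functional g \<longleftrightarrow> (\<forall>x\<in>A. \<forall>y\<in>A. g (x + y) = g x + g y) \<and> (\<forall>c. \<forall>x\<in>A. g (scl c x) = to_ac c * g x)"

lemma functional_entry: "i < n \<Longrightarrow> j < n \<Longrightarrow> functional (\<lambda>x. \<rho> x $$ (i, j))"
  by (simp add: functional_def rho_add_entry rho_scl_entry)

lemma functional_sum:
  assumes g: "functional g" and E: "E \<subseteq> A"
  shows "(\<Sum>b\<in>E. scl (c b) b) \<in> A \<and> g (\<Sum>b\<in>E. scl (c b) b) = (\<Sum>b\<in>E. to_ac (c b) * g b)"
proof -
  have g_add: "g (x + y) = g x + g y" if "x \<in> A" "y \<in> A" for x y
    using g that by (simp add: functional_def)
  have "g 0 + g 0 = g 0 + 0" using g_add[OF zero_closed zero_closed] by (simp only: add_0_right)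
  then have "g 0 = 0" by (rule add_left_imp_eq)
  then show ?thesis
    using E
  proof (induction E rule: infinite_finite_induct)
    case (insert b E)
    then have "scl (c b) b \<in> A" "g (scl (c b) b) = to_ac (c b) * g b"
      using scl_closed g by (auto simp: functional_def)
    then show ?case using insert by (simp add: add_closed g_add)
  qed (simp_all add: zero_closed)
qed

text \<open>Matrices are replaced by functions of two indices, of which only the entries below
  \<open>n\<close> count, so that coefficients can be compared without building matrices.\<close>

definition split_basis :: "'a set \<Rightarrow> bool" where
  "split_basis E \<longleftrightarrow> E \<subseteq> A \<and> finite E \<and> (\<forall>x\<in>A. \<exists>c. x = (\<Sum>b\<in>E. scl (c b) b)) \<and>
     (\<forall>M. \<exists>c. \<forall>i<n. \<forall>j<n. M i j = (\<Sum>b\<in>E. c b * \<rho> b $$ (i, j))) \<and>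
     (\<forall>c. (\<forall>i<n. \<forall>j<n. (\<Sum>b\<in>E. c b * \<rho> b $$ (i, j)) = 0) \<longrightarrow> (\<forall>b\<in>E. c b = 0))"

lemma split_basisD:
  assumes "split_basis E"
  shows "E \<subseteq> A" "finite E" "x \<in> A \<Longrightarrow> \<exists>c. x = (\<Sum>b\<in>E. scl (c b) b)"
    "\<exists>c. \<forall>i<n. \<forall>j<n. M i j = (\<Sum>b\<in>E. c b * \<rho> b $$ (i, j))"
    "(\<And>i j. i < n \<Longrightarrow> j < n \<Longrightarrow> (\<Sum>b\<in>E. c b * \<rho> b $$ (i, j)) = 0) \<Longrightarrow> \<forall>b\<in>E. c b = 0"
proof -
  note E = assms[unfolded split_basis_def]
  show "E \<subseteq> A" "finite E" using E by blast+
  show "x \<in> A \<Longrightarrow> \<exists>c. x = (\<Sum>b\<in>E. scl (c b) b)" using E by simp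
  show "\<exists>c. \<forall>i<n. \<forall>j<n. M i j = (\<Sum>b\<in>E. c b * \<rho> b $$ (i, j))"
    using E[THEN conjunct2, THEN conjunct2, THEN conjunct2, THEN conjunct1] by (rule spec)
  show "\<forall>b\<in>E. c b = 0"
    if "\<And>i j. i < n \<Longrightarrow> j < n \<Longrightarrow> (\<Sum>b\<in>E. c b * \<rho> b $$ (i, j)) = 0"
    using E[THEN conjunct2, THEN conjunct2, THEN conjunct2, THEN conjunct2] that by simp
qed

lemma ex_split_basis: "\<exists>E. split_basis E"
proof -
  obtain E where E: "finite_basis_on A scl E"
    and span: "\<forall>M\<in>carrier_mat n n. \<exists>c. \<forall>i<n. \<forall>j<n. M $$ (i, j) = (\<Sum>b\<in>E. c b * \<rho> b $$ (i, j))"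
    and indep: "\<forall>c. (\<forall>i<n. \<forall>j<n. (\<Sum>b\<in>E. c b * \<rho> b $$ (i, j)) = 0) \<longrightarrow> (\<forall>b\<in>E. c b = 0)"
    using split unfolding splitting_on_def by (elim conjE exE) (rule that)
  have "split_basis E"
    unfolding split_basis_def
  proof (intro conjI)
    show "\<forall>M. \<exists>c. \<forall>i<n. \<forall>j<n. M i j = (\<Sum>b\<in>E. c b * \<rho> b $$ (i, j))"
    proof
      fix M :: "nat \<Rightarrow> nat \<Rightarrow> 'f alg_closure"
      have "mat n n (\<lambda>(i, j). M i j) \<in> carrier_mat n n" by simp
      from span[rule_format, OF this] show "\<exists>c. \<forall>i<n. \<forall>j<n. M i j = (\<Sum>b\<in>E. c b * \<rho> b $$ (i, j))"
        by simp
    qed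
    show "\<forall>c. (\<forall>i<n. \<forall>j<n. (\<Sum>b\<in>E. c b * \<rho> b $$ (i, j)) = 0) \<longrightarrow> (\<forall>b\<in>E. c b = 0)"
      by (rule indep)
    note E' = E[unfolded finite_basis_on_def]
    show "finite E" by (rule E'[THEN conjunct1])
    show "E \<subseteq> A" by (rule E'[THEN conjunct2, THEN conjunct1])
    show "\<forall>x\<in>A. \<exists>c. x = (\<Sum>b\<in>E. scl (c b) b)"
      by (rule E'[THEN conjunct2, THEN conjunct2, THEN conjunct1])
  qed
  then show ?thesis ..
qed

text \<open>The images \<open>\<rho> a\<close> span all matrices over the algebraic closure, so a
  linear form in the entries that vanishes on them vanishes on the matrix unit at
  \<open>(p, q)\<close>, where its value is \<open>Y p q\<close>.\<close>

lemma coefficients_zero: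
  assumes "\<And>a. a \<in> A \<Longrightarrow> (\<Sum>i<n. \<Sum>j<n. \<rho> a $$ (i, j) * Y i j) = 0" and p: "p < n" and q: "q < n"
  shows "Y p q = 0"
proof -
  obtain E where "split_basis E" using ex_split_basis by blast
  note E = split_basisD[OF this]
  obtain c where c: "\<forall>i<n. \<forall>j<n. (if i = p then if j = q then 1 else 0 else 0) = (\<Sum>b\<in>E. c b * \<rho> b $$ (i, j))"
    using E(4)[of "\<lambda>i j. if i = p then if j = q then 1 else 0 else 0"] by blast
  have "Y p q = (\<Sum>i<n. \<Sum>j<n. (if i = p then if j = q then 1 else 0 else 0) * Y i j)"
    by (rule sum_matrix_unit_left[OF p q, symmetric])
  also have "\<dots> = (\<Sum>i<n. \<Sum>j<n. (\<Sum>b\<in>E. c b * \<rho> b $$ (i, j)) * Y i j)"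
    by (intro sum.cong refl) (simp only: c[rule_format] lessThan_iff)
  also have "\<dots> = (\<Sum>i<n. \<Sum>j<n. \<Sum>b\<in>E. c b * (\<rho> b $$ (i, j) * Y i j))"
    by (simp add: sum_distrib_right mult.assoc)
  also have "\<dots> = (\<Sum>i<n. \<Sum>b\<in>E. \<Sum>j<n. c b * (\<rho> b $$ (i, j) * Y i j))"
    by (intro sum.cong refl sum.swap)
  also have "\<dots> = (\<Sum>b\<in>E. \<Sum>i<n. \<Sum>j<n. c b * (\<rho> b $$ (i, j) * Y i j))"
    by (rule sum.swap)
  also have "\<dots> = (\<Sum>b\<in>E. c b * (\<Sum>i<n. \<Sum>j<n. \<rho> b $$ (i, j) * Y i j))"
    by (simp add: sum_distrib_left)
  also have "\<dots> = 0" using assms(1) E(1) by (intro sum.neutral) auto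
  finally show ?thesis .
qed

text \<open>Extended to the matrix algebra, \<open>g\<close> is determined by its values on matrix
  units. \<open>P p q\<close> is such a value, computed by expanding the unit in the images of a
  basis of \<open>A\<close>.\<close>

lemma functional_coefficients:
  assumes g: "functional g"
  obtains P where "\<And>a. a \<in> A \<Longrightarrow> g a = (\<Sum>i<n. \<Sum>j<n. \<rho> a $$ (i, j) * P i j)"
proof -
  obtain E where "split_basis E" using ex_split_basis by blast
  note E = split_basisD[OF this]
  define C where "C p q = (SOME c. \<forall>i<n. \<forall>j<n.
      (if i = p then if j = q then 1 else 0 else 0) = (\<Sum>b\<in>E. c b * \<rho> b $$ (i, j)))" for p q
  have C: "(if i = p then if j = q then 1 else 0 else 0) = (\<Sum>b\<in>E. C p q b * \<rho> b $$ (i, j))"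
    if "i < n" "j < n" for p q i j
    using someI_ex[OF E(4)[of "\<lambda>i j. if i = p then if j = q then 1 else 0 else 0"]] that
    unfolding C_def[symmetric] by blast
  define P where "P p q = (\<Sum>b\<in>E. C p q b * g b)" for p q
  define h where "h a = (\<Sum>i<n. \<Sum>j<n. \<rho> a $$ (i, j) * P i j)" for a
  have h: "functional h"
    unfolding functional_def
  proof (intro conjI ballI allI)
    fix x y assume "x \<in> A" "y \<in> A"
    then have "h (x + y) = (\<Sum>i<n. \<Sum>j<n. \<rho> x $$ (i, j) * P i j + \<rho> y $$ (i, j) * P i j)"
      unfolding h_def by (intro sum.cong refl) (simp add: rho_add_entry distrib_right)
    then show "h (x + y) = h x + h y" by (simp add: h_def sum.distrib)
  next
    fix c x assume "x \<in> A"
    then have "h (scl c x) = (\<Sum>i<n. \<Sum>j<n. to_ac c * (\<rho> x $$ (i, j) * P i j))"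
      unfolding h_def by (intro sum.cong refl) (simp add: rho_scl_entry)
    then show "h (scl c x) = to_ac c * h x" by (simp add: h_def sum_distrib_left)
  qed
  have "h a = g a" if a: "a \<in> E" for a
  proof -
    \<comment> \<open>Expanding \<open>\<rho> a\<close> in matrix units, and these in the images of
      the basis, must return \<open>a\<close> itself; by independence \<open>\<kappa>\<close> is the
      indicator of \<open>a\<close>.\<close>
    define \<kappa> where "\<kappa> b = (\<Sum>p<n. \<Sum>q<n. \<rho> a $$ (p, q) * C p q b)" for b
    have "\<forall>b\<in>E. \<kappa> b - (if b = a then 1 else 0) = 0"
    proof (rule E(5))
      fix i j assume ij: "i < n" "j < n"
      have "(\<Sum>b\<in>E. \<kappa> b * \<rho> b $$ (i, j)) = (\<Sum>b\<in>E. \<Sum>p<n. \<Sum>q<n. \<rho> a $$ (p, q) * (C p q b * \<rho> b $$ (i, j)))"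
        by (simp add: \<kappa>_def sum_distrib_right mult.assoc)
      also have "\<dots> = (\<Sum>p<n. \<Sum>b\<in>E. \<Sum>q<n. \<rho> a $$ (p, q) * (C p q b * \<rho> b $$ (i, j)))"
        by (rule sum.swap)
      also have "\<dots> = (\<Sum>p<n. \<Sum>q<n. \<Sum>b\<in>E. \<rho> a $$ (p, q) * (C p q b * \<rho> b $$ (i, j)))"
        by (intro sum.cong refl sum.swap)
      also have "\<dots> = (\<Sum>p<n. \<Sum>q<n. \<rho> a $$ (p, q) * (if i = p then if j = q then 1 else 0 else 0))"
        by (simp only: C[OF ij] sum_distrib_left)
      also have "\<dots> = \<rho> a $$ (i, j)"
        by (rule sum_matrix_unit_right[OF ij])
      also have "\<rho> a $$ (i, j) = (\<Sum>b\<in>E. (if b = a then 1 else 0) * \<rho> b $$ (i, j))"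
        using a E(2) by (simp add: sum.remove[of E a])
      finally show "(\<Sum>b\<in>E. (\<kappa> b - (if b = a then 1 else 0)) * \<rho> b $$ (i, j)) = 0"
        by (simp add: left_diff_distrib sum_subtractf)
    qed
    then have \<kappa>: "\<kappa> b = (if b = a then 1 else 0)" if "b \<in> E" for b using that by simp
    have "h a = (\<Sum>p<n. \<Sum>q<n. \<Sum>b\<in>E. \<rho> a $$ (p, q) * (C p q b * g b))"
      by (simp add: h_def P_def sum_distrib_left)
    also have "\<dots> = (\<Sum>p<n. \<Sum>b\<in>E. \<Sum>q<n. \<rho> a $$ (p, q) * (C p q b * g b))"
      by (intro sum.cong refl sum.swap)
    also have "\<dots> = (\<Sum>b\<in>E. \<Sum>p<n. \<Sum>q<n. \<rho> a $$ (p, q) * (C p q b * g b))"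
      by (rule sum.swap)
    also have "\<dots> = (\<Sum>b\<in>E. \<kappa> b * g b)"
      by (simp add: \<kappa>_def sum_distrib_right mult.assoc)
    also have "\<dots> = (\<Sum>b\<in>E. if b = a then g b else 0)"
      by (intro sum.cong) (auto simp: \<kappa>)
    also have "\<dots> = g a" using a E(2) by simp
    finally show ?thesis .
  qed
  then have hg: "(\<Sum>b\<in>E. k b * h b) = (\<Sum>b\<in>E. k b * g b)" for k by simp
  have "g a = h a" if a: "a \<in> A" for a
  proof -
    obtain c where c: "a = (\<Sum>b\<in>E. scl (c b) b)" using E(3)[OF a] by blast
    show ?thesis
      unfolding c functional_sum[OF g E(1), THEN conjunct2] functional_sum[OF h E(1), THEN conjunct2] hg ..
  qed
  then show thesis using that unfolding h_def by blast
qed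

text \<open>This is injectivity of \<open>\<rho>\<close>. The conclusion is a combination with zero
  coefficients because \<open>scl 0 b = 0\<close> is available only later, in
  \<open>splitting_pair\<close>.\<close>

lemma rho_zero:
  assumes a: "a \<in> A" and 0: "\<And>i j. i < n \<Longrightarrow> j < n \<Longrightarrow> \<rho> a $$ (i, j) = 0"
  shows "\<exists>E. a = (\<Sum>b\<in>E. scl 0 b)"
proof -
  obtain E where "split_basis E" using ex_split_basis by blast
  note E = split_basisD[OF this]
  obtain c where c: "a = (\<Sum>b\<in>E. scl (c b) b)" using E(3)[OF a] by blast
  have "\<forall>b\<in>E. to_ac (c b) = 0"
  proof (rule E(5))
    fix i j assume ij: "i < n" "j < n"
    show "(\<Sum>b\<in>E. to_ac (c b) * \<rho> b $$ (i, j)) = 0"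
      using 0[OF ij] functional_sum[OF functional_entry[OF ij] E(1), of c] by (simp flip: c)
  qed
  then have "a = (\<Sum>b\<in>E. scl 0 b)" unfolding c by (intro sum.cong) auto
  then show ?thesis ..
qed

end

text \<open>As the images \<open>\<rho> a\<close> span, every entry of \<open>Z\<close> times every
  entry of \<open>J\<close> is 0: the matrix algebra is prime, here with rectangular
  factors.\<close>

lemma (in splitting) two_sided_annihilator:
  assumes Z: "Z \<in> carrier_mat m n" and J: "J \<in> carrier_mat n k" and J0: "J \<noteq> 0\<^sub>m n k"
    and eq: "\<And>a. a \<in> A \<Longrightarrow> Z * (\<rho> a * J) = 0\<^sub>m m k"
  shows "Z = 0\<^sub>m m n"
proof -
  obtain q r where qr: "q < n" "r < k" "J $$ (q, r) \<noteq> 0"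
  proof -
    have "\<exists>q<n. \<exists>r<k. J $$ (q, r) \<noteq> 0"
    proof (rule ccontr)
      assume "\<not> ?thesis"
      then have "J = 0\<^sub>m n k" using J by (intro eq_matI) auto
      then show False using J0 by simp
    qed
    then show thesis using that by blast
  qed
  have "Z $$ (p, q') * J $$ (q, r) = 0" if p: "p < m" and q': "q' < n" for p q'
  proof (rule coefficients_zero[of "\<lambda>i j. Z $$ (p, i) * J $$ (j, r)", OF _ q' qr(1)])
    fix a assume a: "a \<in> A"
    note \<rho>a = rho_carrier[OF a]
    have "0 = (Z * (\<rho> a * J)) $$ (p, r)" using eq[OF a] p qr(2) by simp
    also have "\<dots> = (\<Sum>i<n. Z $$ (p, i) * (\<rho> a * J) $$ (i, r))"
      by (rule mult_mat_entry[OF Z mult_carrier_mat[OF \<rho>a J] p qr(2)])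
    also have "\<dots> = (\<Sum>i<n. Z $$ (p, i) * (\<Sum>j<n. \<rho> a $$ (i, j) * J $$ (j, r)))"
      by (intro sum.cong refl) (simp only: mult_mat_entry[OF \<rho>a J _ qr(2)] lessThan_iff)
    also have "\<dots> = (\<Sum>i<n. \<Sum>j<n. \<rho> a $$ (i, j) * (Z $$ (p, i) * J $$ (j, r)))"
      by (simp add: sum_distrib_left algebra_simps)
    finally show "(\<Sum>i<n. \<Sum>j<n. \<rho> a $$ (i, j) * (Z $$ (p, i) * J $$ (j, r))) = 0" by simp
  qed
  then show ?thesis using qr(3) Z by (intro eq_matI) auto
qed

text \<open>Each entry of the commutation equation is a linear relation between the entries of
  \<open>\<rho> a\<close>, whose coefficients must vanish. Positivity of \<open>n\<close> lets the
  entry at \<open>(0, 0)\<close> serve as the scalar.\<close>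

lemma (in splitting) commuting_mat_scalar:
  assumes H: "H \<in> carrier_mat n n" and n: "0 < n" and comm: "\<And>a. a \<in> A \<Longrightarrow> H * \<rho> a = \<rho> a * H"
  obtains c where "H = c \<cdot>\<^sub>m 1\<^sub>m n"
proof -
  have key: "(if j = q then H $$ (p, i) else 0) - (if i = p then H $$ (j, q) else 0) = 0"
    if p: "p < n" and q: "q < n" and i: "i < n" and j: "j < n" for p q i j
  proof (rule coefficients_zero[of "\<lambda>i j. (if j = q then H $$ (p, i) else 0) - (if i = p then H $$ (j, q) else 0)", OF _ i j])
    fix a assume a: "a \<in> A"
    note \<rho>a = rho_carrier[OF a]
    have "(\<Sum>i<n. \<Sum>j<n. \<rho> a $$ (i, j) * ((if j = q then H $$ (p, i) else 0) - (if i = p then H $$ (j, q) else 0)))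
        = (\<Sum>i<n. \<Sum>j<n. if j = q then \<rho> a $$ (i, j) * H $$ (p, i) else 0)
          - (\<Sum>i<n. \<Sum>j<n. if i = p then \<rho> a $$ (i, j) * H $$ (j, q) else 0)"
      unfolding sum_subtractf[symmetric] by (intro sum.cong refl) (simp add: right_diff_distrib)
    also have "(\<Sum>i<n. \<Sum>j<n. if j = q then \<rho> a $$ (i, j) * H $$ (p, i) else 0) = (H * \<rho> a) $$ (p, q)"
      unfolding mult_mat_entry[OF H \<rho>a p q] using q by (intro sum.cong refl) (simp add: mult.commute)
    also have "(\<Sum>i<n. \<Sum>j<n. if i = p then \<rho> a $$ (i, j) * H $$ (j, q) else 0)
        = (\<Sum>i<n. if i = p then \<Sum>j<n. \<rho> a $$ (i, j) * H $$ (j, q) else 0)"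
      by (intro sum.cong refl) simp
    also have "\<dots> = (\<rho> a * H) $$ (p, q)"
      unfolding mult_mat_entry[OF \<rho>a H p q] using p by simp
    finally show "(\<Sum>i<n. \<Sum>j<n. \<rho> a $$ (i, j) * ((if j = q then H $$ (p, i) else 0) - (if i = p then H $$ (j, q) else 0))) = 0"
      by (simp add: comm[OF a])
  qed
  have "H = H $$ (0, 0) \<cdot>\<^sub>m 1\<^sub>m n"
  proof (rule eq_matI)
    fix i j assume "i < dim_row (H $$ (0, 0) \<cdot>\<^sub>m 1\<^sub>m n)" "j < dim_col (H $$ (0, 0) \<cdot>\<^sub>m 1\<^sub>m n)"
    then have ij: "i < n" "j < n" by simp_all
    show "H $$ (i, j) = (H $$ (0, 0) \<cdot>\<^sub>m 1\<^sub>m n) $$ (i, j)"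
      using key[OF ij(1) n ij(2) n] key[OF n n ij(1) ij(1)] ij by (auto split: if_splits)
  qed (use H in auto)
  then show thesis by (rule that)
qed

lemma adjoint_mat_eq:
  fixes \<Phi> :: "'l::comm_ring_1 mat"
  assumes \<Phi>: "\<Phi> \<in> carrier_mat n n" and M: "M \<in> carrier_mat n n" and N: "N \<in> carrier_mat n n"
    and adj: "\<And>x y. x \<in> carrier_vec n \<Longrightarrow> y \<in> carrier_vec n \<Longrightarrow>
      bilinear_of_mat \<Phi> (M *\<^sub>v x) y = bilinear_of_mat \<Phi> x (N *\<^sub>v y)"
  shows "transpose_mat M * \<Phi> = \<Phi> * N"
proof (rule eq_mat_of_bilinear)
  fix x y :: "'l vec" assume "x \<in> carrier_vec n" "y \<in> carrier_vec n"
  then show "bilinear_of_mat (transpose_mat M * \<Phi>) x y = bilinear_of_mat (\<Phi> * N) x y"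
    using adj[of x y] \<Phi> M N by (simp only: bilinear_of_mat_mult_left bilinear_of_mat_mult_right)
qed (use \<Phi> M N in auto)

lemma symmetric_mat_eq:
  fixes \<Phi> :: "'l::comm_ring_1 mat"
  assumes \<Phi>: "\<Phi> \<in> carrier_mat n n"
    and sym: "\<And>x y. x \<in> carrier_vec n \<Longrightarrow> y \<in> carrier_vec n \<Longrightarrow> bilinear_of_mat \<Phi> x y = \<eta> * bilinear_of_mat \<Phi> y x"
  shows "\<Phi> = \<eta> \<cdot>\<^sub>m transpose_mat \<Phi>"
proof (rule eq_matI)
  fix i j assume "i < dim_row (\<eta> \<cdot>\<^sub>m transpose_mat \<Phi>)" "j < dim_col (\<eta> \<cdot>\<^sub>m transpose_mat \<Phi>)"
  then have ij: "i < n" "j < n" using \<Phi> by auto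
  have "\<Phi> $$ (i, j) = \<eta> * \<Phi> $$ (j, i)"
    using sym[of "unit_vec n i" "unit_vec n j"] bilinear_of_mat_unit[OF \<Phi> ij]
      bilinear_of_mat_unit[OF \<Phi> ij(2,1)] by simp
  then show "\<Phi> $$ (i, j) = (\<eta> \<cdot>\<^sub>m transpose_mat \<Phi>) $$ (i, j)" using \<Phi> ij by simp
qed (use \<Phi> in auto)

text \<open>\<open>\<iota>\<close> models the embedding of \<open>D\<close> as the corner
  \<open>e R e\<close>: multiplicative, but with \<open>\<iota> 1\<close> an idempotent that need
  not be \<open>e\<close>, the unit of the locale. Nothing links \<open>n\<close> to
  \<open>n0\<close> beforehand.\<close>

locale splitting_pair = R: splitting A mul e scl n \<rho> + D: splitting UNIV "(*)" 1 sD n0 \<rho>0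
  for A :: "'a::ab_group_add set" and mul :: "'a \<Rightarrow> 'a \<Rightarrow> 'a" and e :: 'a
    and scl :: "'f::field \<Rightarrow> 'a \<Rightarrow> 'a" and n :: nat and \<rho> :: "'a \<Rightarrow> 'f alg_closure mat"
    and sD :: "'f \<Rightarrow> 'd::ring_1 \<Rightarrow> 'd" and n0 :: nat and \<rho>0 :: "'d \<Rightarrow> 'f alg_closure mat" +
  fixes \<iota> :: "'d \<Rightarrow> 'a"
  assumes iota_mem: "\<iota> d \<in> A" and iota_add: "\<iota> (d + d') = \<iota> d + \<iota> d'"
    and iota_scl: "\<iota> (sD c d) = scl c (\<iota> d)" and iota_mult: "\<iota> (d * d') = mul (\<iota> d) (\<iota> d')"
    and iota_one: "\<iota> 1 \<noteq> 0" and scl_zero: "scl 0 x = 0"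
begin

text \<open>The entries of \<open>\<rho> (\<iota> d)\<close> are functionals on \<open>D\<close>,
  hence combinations of the entries of \<open>\<rho>0 d\<close>, with coefficients
  \<open>P k l i j\<close>. Multiplicativity makes the matrix of the \<open>P k l m j\<close>, for
  fixed \<open>l\<close> and \<open>j\<close>, an intertwiner. This replaces the uniqueness of the
  simple module of a matrix algebra.\<close>

lemma intertwiner_exists:
  obtains J where "J \<in> carrier_mat n n0" "J \<noteq> 0\<^sub>m n n0" "\<And>d. \<rho> (\<iota> d) * J = J * \<rho>0 d"
proof -
  define P where "P k l = (SOME P. \<forall>d. \<rho> (\<iota> d) $$ (k, l) = (\<Sum>i<n0. \<Sum>j<n0. \<rho>0 d $$ (i, j) * P i j))" for k l
  have P: "\<rho> (\<iota> d) $$ (k, l) = (\<Sum>i<n0. \<Sum>j<n0. \<rho>0 d $$ (i, j) * P k l i j)" if "k < n" "l < n" for d k l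
  proof -
    have "D.functional (\<lambda>d. \<rho> (\<iota> d) $$ (k, l))"
      using that by (simp add: D.functional_def iota_add iota_scl R.rho_add_entry R.rho_scl_entry iota_mem)
    then have "\<exists>P. \<forall>d. \<rho> (\<iota> d) $$ (k, l) = (\<Sum>i<n0. \<Sum>j<n0. \<rho>0 d $$ (i, j) * P i j)"
    proof (rule D.functional_coefficients)
      fix P assume P: "\<And>d. d \<in> UNIV \<Longrightarrow> \<rho> (\<iota> d) $$ (k, l) = (\<Sum>i<n0. \<Sum>j<n0. \<rho>0 d $$ (i, j) * P i j)"
      show ?thesis by (intro exI[of _ P] allI P UNIV_I)
    qed
    from someI_ex[OF this] show ?thesis unfolding P_def[symmetric] by (rule spec)
  qed
  note \<rho>\<iota> = R.rho_carrier[OF iota_mem] and \<rho>0 = D.rho_carrier[OF UNIV_I]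
  \<comment> \<open>Both sides are the coefficient of \<open>\<rho>0 d' $$ (m, j)\<close> in the
    entry \<open>(k, l)\<close> of \<open>\<rho> (\<iota> (d * d'))\<close>, expanded once as a
    product in \<open>R\<close> and once through \<open>\<rho>0 d * \<rho>0 d'\<close>.\<close>
  have equiv: "(\<Sum>k'<n. \<rho> (\<iota> d) $$ (k, k') * P k' l m j) = (\<Sum>i<n0. P k l i j * \<rho>0 d $$ (i, m))"
    if k: "k < n" and l: "l < n" and m: "m < n0" and j: "j < n0" for d k l m j
  proof -
    define Y where "Y m j = (\<Sum>k'<n. \<rho> (\<iota> d) $$ (k, k') * P k' l m j) - (\<Sum>i<n0. P k l i j * \<rho>0 d $$ (i, m))" for m j
    have "Y m j = 0"
    proof (rule D.coefficients_zero[of Y, OF _ m j])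
      fix d' :: 'd
      have "(\<Sum>m<n0. \<Sum>j<n0. \<rho>0 d' $$ (m, j) * (\<Sum>k'<n. \<rho> (\<iota> d) $$ (k, k') * P k' l m j))
          = (\<Sum>m<n0. \<Sum>j<n0. \<Sum>k'<n. \<rho> (\<iota> d) $$ (k, k') * (\<rho>0 d' $$ (m, j) * P k' l m j))"
        by (simp add: sum_distrib_left algebra_simps)
      also have "\<dots> = (\<Sum>m<n0. \<Sum>k'<n. \<Sum>j<n0. \<rho> (\<iota> d) $$ (k, k') * (\<rho>0 d' $$ (m, j) * P k' l m j))"
        by (intro sum.cong refl sum.swap)
      also have "\<dots> = (\<Sum>k'<n. \<Sum>m<n0. \<Sum>j<n0. \<rho> (\<iota> d) $$ (k, k') * (\<rho>0 d' $$ (m, j) * P k' l m j))"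
        by (rule sum.swap)
      also have "\<dots> = (\<Sum>k'<n. \<rho> (\<iota> d) $$ (k, k') * \<rho> (\<iota> d') $$ (k', l))"
        by (intro sum.cong refl) (simp add: P l sum_distrib_left)
      also have "\<dots> = \<rho> (\<iota> (d * d')) $$ (k, l)"
        by (simp only: iota_mult R.rho_mul[OF iota_mem iota_mem] mult_mat_entry[OF \<rho>\<iota> \<rho>\<iota> k l])
      also have "\<dots> = (\<Sum>i<n0. \<Sum>j<n0. (\<rho>0 d * \<rho>0 d') $$ (i, j) * P k l i j)"
        by (simp only: P[OF k l] D.rho_mul[OF UNIV_I UNIV_I])
      also have "\<dots> = (\<Sum>i<n0. \<Sum>j<n0. (\<Sum>m<n0. \<rho>0 d $$ (i, m) * \<rho>0 d' $$ (m, j)) * P k l i j)"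
        by (intro sum.cong refl) (simp only: mult_mat_entry[OF \<rho>0 \<rho>0] lessThan_iff)
      also have "\<dots> = (\<Sum>i<n0. \<Sum>j<n0. \<Sum>m<n0. \<rho>0 d' $$ (m, j) * (P k l i j * \<rho>0 d $$ (i, m)))"
        by (simp add: sum_distrib_right sum_distrib_left mult.commute mult.left_commute)
      also have "\<dots> = (\<Sum>i<n0. \<Sum>m<n0. \<Sum>j<n0. \<rho>0 d' $$ (m, j) * (P k l i j * \<rho>0 d $$ (i, m)))"
        by (intro sum.cong refl sum.swap)
      also have "\<dots> = (\<Sum>m<n0. \<Sum>i<n0. \<Sum>j<n0. \<rho>0 d' $$ (m, j) * (P k l i j * \<rho>0 d $$ (i, m)))"
        by (rule sum.swap)
      also have "\<dots> = (\<Sum>m<n0. \<Sum>j<n0. \<Sum>i<n0. \<rho>0 d' $$ (m, j) * (P k l i j * \<rho>0 d $$ (i, m)))"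
        by (intro sum.cong refl sum.swap)
      also have "\<dots> = (\<Sum>m<n0. \<Sum>j<n0. \<rho>0 d' $$ (m, j) * (\<Sum>i<n0. P k l i j * \<rho>0 d $$ (i, m)))"
        by (simp only: sum_distrib_left)
      finally show "(\<Sum>m<n0. \<Sum>j<n0. \<rho>0 d' $$ (m, j) * Y m j) = 0"
        by (simp add: Y_def right_diff_distrib sum_subtractf)
    qed
    then show ?thesis by (simp add: Y_def)
  qed
  have "\<exists>k<n. \<exists>l<n. \<rho> (\<iota> 1) $$ (k, l) \<noteq> 0"
  proof (rule ccontr)
    assume "\<not> ?thesis"
    then have "\<exists>E. \<iota> 1 = (\<Sum>b\<in>E. scl 0 b)" by (intro R.rho_zero[OF iota_mem]) blast
    then show False using iota_one by (auto simp: scl_zero)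
  qed
  then obtain k l where kl: "k < n" "l < n" "\<rho> (\<iota> 1) $$ (k, l) \<noteq> 0" by blast
  have "\<exists>m<n0. \<exists>j<n0. P k l m j \<noteq> 0"
  proof (rule ccontr)
    assume "\<not> ?thesis"
    then have "(\<Sum>i<n0. \<Sum>j<n0. \<rho>0 1 $$ (i, j) * P k l i j) = 0" by (intro sum.neutral ballI) simp
    then show False using kl P[OF kl(1,2), of 1] by simp
  qed
  then obtain m j where mj: "m < n0" "j < n0" "P k l m j \<noteq> 0" by blast
  \<comment> \<open>The fixed indices \<open>l\<close> and \<open>j\<close> come from a nonzero
    coefficient, which exists because \<open>\<rho> (\<iota> 1)\<close> is nonzero.\<close>
  define J where "J = mat n n0 (\<lambda>(k, m). P k l m j)"
  have J: "J \<in> carrier_mat n n0" by (simp add: J_def)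
  have J_entry: "J $$ (k, m) = P k l m j" if "k < n" "m < n0" for k m using that by (simp add: J_def)
  have "J \<noteq> 0\<^sub>m n n0"
  proof
    assume "J = 0\<^sub>m n n0"
    then have "J $$ (k, m) = 0" using kl mj by simp
    then show False using J_entry[OF kl(1) mj(1)] mj(3) by simp
  qed
  moreover have "\<rho> (\<iota> d) * J = J * \<rho>0 d" for d
  proof (rule eq_matI)
    fix k m assume "k < dim_row (J * \<rho>0 d)" "m < dim_col (J * \<rho>0 d)"
    then have km: "k < n" "m < n0" using J \<rho>0[of d] by auto
    have "(\<rho> (\<iota> d) * J) $$ (k, m) = (\<Sum>k'<n. \<rho> (\<iota> d) $$ (k, k') * P k' l m j)"
      unfolding mult_mat_entry[OF \<rho>\<iota> J km] using km by (intro sum.cong refl) (simp add: J_entry)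
    also have "\<dots> = (\<Sum>i<n0. P k l i j * \<rho>0 d $$ (i, m))" by (rule equiv[OF km(1) kl(2) km(2) mj(2)])
    also have "\<dots> = (J * \<rho>0 d) $$ (k, m)"
      unfolding mult_mat_entry[OF J \<rho>0 km] using km by (intro sum.cong refl) (simp add: J_entry)
    finally show "(\<rho> (\<iota> d) * J) $$ (k, m) = (J * \<rho>0 d) $$ (k, m)" .
  next
    show "dim_row (\<rho> (\<iota> d) * J) = dim_row (J * \<rho>0 d)" "dim_col (\<rho> (\<iota> d) * J) = dim_col (J * \<rho>0 d)"
      using J \<rho>\<iota>[of d] \<rho>0[of d] by auto
  qed
  ultimately show thesis using that J by blast
qed

text \<open>Along an intertwiner \<open>J\<close>, the form with Gram matrix \<open>\<Phi>\<close>, twisted by \<open>s\<close>, pulls back to a nonzero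
  form with the adjunction of \<open>\<Phi>0\<close>, hence to a multiple of \<open>\<Phi>0\<close>.\<close>

lemma type_sign:
  assumes \<Phi>: "\<Phi> \<in> carrier_mat n n" "invertible_mat \<Phi>" "\<Phi> = \<eta> \<cdot>\<^sub>m transpose_mat \<Phi>"
    and \<Phi>_adj: "\<And>a. a \<in> A \<Longrightarrow> transpose_mat (\<rho> a) * \<Phi> = \<Phi> * \<rho> (\<phi> a)"
    and \<Phi>0: "\<Phi>0 \<in> carrier_mat n0 n0" "invertible_mat \<Phi>0" "\<Phi>0 = \<eta>0 \<cdot>\<^sub>m transpose_mat \<Phi>0"
    and \<Phi>0_adj: "\<And>d. transpose_mat (\<rho>0 d) * \<Phi>0 = \<Phi>0 * \<rho>0 (\<phi>0 d)"
    and phi_mem: "\<And>a. a \<in> A \<Longrightarrow> \<phi> a \<in> A"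
    and s: "s \<in> A" "\<phi> s = scl k s" "mul s (\<iota> 1) = s" "\<And>d. mul (\<phi> (\<iota> d)) s = mul s (\<iota> (\<phi>0 d))"
    and t: "t \<in> A" "mul s t = \<phi> (\<iota> 1)"
    and corner: "\<And>a. a \<in> A \<Longrightarrow> \<exists>d. mul (mul (\<iota> 1) a) (\<iota> 1) = \<iota> d"
  shows "\<eta> = to_ac k * \<eta>0"
proof -
  obtain J where J: "J \<in> carrier_mat n n0" "J \<noteq> 0\<^sub>m n n0" "\<And>d. \<rho> (\<iota> d) * J = J * \<rho>0 d"
    using intertwiner_exists by blast
  note \<rho>\<iota> = R.rho_carrier[OF iota_mem] and \<rho>0 = D.rho_carrier[OF UNIV_I]
  let ?T = "transpose_mat :: 'f alg_closure mat \<Rightarrow> 'f alg_closure mat"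
  define S where "S = \<rho> s"
  define W where "W = ?T J"
  have S: "S \<in> carrier_mat n n" and W: "W \<in> carrier_mat n0 n"
    using R.rho_carrier[OF s(1)] J(1) by (simp_all add: S_def W_def)
  \<comment> \<open>The Gram matrix of the pulled back form: it pairs \<open>x\<close> with
    \<open>y\<close> as \<open>\<Phi>\<close> pairs \<open>J x\<close> with
    \<open>S J y\<close>.\<close>
  define \<Gamma> where "\<Gamma> = W * (\<Phi> * (S * J))"
  have \<Gamma>: "\<Gamma> \<in> carrier_mat n0 n0" using S W \<Phi>(1) J(1) by (simp add: \<Gamma>_def)
  have W_iota: "?T (\<rho>0 d) * W = W * ?T (\<rho> (\<iota> d))" for d
    using transpose_mult[OF \<rho>\<iota>[of d] J(1)] transpose_mult[OF J(1) \<rho>0[of d]] J(3)[of d] by (simp add: W_def)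
  have unit_J: "\<rho> (\<iota> 1) * J = J" using J(1) J(3)[of 1] D.rho_one by simp
  have adj: "?T (\<rho>0 d) * \<Gamma> = \<Gamma> * \<rho>0 (\<phi>0 d)" for d
  proof -
    let ?P = "\<rho> (\<phi> (\<iota> d))"
    have P: "?P \<in> carrier_mat n n" by (intro R.rho_carrier phi_mem iota_mem)
    have "?T (\<rho>0 d) * \<Gamma> = (?T (\<rho>0 d) * W) * (\<Phi> * (S * J))"
      unfolding \<Gamma>_def using \<rho>0[of d] W \<Phi>(1) S J(1) by (simp add: assoc_mult_mat[of _ n0 n0 _ n _ n0])
    also have "\<dots> = W * ((?T (\<rho> (\<iota> d)) * \<Phi>) * (S * J))"
      unfolding W_iota using \<rho>\<iota>[of d] W \<Phi>(1) S J(1)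
      by (simp add: assoc_mult_mat[of W n0 n _ n _ n0] assoc_mult_mat[of _ n n \<Phi> n _ n0])
    also have "\<dots> = W * (\<Phi> * ((?P * S) * J))"
      unfolding \<Phi>_adj[OF iota_mem] using P W \<Phi>(1) S J(1)
      by (simp add: assoc_mult_mat[of \<Phi> n n _ n _ n0] assoc_mult_mat[of ?P n n S n J n0])
    also have "?P * S = S * \<rho> (\<iota> (\<phi>0 d))"
      unfolding S_def R.rho_mul[OF phi_mem[OF iota_mem] s(1), symmetric] s(4)
      by (rule R.rho_mul[OF s(1) iota_mem])
    also have "(S * \<rho> (\<iota> (\<phi>0 d))) * J = (S * J) * \<rho>0 (\<phi>0 d)"
      using S \<rho>\<iota> J(1) \<rho>0 by (simp add: assoc_mult_mat[of S n n _ n J n0] assoc_mult_mat[of S n n J n0 _ n0] J(3))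
    also have "W * (\<Phi> * ((S * J) * \<rho>0 (\<phi>0 d))) = \<Gamma> * \<rho>0 (\<phi>0 d)"
      unfolding \<Gamma>_def using W \<Phi>(1) mult_carrier_mat[OF S J(1)] \<rho>0[of "\<phi>0 d"]
      by (simp add: assoc_mult_mat[of \<Phi> n n "S * J" n0 _ n0] assoc_mult_mat[of W n0 n _ n0 _ n0])
    finally show ?thesis .
  qed
  \<comment> \<open>By the corner condition \<open>S * (\<rho> a * J) = S * J * \<rho>0 d\<close>,
    so if \<open>\<Gamma>\<close> were 0, \<open>W * (\<Phi> * S)\<close> would annihilate all
    \<open>\<rho> a * J\<close> and hence be 0. Multiplication by \<open>\<rho> t\<close> turns
    \<open>S\<close> into \<open>\<rho> (\<phi> (\<iota> 1))\<close>, which passes through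
    \<open>\<Phi>\<close> and is absorbed by \<open>W\<close>; this leaves
    \<open>W * \<Phi> = 0\<close>.\<close>
  have \<Gamma>_0: "\<Gamma> \<noteq> 0\<^sub>m n0 n0"
  proof
    assume \<Gamma>_0: "\<Gamma> = 0\<^sub>m n0 n0"
    have WPS: "W * (\<Phi> * S) \<in> carrier_mat n0 n" using W \<Phi>(1) S by simp
    have "W * (\<Phi> * S) = 0\<^sub>m n0 n"
    proof (rule R.two_sided_annihilator[OF WPS J(1,2)])
      fix a assume a: "a \<in> A"
      obtain d where d: "mul (mul (\<iota> 1) a) (\<iota> 1) = \<iota> d" using corner[OF a] by blast
      note \<rho>a = R.rho_carrier[OF a]
      let ?E = "\<rho> (\<iota> 1)"
      have S_E: "S = S * ?E"
        using R.rho_mul[OF s(1) iota_mem, of 1] by (simp add: S_def s(3))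
      have EaE: "?E * \<rho> a * ?E = \<rho> (\<iota> d)"
        using R.rho_mul[OF R.mul_closed[OF iota_mem a] iota_mem, of 1 1] R.rho_mul[OF iota_mem a, of 1] d by simp
      have "S * (\<rho> a * J) = (S * ?E) * (\<rho> a * (?E * J))" by (simp only: S_E[symmetric] unit_J)
      also have "\<dots> = S * ((?E * \<rho> a * ?E) * J)"
        using S \<rho>\<iota>[of 1] \<rho>a J(1)
        by (simp add: assoc_mult_mat[of S n n ?E n _ n0] assoc_mult_mat[of ?E n n _ n _ n] assoc_mult_mat[of ?E n n _ n _ n0]
            assoc_mult_mat[of "\<rho> a" n n _ n _ n0])
      also have "\<dots> = (S * J) * \<rho>0 d"
        unfolding EaE J(3) using S J(1) \<rho>0[of d] by (simp add: assoc_mult_mat[of S n n J n0 _ n0])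
      finally have SaJ: "S * (\<rho> a * J) = (S * J) * \<rho>0 d" .
      have "W * (\<Phi> * S) * (\<rho> a * J) = W * (\<Phi> * (S * (\<rho> a * J)))"
        using W \<Phi>(1) S \<rho>a J(1) by (simp add: assoc_mult_mat[of W n0 n _ n _ n0] assoc_mult_mat[of \<Phi> n n S n _ n0])
      also have "\<dots> = \<Gamma> * \<rho>0 d"
        unfolding SaJ \<Gamma>_def using W \<Phi>(1) mult_carrier_mat[OF S J(1)] \<rho>0[of d]
        by (simp add: assoc_mult_mat[of \<Phi> n n "S * J" n0 _ n0] assoc_mult_mat[of W n0 n _ n0 _ n0])
      finally show "W * (\<Phi> * S) * (\<rho> a * J) = 0\<^sub>m n0 n0" using \<rho>0[of d] by (simp add: \<Gamma>_0)
    qed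
    moreover have "W * (\<Phi> * S) * \<rho> t = W * \<Phi>"
    proof -
      note \<rho>t = R.rho_carrier[OF t(1)]
      have "W * (\<Phi> * S) * \<rho> t = W * (\<Phi> * (S * \<rho> t))"
        using W \<Phi>(1) S \<rho>t by (simp add: assoc_mult_mat[of W n0 n _ n _ n] assoc_mult_mat[of \<Phi> n n S n _ n])
      also have "S * \<rho> t = \<rho> (\<phi> (\<iota> 1))" by (simp add: S_def t(2) flip: R.rho_mul[OF s(1) t(1)])
      also have "W * (\<Phi> * \<rho> (\<phi> (\<iota> 1))) = W * ?T (\<rho> (\<iota> 1)) * \<Phi>"
        unfolding \<Phi>_adj[OF iota_mem, symmetric] using W \<rho>\<iota>[of 1] \<Phi>(1)
        by (simp add: assoc_mult_mat[of W n0 n _ n \<Phi> n])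
      also have "W * ?T (\<rho> (\<iota> 1)) = W" using W_iota[of 1] D.rho_one W by simp
      finally show ?thesis .
    qed
    ultimately have "W * \<Phi> = 0\<^sub>m n0 n" using R.rho_carrier[OF t(1)] by simp
    moreover obtain \<Psi> where "\<Psi> \<in> carrier_mat n n" "\<Phi> * \<Psi> = 1\<^sub>m n" using invertible_matE[OF \<Phi>(1,2)] .
    ultimately have "W = 0\<^sub>m n0 n"
      using assoc_mult_mat[OF W \<Phi>(1), of \<Psi> n] W by simp
    then have "J = ?T (0\<^sub>m n0 n)" by (metis W_def transpose_transpose)
    also have "\<dots> = 0\<^sub>m n n0" by (rule eq_matI) auto
    finally show False using J(2) by simp
  qed
  have n0: "0 < n0"
  proof (rule ccontr)
    assume "\<not> 0 < n0"
    then have "\<Gamma> = 0\<^sub>m n0 n0" using \<Gamma> by (intro eq_matI) auto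
    then show False using \<Gamma>_0 by simp
  qed
  obtain \<Psi> where \<Psi>: "\<Psi> \<in> carrier_mat n0 n0" "\<Phi>0 * \<Psi> = 1\<^sub>m n0" "\<Psi> * \<Phi>0 = 1\<^sub>m n0"
    using invertible_matE[OF \<Phi>0(1,2)] .
  \<comment> \<open>\<open>\<Gamma>\<close> and \<open>\<Phi>0\<close> have the same adjunction, so
    this quotient commutes with the transposes of all \<open>\<rho>0 d\<close>, and its transpose
    with all \<open>\<rho>0 d\<close>.\<close>
  define K where "K = \<Gamma> * \<Psi>"
  have K: "K \<in> carrier_mat n0 n0" using \<Gamma> \<Psi>(1) by (simp add: K_def)
  have "?T (\<rho>0 d) * K = K * ?T (\<rho>0 d)" for d
  proof -
    let ?r = "\<rho>0 (\<phi>0 d)" and ?t = "?T (\<rho>0 d)"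
    have r: "?r \<in> carrier_mat n0 n0" and t: "?t \<in> carrier_mat n0 n0" using \<rho>0 by simp_all
    have "?r * \<Psi> = (\<Psi> * \<Phi>0) * (?r * \<Psi>)" using r \<Psi> by simp
    also have "\<dots> = \<Psi> * (\<Phi>0 * ?r) * \<Psi>"
      using r \<Psi>(1) \<Phi>0(1) by (simp add: assoc_mult_mat[of _ n0 n0 _ n0 _ n0])
    also have "\<dots> = \<Psi> * ?t * (\<Phi>0 * \<Psi>)"
      unfolding \<Phi>0_adj[symmetric] using t \<Psi>(1) \<Phi>0(1) by (simp add: assoc_mult_mat[of _ n0 n0 _ n0 _ n0])
    also have "\<dots> = \<Psi> * ?t" using t \<Psi> by simp
    finally have r\<Psi>: "?r * \<Psi> = \<Psi> * ?t" .
    have "?t * K = (?t * \<Gamma>) * \<Psi>" unfolding K_def using t \<Gamma> \<Psi>(1) by (simp add: assoc_mult_mat[of _ n0 n0 _ n0 _ n0])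
    also have "\<dots> = \<Gamma> * (?r * \<Psi>)" unfolding adj using r \<Gamma> \<Psi>(1) by (simp add: assoc_mult_mat[of _ n0 n0 _ n0 _ n0])
    also have "\<dots> = K * ?t" unfolding r\<Psi> K_def using t \<Gamma> \<Psi>(1) by (simp add: assoc_mult_mat[of _ n0 n0 _ n0 _ n0])
    finally show ?thesis .
  qed
  then have comm: "?T K * \<rho>0 d = \<rho>0 d * ?T K" for d
    using transpose_mult[OF _ K, of "?T (\<rho>0 d)" n0] transpose_mult[OF K, of "?T (\<rho>0 d)" n0] \<rho>0[of d]
    by simp
  have "?T K \<in> carrier_mat n0 n0" using K by simp
  then obtain c where "?T K = c \<cdot>\<^sub>m 1\<^sub>m n0" using D.commuting_mat_scalar[OF _ n0 comm] by blast
  then have "?T (?T K) = ?T (c \<cdot>\<^sub>m 1\<^sub>m n0)" by simp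
  moreover have "?T (c \<cdot>\<^sub>m 1\<^sub>m n0) = c \<cdot>\<^sub>m 1\<^sub>m n0" by (rule eq_matI) auto
  ultimately have K_eq: "K = c \<cdot>\<^sub>m 1\<^sub>m n0" by simp
  have \<Gamma>_eq: "\<Gamma> = c \<cdot>\<^sub>m \<Phi>0"
  proof -
    have "\<Gamma> = K * \<Phi>0" unfolding K_def using \<Gamma> \<Psi> \<Phi>0(1) by (simp add: assoc_mult_mat[of _ n0 n0 _ n0 _ n0])
    then show ?thesis unfolding K_eq using \<Phi>0(1) by (simp add: mult_smult_assoc_mat[of _ n0 n0 _ n0])
  qed
  \<comment> \<open>Transposing moves \<open>S\<close> to the other side of \<open>\<Phi>\<close>,
    where adjunction turns it into \<open>\<rho> (\<phi> s)\<close>, that is, \<open>k\<close> times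
    \<open>S\<close>.\<close>
  have sym: "\<eta> \<cdot>\<^sub>m ?T \<Gamma> = to_ac k \<cdot>\<^sub>m \<Gamma>"
  proof -
    have TW: "?T W = J" by (simp add: W_def)
    have "?T \<Gamma> = W * (?T S * (?T \<Phi> * J))"
    proof -
      have "?T \<Gamma> = ?T (\<Phi> * (S * J)) * J"
        unfolding \<Gamma>_def TW[symmetric] by (rule transpose_mult[OF W]) (use \<Phi>(1) S J(1) TW in auto)
      also have "?T (\<Phi> * (S * J)) = ?T (S * J) * ?T \<Phi>"
        by (rule transpose_mult[OF \<Phi>(1) mult_carrier_mat[OF S J(1)]])
      also have "?T (S * J) = W * ?T S" unfolding W_def by (rule transpose_mult[OF S J(1)])
      finally show ?thesis
        using W S \<Phi>(1) J(1) by (simp add: assoc_mult_mat[of W n0 n _ n _ n] assoc_mult_mat[of W n0 n _ n _ n0]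
          assoc_mult_mat[of _ n n _ n _ n0])
    qed
    then have "\<eta> \<cdot>\<^sub>m ?T \<Gamma> = W * (?T S * ((\<eta> \<cdot>\<^sub>m ?T \<Phi>) * J))"
      using W S \<Phi>(1) J(1)
      by (simp add: mult_smult_assoc_mat[of _ n n _ n0] mult_smult_distrib[of _ n n _ n0] mult_smult_distrib[of _ n0 n _ n0])
    also have "\<eta> \<cdot>\<^sub>m ?T \<Phi> = \<Phi>" using \<Phi>(3) by simp
    also have "?T S * (\<Phi> * J) = (?T S * \<Phi>) * J"
      using S \<Phi>(1) J(1) by (simp add: assoc_mult_mat[of _ n n _ n _ n0])
    also have "?T S * \<Phi> = \<Phi> * (to_ac k \<cdot>\<^sub>m S)"
      using \<Phi>_adj[OF s(1)] by (simp add: S_def s(2) R.rho_scl[OF s(1)])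
    also have "W * (\<Phi> * (to_ac k \<cdot>\<^sub>m S) * J) = to_ac k \<cdot>\<^sub>m \<Gamma>"
      unfolding \<Gamma>_def using W S \<Phi>(1) J(1)
      by (simp add: assoc_mult_mat[of \<Phi> n n _ n _ n0] mult_smult_assoc_mat[of _ n n _ n0] mult_smult_distrib[of _ n n _ n0]
          mult_smult_distrib[of _ n0 n _ n0])
    finally show ?thesis .
  qed
  obtain i j where ij: "i < n0" "j < n0" "\<Gamma> $$ (j, i) \<noteq> 0"
  proof -
    have "\<exists>i<n0. \<exists>j<n0. \<Gamma> $$ (j, i) \<noteq> 0"
    proof (rule ccontr)
      assume "\<not> ?thesis"
      then have "\<Gamma> = 0\<^sub>m n0 n0" using \<Gamma> by (intro eq_matI) auto
      then show False using \<Gamma>_0 by simp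
    qed
    then show thesis using that by blast
  qed
  \<comment> \<open>At a nonzero entry, this symmetry and the one inherited from
    \<open>\<Phi>0\<close> must agree.\<close>
  have "\<eta> * \<Gamma> $$ (j, i) = to_ac k * \<Gamma> $$ (i, j)"
    using arg_cong[OF sym, of "\<lambda>M. M $$ (i, j)"] \<Gamma> ij by simp
  also have "\<Gamma> $$ (i, j) = c * \<Phi>0 $$ (i, j)" unfolding \<Gamma>_eq using \<Phi>0(1) ij by simp
  also have "\<Phi>0 $$ (i, j) = \<eta>0 * \<Phi>0 $$ (j, i)"
    using arg_cong[OF \<Phi>0(3), of "\<lambda>M. M $$ (i, j)"] \<Phi>0(1) ij by simp
  also have "c * (\<eta>0 * \<Phi>0 $$ (j, i)) = \<eta>0 * \<Gamma> $$ (j, i)" unfolding \<Gamma>_eq using \<Phi>0(1) ij by simp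
  finally show ?thesis using ij(3) by (simp flip: mult.assoc)
qed

end

section \<open>The type of an involution as a sign\<close>

lemma bilinear_of_mat_alternating:
  fixes \<Phi> :: "'l::comm_ring_1 mat"
  assumes \<Phi>: "\<Phi> \<in> carrier_mat n n" and alt: "\<And>x. x \<in> carrier_vec n \<Longrightarrow> bilinear_of_mat \<Phi> x x = 0"
    and x: "x \<in> carrier_vec n" and y: "y \<in> carrier_vec n"
  shows "bilinear_of_mat \<Phi> x y = - 1 * bilinear_of_mat \<Phi> y x"
proof -
  have \<Phi>x: "\<Phi> *\<^sub>v x \<in> carrier_vec n" and \<Phi>y: "\<Phi> *\<^sub>v y \<in> carrier_vec n" using \<Phi> x y by simp_all
  have "bilinear_of_mat \<Phi> (x + y) (x + y) =
      bilinear_of_mat \<Phi> x x + bilinear_of_mat \<Phi> x y + (bilinear_of_mat \<Phi> y x + bilinear_of_mat \<Phi> y y)"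
    unfolding bilinear_of_mat_def mult_add_distrib_mat_vec[OF \<Phi> x y]
    using x y \<Phi>x \<Phi>y by (simp add: add_scalar_prod_distrib[of _ n] scalar_prod_add_distrib[of _ n])
  then have "bilinear_of_mat \<Phi> x y + bilinear_of_mat \<Phi> y x = 0"
    using alt[of "x + y"] alt[OF x] alt[OF y] x y by simp
  then show ?thesis by (simp add: add_eq_0_iff2)
qed

text \<open>A common form of both types: the sign is 1 for orthogonal and - 1 for symplectic
  involutions, where only the skew-symmetry of the alternating form is retained.\<close>

definition type_sign_on ::
  "'a::ab_group_add set \<Rightarrow> ('a \<Rightarrow> 'a \<Rightarrow> 'a) \<Rightarrow> 'a \<Rightarrow> ('f::field \<Rightarrow> 'a \<Rightarrow> 'a) \<Rightarrow> ('a \<Rightarrow> 'a) \<Rightarrow> 'f alg_closure \<Rightarrow> bool" where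
  "type_sign_on A mul e scl \<sigma> \<eta> \<longleftrightarrow>
     (\<exists>n \<Phi>. adjunction_after_splitting A mul e scl \<sigma> n \<Phi> \<and>
        (\<forall>x\<in>carrier_vec n. \<forall>y\<in>carrier_vec n. bilinear_of_mat \<Phi> x y = \<eta> * bilinear_of_mat \<Phi> y x))"

lemma orthogonal_type_sign: "orthogonal_type A mul e scl \<sigma> \<Longrightarrow> type_sign_on A mul e scl \<sigma> 1"
  unfolding orthogonal_type_def type_sign_on_def by simp

lemma symplectic_type_sign: "symplectic_type A mul e scl \<sigma> \<Longrightarrow> type_sign_on A mul e scl \<sigma> (- 1)"
proof -
  assume "symplectic_type A mul e scl \<sigma>"
  then obtain n \<Phi> where adj: "adjunction_after_splitting A mul e scl \<sigma> n \<Phi>"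
    and alt: "\<And>x. x \<in> carrier_vec n \<Longrightarrow> bilinear_of_mat \<Phi> x x = 0"
    unfolding symplectic_type_def by blast
  have "\<Phi> \<in> carrier_mat n n" using adj by (simp add: adjunction_after_splitting_def)
  from bilinear_of_mat_alternating[OF this alt] show ?thesis
    unfolding type_sign_on_def using adj by blast
qed

lemma type_sign_onE:
  assumes "type_sign_on A mul e scl \<sigma> \<eta>" "\<And>x. x \<in> A \<Longrightarrow> \<sigma> x \<in> A"
  obtains n \<Phi> \<rho> where "splitting_on A mul e scl n \<rho>" "\<Phi> \<in> carrier_mat n n" "invertible_mat \<Phi>"
    "\<Phi> = \<eta> \<cdot>\<^sub>m transpose_mat \<Phi>" "\<And>a. a \<in> A \<Longrightarrow> transpose_mat (\<rho> a) * \<Phi> = \<Phi> * \<rho> (\<sigma> a)"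
proof -
  obtain n \<Phi> where ad: "adjunction_after_splitting A mul e scl \<sigma> n \<Phi>"
    and sym: "\<And>x y. x \<in> carrier_vec n \<Longrightarrow> y \<in> carrier_vec n \<Longrightarrow> bilinear_of_mat \<Phi> x y = \<eta> * bilinear_of_mat \<Phi> y x"
    using assms(1) unfolding type_sign_on_def by blast
  obtain \<rho> where \<rho>: "splitting_on A mul e scl n \<rho>" and \<Phi>: "\<Phi> \<in> carrier_mat n n" "invertible_mat \<Phi>"
    and adj: "\<And>a x y. a \<in> A \<Longrightarrow> x \<in> carrier_vec n \<Longrightarrow> y \<in> carrier_vec n \<Longrightarrow>
       bilinear_of_mat \<Phi> (\<rho> a *\<^sub>v x) y = bilinear_of_mat \<Phi> x (\<rho> (\<sigma> a) *\<^sub>v y)"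
    using ad unfolding adjunction_after_splitting_def by blast
  have "transpose_mat (\<rho> a) * \<Phi> = \<Phi> * \<rho> (\<sigma> a)" if a: "a \<in> A" for a
    by (rule adjoint_mat_eq[OF \<Phi>(1) _ _ adj[OF a]]) (use \<rho> a assms(2) in \<open>simp_all add: splitting_on_def\<close>)
  with \<rho> \<Phi> symmetric_mat_eq[OF \<Phi>(1) sym] show thesis by (rule that)
qed

context compatible_involution
begin

lemma End_scale_closed: "r \<in> End_D act \<Longrightarrow> End_scale sD act c r \<in> End_D act"
proof (rule End_DI)
  fix v w d assume r: "r \<in> End_D act"
  show "End_scale sD act c r (v + w) = End_scale sD act c r v + End_scale sD act c r w"
    by (simp add: End_scale_def module_scale_def End_D_add[OF r] act_add_left)
  show "End_scale sD act c r (v \<cdot> d) = End_scale sD act c r v \<cdot> d"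
    by (simp add: End_scale_def module_scale_def End_D_act[OF r] D.scl_one_commute flip: act_mult)
qed

lemma form_type_sign:
  assumes B: "B \<in> forms" and sym: "\<And>v w. B w v = sD k (\<phi>0 (B v w))"
    and tR: "type_sign_on (End_D act) (\<circ>) id (End_scale sD act) \<phi> \<eta>"
    and tD: "type_sign_on UNIV (*) 1 sD \<phi>0 \<eta>0"
  shows "\<eta> = to_ac k * \<eta>0"
proof -
  let ?R = "End_D act"
  obtain n \<Phi> \<rho> where R: "splitting_on ?R (\<circ>) id (End_scale sD act) n \<rho>" "\<Phi> \<in> carrier_mat n n" "invertible_mat \<Phi>"
    "\<Phi> = \<eta> \<cdot>\<^sub>m transpose_mat \<Phi>" "\<And>a. a \<in> ?R \<Longrightarrow> transpose_mat (\<rho> a) * \<Phi> = \<Phi> * \<rho> (\<phi> a)"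
    using type_sign_onE[OF tR phi_mem] by metis
  obtain n0 \<Phi>0 \<rho>0 where D: "splitting_on UNIV (*) 1 sD n0 \<rho>0" "\<Phi>0 \<in> carrier_mat n0 n0" "invertible_mat \<Phi>0"
    "\<Phi>0 = \<eta>0 \<cdot>\<^sub>m transpose_mat \<Phi>0" "\<And>d. transpose_mat (\<rho>0 d) * \<Phi>0 = \<Phi>0 * \<rho>0 (\<phi>0 d)"
    using type_sign_onE[OF tD UNIV_I] by (metis UNIV_I)
  define \<iota> where "\<iota> d = \<theta> (v1 \<cdot> d)" for d
  have \<iota>_0: "\<iota> 1 \<noteq> 0"
  proof
    assume "\<iota> 1 = 0"
    then have "v1 = 0" by (metis \<iota>_def act_one theta_v1' zero_fun_apply)
    then show False using f_v1 f_act[of 0 0] by simp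
  qed
  have splitR: "splitting ?R (\<circ>) id (End_scale sD act) n \<rho>"
    by (rule splitting.intro[OF R(1) zero_End_D plus_End_D End_scale_closed comp_End_D])
  have splitD: "splitting UNIV (*) 1 sD n0 \<rho>0"
    by (rule splitting.intro[OF D(1)]) simp_all
  have \<iota>: "\<iota> d \<in> ?R" "\<iota> (d + d') = \<iota> d + \<iota> d'" "\<iota> (sD c d) = End_scale sD act c (\<iota> d)"
    "\<iota> (d * d') = \<iota> d \<circ> \<iota> d'" for d d' c
  proof -
    show "\<iota> d \<in> ?R" unfolding \<iota>_def by (rule theta_End_D)
    show "\<iota> (d + d') = \<iota> d + \<iota> d'" by (simp add: fun_eq_iff \<iota>_def \<theta>_def act_add_right act_add_left)
    show "\<iota> (sD c d) = End_scale sD act c (\<iota> d)"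
      by (simp add: fun_eq_iff \<iota>_def \<theta>_def End_scale_def module_scale_def D.scl_mult_left D.scl_mult_right
          flip: act_mult)
    show "\<iota> (d * d') = \<iota> d \<circ> \<iota> d'"
      by (simp add: fun_eq_iff \<iota>_def \<theta>_def f_act f_v1 act_mult)
  qed
  have scl_0: "End_scale sD act 0 r = 0" for r
    by (simp add: fun_eq_iff End_scale_def module_scale_def)
  interpret splitting_pair ?R "(\<circ>)" id "End_scale sD act" n \<rho> sD n0 \<rho>0 \<iota>
    by (intro splitting_pair.intro splitting_pair_axioms.intro splitR splitD \<iota> \<iota>_0 scl_0)
  let ?c = "B v1 w1"
  obtain g where g: "?c \<in> Dg g" using form_coefficient(1)[OF B] by blast
  obtain y where y: "?c * y = 1" "y * ?c = 1"
    using D.homogeneous_inverse[OF g form_coefficient(2)[OF B]] by metis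
  \<comment> \<open>The factor \<open>y\<close> cancels the coefficient of \<open>B\<close> relative
    to \<open>B0\<close>, so that \<open>u\<close> represents \<open>f\<close>.\<close>
  define u where "u = w1 \<cdot> y"
  have Bu: "B v u = \<phi>0 (f v)" for v
  proof -
    have "B0 v w1 = B0 (\<theta> v1 v) w1"
      using B0_adj[OF theta_End_D, of v1 v w1] by (simp add: phi_theta B0_unit act_one)
    then have "B v w1 = ?c * \<psi> (f v)" using form_eq_base_form[OF B, of v w1] by (simp add: \<theta>_def \<psi>_def)
    then have "B v u = \<phi>0 (f v) * (?c * y)"
      by (simp add: u_def formsD(4)[OF B] mult.assoc flip: form_coefficient(3)[OF B])
    then show ?thesis by (simp add: y)
  qed
  have phi_\<theta>: "\<phi> (\<theta> w) x = u \<cdot> B w x" for w x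
  proof -
    have "u \<cdot> B w x = w1 \<cdot> (y * ?c * B0 w x)"
      by (simp add: u_def form_eq_base_form[OF B, of w x] mult.assoc act_mult)
    then show ?thesis by (simp add: y phi_theta)
  qed
  show "\<eta> = to_ac k * \<eta>0"
  proof (rule type_sign[OF R(2-5) D(2-5) phi_mem])
    show "\<theta> u \<in> ?R" by (rule theta_End_D)
    show "\<phi> (\<theta> u) = End_scale sD act k (\<theta> u)"
    proof
      fix x
      have "B u x = sD k (f x)" using sym[of u x] by (simp only: Bu phi0_phi0)
      then show "\<phi> (\<theta> u) x = End_scale sD act k (\<theta> u) x"
        unfolding phi_\<theta> by (simp add: End_scale_def module_scale_def \<theta>_def D.scl_mult_right flip: act_mult)
    qed
    show "\<theta> u \<circ> \<iota> 1 = \<theta> u"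
      by (auto simp: \<iota>_def \<theta>_def f_act f_v1 act_one)
    show "\<phi> (\<iota> d) \<circ> \<theta> u = \<theta> u \<circ> \<iota> (\<phi>0 d)" for d
    proof
      fix x
      have "B (v1 \<cdot> d) (u \<cdot> f x) = \<phi>0 d * f x"
        by (simp add: formsD(4)[OF B] Bu f_act f_v1)
      then show "(\<phi> (\<iota> d) \<circ> \<theta> u) x = (\<theta> u \<circ> \<iota> (\<phi>0 d)) x"
        by (simp add: \<iota>_def phi_\<theta>) (simp add: \<theta>_def f_act f_v1)
    qed
    \<comment> \<open>The witness for \<open>t\<close>: \<open>\<theta> u\<close> sends
      \<open>v1 \<cdot> d\<close> to \<open>u \<cdot> d\<close>, so the composite sends
      \<open>x\<close> to \<open>u \<cdot> B v1 x\<close>, which is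
      \<open>\<phi> (\<theta> v1) x\<close>.\<close>
    show "(\<lambda>x. v1 \<cdot> B v1 x) \<in> ?R"
      by (rule End_DI) (simp_all add: formsD(2,4)[OF B] act_add_right act_mult)
    show "\<theta> u \<circ> (\<lambda>x. v1 \<cdot> B v1 x) = \<phi> (\<iota> 1)"
    proof
      fix x
      show "(\<theta> u \<circ> (\<lambda>x. v1 \<cdot> B v1 x)) x = \<phi> (\<iota> 1) x"
        unfolding \<iota>_def phi_\<theta> by (simp add: \<theta>_def f_act f_v1 act_one)
    qed
    \<comment> \<open>\<open>\<iota> 1\<close> maps into \<open>v1 D\<close>, on which
      \<open>a\<close> followed by \<open>\<iota> 1\<close> acts through the single scalar
      \<open>f (a v1)\<close>.\<close>
    show "\<exists>d. (\<iota> 1 \<circ> a) \<circ> \<iota> 1 = \<iota> d" if a: "a \<in> ?R" for a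
      by (rule exI[of _ "f (a v1)"])
        (auto simp: \<iota>_def \<theta>_def f_act act_one End_D_act[OF a] act_mult)
  qed
qed

text \<open>Cancelling the nonzero type sign in \<open>form_type_sign\<close> leaves
  \<open>k = 1\<close>; a general \<open>\<eta>\<close> treats both matching types at once.\<close>

lemma types_equal_hermitian:
  assumes cs: "central_simple_on (End_D act) (\<circ>) id (End_scale sD act)" and B: "B \<in> forms"
    and t: "type_sign_on (End_D act) (\<circ>) id (End_scale sD act) \<phi> \<eta>" "type_sign_on UNIV (*) 1 sD \<phi>0 \<eta>"
    and \<eta>: "\<eta> \<noteq> 0"
  shows "hermitian \<phi>0 B"
proof -
  obtain k where k: "\<And>v w. B w v = sD k (\<phi>0 (B v w))"
    using form_sign_central[OF cs B] by blast
  have "k = 1" using form_type_sign[OF B k t] \<eta> by simp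
  show ?thesis unfolding hermitian_def
  proof (intro allI)
    show "B w v = \<phi>0 (B v w)" for v w
      using k[of w v] by (simp only: \<open>k = 1\<close> D.scale_one)
  qed
qed

lemma types_opposite_skew_hermitian:
  assumes cs: "central_simple_on (End_D act) (\<circ>) id (End_scale sD act)" and B: "B \<in> forms"
    and t: "type_sign_on (End_D act) (\<circ>) id (End_scale sD act) \<phi> (- \<eta>)" "type_sign_on UNIV (*) 1 sD \<phi>0 \<eta>"
    and \<eta>: "\<eta> \<noteq> 0"
  shows "skew_hermitian \<phi>0 B"
proof -
  obtain k where k: "\<And>v w. B w v = sD k (\<phi>0 (B v w))"
    using form_sign_central[OF cs B] by blast
  have "(to_ac (- 1) - to_ac k) * \<eta> = 0" using form_type_sign[OF B k t] by (simp add: left_diff_distrib)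
  then have "to_ac k = to_ac (- 1)" using \<eta> by simp
  then have "k = - 1" by (simp only: to_ac_eq_iff)
  show ?thesis unfolding skew_hermitian_def
  proof (intro allI)
    show "B w v = - \<phi>0 (B v w)" for v w
      using k[of w v] by (simp only: \<open>k = - 1\<close> D.scale_minus_left D.scale_one)
  qed
qed

lemma char_2_hermitian:
  assumes cs: "central_simple_on (End_D act) (\<circ>) id (End_scale sD act)" and B: "B \<in> forms"
    and char: "CHAR('f) = 2"
  shows "hermitian \<phi>0 B"
proof -
  obtain k where k: "k = 1 \<or> k = - 1" "\<And>v w. B w v = sD k (\<phi>0 (B v w))"
    using form_sign_central[OF cs B] by blast
  have "(of_nat CHAR('f) :: 'f) = 0" by (rule of_nat_CHAR)
  then have "(1::'f) + 1 = 0" by (simp add: char)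
  then have "k = 1" using k(1) by (auto simp: add_eq_0_iff)
  show ?thesis unfolding hermitian_def
  proof (intro allI)
    show "B w v = \<phi>0 (B v w)" for v w
      using k(2)[of w v] by (simp only: \<open>k = 1\<close> D.scale_one)
  qed
qed

end

section \<open>The adjoint form for every involution of the same kind, in the three cases\<close>

theorem corollary3p2:
  fixes sD :: "'f::field \<Rightarrow> 'd::ring_1 \<Rightarrow> 'd"
    and Dg :: "'g::ab_group_add \<Rightarrow> 'd set"
    and act :: "'v::ab_group_add \<Rightarrow> 'd \<Rightarrow> 'v"
    and Vg :: "'g \<Rightarrow> 'v set"
    and \<phi> :: "('v \<Rightarrow> 'v) \<Rightarrow> ('v \<Rightarrow> 'v)"
  assumes D: "graded_division_algebra sD Dg"
    and D_fin_dim: "\<exists>E. finite_dimensional_vector_space sD E"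
    and V: "graded_right_module sD Dg act Vg"
    and V_nonzero: "\<exists>v::'v. v \<noteq> 0"
    and V_fin_rank: "finite_rank act"
    and phi_involution: "involution_on (End_D act) (\<circ>) (End_scale sD act) \<phi>"
    and phi_degree: "degree_preserving (End_comp act Vg) \<phi>"
    and R_phi: "central_simple_with_involution_on (End_D act) (\<circ>) id (End_scale sD act) \<phi>"
  shows
    "(\<exists>\<phi>0. involution_on UNIV (*) sD \<phi>0 \<and> degree_preserving Dg \<phi>0 \<and> same_kind act \<phi> \<phi>0) \<and>
     (\<forall>\<phi>0. involution_on UNIV (*) sD \<phi>0 \<and> degree_preserving Dg \<phi>0 \<and> same_kind act \<phi> \<phi>0 \<longrightarrow>
        (\<exists>B. B \<in> adjoint_forms sD Dg act Vg \<phi> \<phi>0) \<and>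
        (central_simple_on (End_D act) (\<circ>) id (End_scale sD act) \<and> CHAR('f) \<noteq> 2 \<longrightarrow>
           unique_up_to_factor sD (adjoint_forms sD Dg act Vg \<phi> \<phi>0) \<and>
           (\<forall>B\<in>adjoint_forms sD Dg act Vg \<phi> \<phi>0.
              (orthogonal_type (End_D act) (\<circ>) id (End_scale sD act) \<phi> \<and> orthogonal_type UNIV (*) 1 sD \<phi>0 \<or>
               symplectic_type (End_D act) (\<circ>) id (End_scale sD act) \<phi> \<and> symplectic_type UNIV (*) 1 sD \<phi>0
                 \<longrightarrow> hermitian \<phi>0 B) \<and>
              (orthogonal_type (End_D act) (\<circ>) id (End_scale sD act) \<phi> \<and> symplectic_type UNIV (*) 1 sD \<phi>0 \<or>
               symplectic_type (End_D act) (\<circ>) id (End_scale sD act) \<phi> \<and> orthogonal_type UNIV (*) 1 sD \<phi>0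
                 \<longrightarrow> skew_hermitian \<phi>0 B))) \<and>
        (central_simple_on (End_D act) (\<circ>) id (End_scale sD act) \<and> CHAR('f) = 2 \<longrightarrow>
           unique_up_to_factor sD (adjoint_forms sD Dg act Vg \<phi> \<phi>0) \<and>
           (\<forall>B\<in>adjoint_forms sD Dg act Vg \<phi> \<phi>0. hermitian \<phi>0 B)) \<and>
        (\<not> central_simple_on (End_D act) (\<circ>) id (End_scale sD act) \<longrightarrow>
           (\<exists>B\<in>adjoint_forms sD Dg act Vg \<phi> \<phi>0. hermitian \<phi>0 B) \<and>
           unique_up_to_factor sD {B \<in> adjoint_forms sD Dg act Vg \<phi> \<phi>0. hermitian \<phi>0 B}))"
proof -
  interpret D: graded_division_algebra sD Dg by (rule D)
  interpret V: graded_right_module sD Dg act Vg by (rule V)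
  interpret M: module_involution sD Dg act Vg \<phi>
    by unfold_locales (fact V_nonzero V_fin_rank phi_involution phi_degree)+
  obtain f v1 w1 B0 \<delta> where base: "base_form sD Dg act Vg \<phi> f v1 w1 B0 \<delta>"
  proof (rule M.base_form_exists)
    fix f :: "'v \<Rightarrow> 'd" and v1 w1 B0 \<delta>
    assume "\<And>v w. f (v + w) = f v + f w" "\<And>v d. f (act v d) = f v * d" "f v1 = 1"
      "\<exists>g. v1 \<in> Vg g" "\<exists>g. w1 \<in> Vg g"
      "\<And>v v' w. B0 (v + v') w = B0 v w + B0 v' w"
      "\<And>v w w'. B0 v (w + w') = B0 v w + B0 v w'"
      "\<And>v w d. B0 v (act w d) = B0 v w * d"
      "\<And>a v w. a \<in> End_D act \<Longrightarrow> B0 (a v) w = B0 v (\<phi> a w)"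
      "homogeneous_form Dg Vg B0" "B0 v1 w1 = 1"
      "\<And>v w. \<phi> (\<lambda>x. act v (f x)) w = act w1 (B0 v w)"
      "\<delta> = 1 \<or> \<delta> = - 1" "\<And>v w. B0 (act v1 (B0 v w)) w1 = B0 w v * \<delta>"
    then have "base_form sD Dg act Vg \<phi> f v1 w1 B0 \<delta>"
      by (intro base_form.intro base_form_axioms.intro M.module_involution_axioms)
    then show thesis by (rule that)
  qed
  interpret base_form sD Dg act Vg \<phi> f v1 w1 B0 \<delta> by (rule base)
  have exists: "\<exists>\<phi>0. involution_on UNIV (*) sD \<phi>0 \<and> degree_preserving Dg \<phi>0 \<and> same_kind act \<phi> \<phi>0"
    using psi_involution psi_same_kind psi_homogeneous unfolding degree_preserving_def by blast
  show ?thesis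
  proof (rule conjI[OF exists], intro allI impI)
    fix \<phi>0 assume "involution_on UNIV (*) sD \<phi>0 \<and> degree_preserving Dg \<phi>0 \<and> same_kind act \<phi> \<phi>0"
    then interpret C: compatible_involution sD Dg act Vg \<phi> f v1 w1 B0 \<delta> \<phi>0
      by unfold_locales (use D_fin_dim R_phi in simp_all)
    \<comment> \<open>Failure of central simplicity means that \<open>\<phi>0\<close> moves some
      central element, the input of the Hilbert 90 argument.\<close>
    have not_cs: "\<exists>B\<in>C.forms. hermitian \<phi>0 B"
      if "\<not> central_simple_on (End_D act) (\<circ>) id (End_scale sD act)"
      using C.central_simple_if_fixed_centre C.hermitian_exists that by blast
    show "(\<exists>B. B \<in> adjoint_forms sD Dg act Vg \<phi> \<phi>0) \<and>
        (central_simple_on (End_D act) (\<circ>) id (End_scale sD act) \<and> CHAR('f) \<noteq> 2 \<longrightarrow>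
           unique_up_to_factor sD (adjoint_forms sD Dg act Vg \<phi> \<phi>0) \<and>
           (\<forall>B\<in>adjoint_forms sD Dg act Vg \<phi> \<phi>0.
              (orthogonal_type (End_D act) (\<circ>) id (End_scale sD act) \<phi> \<and> orthogonal_type UNIV (*) 1 sD \<phi>0 \<or>
               symplectic_type (End_D act) (\<circ>) id (End_scale sD act) \<phi> \<and> symplectic_type UNIV (*) 1 sD \<phi>0
                 \<longrightarrow> hermitian \<phi>0 B) \<and>
              (orthogonal_type (End_D act) (\<circ>) id (End_scale sD act) \<phi> \<and> symplectic_type UNIV (*) 1 sD \<phi>0 \<or>
               symplectic_type (End_D act) (\<circ>) id (End_scale sD act) \<phi> \<and> orthogonal_type UNIV (*) 1 sD \<phi>0
                 \<longrightarrow> skew_hermitian \<phi>0 B))) \<and>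
        (central_simple_on (End_D act) (\<circ>) id (End_scale sD act) \<and> CHAR('f) = 2 \<longrightarrow>
           unique_up_to_factor sD (adjoint_forms sD Dg act Vg \<phi> \<phi>0) \<and>
           (\<forall>B\<in>adjoint_forms sD Dg act Vg \<phi> \<phi>0. hermitian \<phi>0 B)) \<and>
        (\<not> central_simple_on (End_D act) (\<circ>) id (End_scale sD act) \<longrightarrow>
           (\<exists>B\<in>adjoint_forms sD Dg act Vg \<phi> \<phi>0. hermitian \<phi>0 B) \<and>
           unique_up_to_factor sD {B \<in> adjoint_forms sD Dg act Vg \<phi> \<phi>0. hermitian \<phi>0 B})"
    proof (intro conjI impI)
      show "\<exists>B. B \<in> C.forms" by (rule C.forms_nonempty)
    next
      assume cs: "central_simple_on (End_D act) (\<circ>) id (End_scale sD act) \<and> CHAR('f) \<noteq> 2"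
      then show "unique_up_to_factor sD C.forms" using C.forms_unique_central by blast
      show "\<forall>B\<in>C.forms.
          (orthogonal_type (End_D act) (\<circ>) id (End_scale sD act) \<phi> \<and> orthogonal_type UNIV (*) 1 sD \<phi>0 \<or>
           symplectic_type (End_D act) (\<circ>) id (End_scale sD act) \<phi> \<and> symplectic_type UNIV (*) 1 sD \<phi>0
             \<longrightarrow> hermitian \<phi>0 B) \<and>
          (orthogonal_type (End_D act) (\<circ>) id (End_scale sD act) \<phi> \<and> symplectic_type UNIV (*) 1 sD \<phi>0 \<or>
           symplectic_type (End_D act) (\<circ>) id (End_scale sD act) \<phi> \<and> orthogonal_type UNIV (*) 1 sD \<phi>0
             \<longrightarrow> skew_hermitian \<phi>0 B)"
      proof (intro ballI conjI impI)
        fix B assume B: "B \<in> C.forms"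
        note same = C.types_equal_hermitian[OF cs[THEN conjunct1] B]
        note opposite = C.types_opposite_skew_hermitian[OF cs[THEN conjunct1] B]
        {
          assume "orthogonal_type (End_D act) (\<circ>) id (End_scale sD act) \<phi> \<and> orthogonal_type UNIV (*) 1 sD \<phi>0 \<or>
            symplectic_type (End_D act) (\<circ>) id (End_scale sD act) \<phi> \<and> symplectic_type UNIV (*) 1 sD \<phi>0"
          then show "hermitian \<phi>0 B"
            using same[of 1] same[of "- 1"] by (auto dest: orthogonal_type_sign symplectic_type_sign)
        next
          assume "orthogonal_type (End_D act) (\<circ>) id (End_scale sD act) \<phi> \<and> symplectic_type UNIV (*) 1 sD \<phi>0 \<or>
            symplectic_type (End_D act) (\<circ>) id (End_scale sD act) \<phi> \<and> orthogonal_type UNIV (*) 1 sD \<phi>0"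
          then show "skew_hermitian \<phi>0 B"
            using opposite[of 1] opposite[of "- 1"] by (auto dest: orthogonal_type_sign symplectic_type_sign)
        }
      qed
    next
      assume cs: "central_simple_on (End_D act) (\<circ>) id (End_scale sD act) \<and> CHAR('f) = 2"
      then show "unique_up_to_factor sD C.forms" "\<forall>B\<in>C.forms. hermitian \<phi>0 B"
        using C.forms_unique_central C.char_2_hermitian by blast+
    next
      assume "\<not> central_simple_on (End_D act) (\<circ>) id (End_scale sD act)"
      then show "\<exists>B\<in>C.forms. hermitian \<phi>0 B" by (rule not_cs)
      show "unique_up_to_factor sD {B \<in> C.forms. hermitian \<phi>0 B}" by (rule C.hermitian_forms_unique)
    qed
  qed
qed

end
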